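(* There is an algorithm that, given a connected graph $G$ with $n$ vertices and $m$ edges, the cyclic orderings $\rho_v$, and an initial state $\mathcal{S}_0$ of the rotor-router system with $k$ tokens, performs a preprocessing in time and space polynomial in $n$, $m$ and $\log k$, after which, for any integer $\tau\ge0$, it can answer in time $\mathcal{O}(n+m)$ either a query asking for the state $\mathcal{S}_\tau$, or a query asking, for a given arc $e$, for $\mathcal{C}_0^{\tau}(e)$ (the total number of tokens sent along $e$ during steps $0,\dots,\tau-1$).
   Context: Rotor-router model: $G=(V,E)$ is a finite connected undirected graph; its arcs are the ordered pairs $(u,v)$ with $\{u,v\}\in E$. Each vertex $v$ has a fixed cyclic ordering $\rho_v$ of its outgoing arcs, with $\mathit{next}(e)$ the successor of $e$ in $\rho_v$. A state $\mathcal{S}_t$ consists of a pointer $\mathit{pointer}_v$ (an outgoing arc of $v$) and a number of identical tokens at each vertex $v$; $k$ is the total number of tokens. In each synchronous step every vertex $v$, while it has tokens, sends one token along $\mathit{pointer}_v$ and sets $\mathit{pointer}_v:=\mathit{next}(\mathit{pointer}_v)$; tokens sent at step $t$ are at the heads of their arcs at time $t+1$. $\mathcal{L}_t(e)$ is the number of tokens sent along arc $e$ at step $t$, and $\mathcal{C}_0^{\tau}(e)=\sum_{0\le t<\tau}\mathcal{L}_t(e)$. *)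

theory Defs
  imports Complex_Main "HOL-Combinatorics.Orbits"
begin

section \<open>The rotor-router model\<close>

type_synonym 'v arc = "'v \<times> 'v"

definition arcs :: "'v set set \<Rightarrow> 'v arc set" where
  "arcs E = {(u, v). {u, v} \<in> E}"

definition connected_graph :: "'v set \<Rightarrow> 'v set set \<Rightarrow> bool" where
  "connected_graph V E \<longleftrightarrow>
     finite V \<and> V \<noteq> {} \<and> (\<forall>e\<in>E. e \<subseteq> V \<and> card e = 2) \<and>
     (\<forall>u\<in>V. \<forall>v\<in>V. (u, v) \<in> (arcs E)\<^sup>*)"

definition out_arcs :: "'v set set \<Rightarrow> 'v \<Rightarrow> 'v arc set" where
  "out_arcs E v = {e \<in> arcs E. fst e = v}"

text \<open>
  One function \<open>nxt\<close> on arcs carries the orderings of all vertices: its restriction to the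
  outgoing arcs of each vertex is a single cycle through all of them. Vertices without outgoing
  arcs are excluded, as they have no pointer; a connected graph has such a vertex only if it is
  a single vertex.
\<close>

definition cyclic_orderings :: "'v set \<Rightarrow> 'v set set \<Rightarrow> ('v arc \<Rightarrow> 'v arc) \<Rightarrow> bool" where
  "cyclic_orderings V E nxt \<longleftrightarrow> (\<forall>v\<in>V. cyclic_on nxt (out_arcs E v))"

record 'v rr_state =
  pointer :: "'v \<Rightarrow> 'v arc"
  tokens :: "'v \<Rightarrow> nat"

definition valid_state :: "'v set \<Rightarrow> 'v set set \<Rightarrow> 'v rr_state \<Rightarrow> bool" where
  "valid_state V E S \<longleftrightarrow> (\<forall>v\<in>V. pointer S v \<in> out_arcs E v)"

text \<open>
  During one step the \<open>i\<close>-th token (counting from 0) leaving \<open>v\<close> uses the arc obtained from the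
  pointer of \<open>v\<close> by advancing it \<open>i\<close> times.
\<close>

definition sent :: "('v arc \<Rightarrow> 'v arc) \<Rightarrow> 'v rr_state \<Rightarrow> 'v arc \<Rightarrow> nat" where
  "sent nxt S e = card {i. i < tokens S (fst e) \<and> (nxt ^^ i) (pointer S (fst e)) = e}"

definition rr_step :: "'v set set \<Rightarrow> ('v arc \<Rightarrow> 'v arc) \<Rightarrow> 'v rr_state \<Rightarrow> 'v rr_state" where
  "rr_step E nxt S =
     \<lparr>pointer = (\<lambda>v. (nxt ^^ tokens S v) (pointer S v)),
      tokens = (\<lambda>v. \<Sum>e\<in>{e \<in> arcs E. snd e = v}. sent nxt S e)\<rparr>"

definition state_at ::
    "'v set set \<Rightarrow> ('v arc \<Rightarrow> 'v arc) \<Rightarrow> 'v rr_state \<Rightarrow> nat \<Rightarrow> 'v rr_state" where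
  "state_at E nxt S\<^sub>0 t = (rr_step E nxt ^^ t) S\<^sub>0"

definition arc_load ::
    "'v set set \<Rightarrow> ('v arc \<Rightarrow> 'v arc) \<Rightarrow> 'v rr_state \<Rightarrow> nat \<Rightarrow> 'v arc \<Rightarrow> nat" where
  "arc_load E nxt S\<^sub>0 t e = sent nxt (state_at E nxt S\<^sub>0 t) e"

definition cumulative_load ::
    "'v set set \<Rightarrow> ('v arc \<Rightarrow> 'v arc) \<Rightarrow> 'v rr_state \<Rightarrow> nat \<Rightarrow> 'v arc \<Rightarrow> nat" where
  "cumulative_load E nxt S\<^sub>0 \<tau> e = (\<Sum>t<\<tau>. arc_load E nxt S\<^sub>0 t e)"


section \<open>A word RAM with structured control\<close>

text \<open>
  Memory consists of named arrays of natural numbers; a scalar variable is cell 0 of its array.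
  A program mentions finitely many names, so this is an ordinary random access memory laid out
  in constantly many interleaved tracks.
\<close>

type_synonym memory = "string \<Rightarrow> nat \<Rightarrow> nat"

datatype binop = Add | Sub | Mul | Div | Mod | Less | Eq

datatype expr =
    Const nat
  | Cell string expr
  | Bin binop expr expr

datatype com =
    Skip
  | Store string expr expr
  | Seq com com
  | If expr com com
  | While expr com

fun apply_binop :: "binop \<Rightarrow> nat \<Rightarrow> nat \<Rightarrow> nat" where
  "apply_binop Add a b = a + b"
| "apply_binop Sub a b = a - b"
| "apply_binop Mul a b = a * b"
| "apply_binop Div a b = a div b"
| "apply_binop Mod a b = a mod b"
| "apply_binop Less a b = (if a < b then 1 else 0)"
| "apply_binop Eq a b = (if a = b then 1 else 0)"

text \<open>
  Every value ever produced or read must be below \<open>w\<close>, that is, fit into a machine word of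
  \<open>log 2 w\<close> bits, and every array index ever accessed must be below \<open>s\<close>; otherwise evaluation
  fails. Without the bound \<open>w\<close>, unit-cost multiplication would make the cost measure
  unrealistically generous.
\<close>

fun eval :: "nat \<Rightarrow> nat \<Rightarrow> memory \<Rightarrow> expr \<Rightarrow> nat option" where
  "eval w s M (Const c) = (if c < w then Some c else None)"
| "eval w s M (Cell x a) =
     (case eval w s M a of
        None \<Rightarrow> None
      | Some i \<Rightarrow> if i < s \<and> M x i < w then Some (M x i) else None)"
| "eval w s M (Bin f a b) =
     (case (eval w s M a, eval w s M b) of
        (Some i, Some j) \<Rightarrow> if apply_binop f i j < w then Some (apply_binop f i j) else None
      | _ \<Rightarrow> None)"

fun cost :: "expr \<Rightarrow> nat" where
  "cost (Const c) = 1"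
| "cost (Cell x a) = cost a + 1"
| "cost (Bin f a b) = cost a + cost b + 1"

text \<open>
  \<open>exec w s c M t M'\<close>: started in memory \<open>M\<close>, the program \<open>c\<close> halts after \<open>t\<close> elementary
  operations in memory \<open>M'\<close>, respecting the bounds \<open>w\<close> and \<open>s\<close> throughout.
\<close>

inductive exec :: "nat \<Rightarrow> nat \<Rightarrow> com \<Rightarrow> memory \<Rightarrow> nat \<Rightarrow> memory \<Rightarrow> bool" for w s where
  exec_Skip: "exec w s Skip M 1 M"
| exec_Store:
    "eval w s M a = Some i \<Longrightarrow> i < s \<Longrightarrow> eval w s M b = Some v \<Longrightarrow>
     exec w s (Store x a b) M (cost a + cost b + 1) (M(x := (M x)(i := v)))"
| exec_Seq:
    "exec w s c\<^sub>1 M t\<^sub>1 M' \<Longrightarrow> exec w s c\<^sub>2 M' t\<^sub>2 M'' \<Longrightarrow>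
     exec w s (Seq c\<^sub>1 c\<^sub>2) M (t\<^sub>1 + t\<^sub>2) M''"
| exec_If_true:
    "eval w s M b = Some v \<Longrightarrow> v \<noteq> 0 \<Longrightarrow> exec w s c\<^sub>1 M t M' \<Longrightarrow>
     exec w s (If b c\<^sub>1 c\<^sub>2) M (cost b + 1 + t) M'"
| exec_If_false:
    "eval w s M b = Some 0 \<Longrightarrow> exec w s c\<^sub>2 M t M' \<Longrightarrow>
     exec w s (If b c\<^sub>1 c\<^sub>2) M (cost b + 1 + t) M'"
| exec_While_true:
    "eval w s M b = Some v \<Longrightarrow> v \<noteq> 0 \<Longrightarrow> exec w s c M t\<^sub>1 M' \<Longrightarrow>
     exec w s (While b c) M' t\<^sub>2 M'' \<Longrightarrow>
     exec w s (While b c) M (cost b + 1 + t\<^sub>1 + t\<^sub>2) M''"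
| exec_While_false:
    "eval w s M b = Some 0 \<Longrightarrow> exec w s (While b c) M (cost b + 1) M"

inductive_cases exec_SkipE: "exec w s Skip M t M'"
inductive_cases exec_StoreE: "exec w s (Store x a b) M t M'"
inductive_cases exec_SeqE: "exec w s (Seq c\<^sub>1 c\<^sub>2) M t M'"
inductive_cases exec_IfE: "exec w s (If b c\<^sub>1 c\<^sub>2) M t M'"
inductive_cases exec_WhileE: "exec w s (While b c) M t M'"

lemma exec_deterministic:
  "exec w s c M t M' \<Longrightarrow> exec w s c M u N \<Longrightarrow> t = u \<and> M' = N"
proof (induction arbitrary: u N rule: exec.induct)
  case (exec_Skip M)
  then show ?case by (rule exec_SkipE) simp
next
  case (exec_Store M a i b v x)
  from exec_Store.prems exec_Store.hyps show ?case by (cases rule: exec_StoreE) auto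
next
  case (exec_Seq c\<^sub>1 M t\<^sub>1 M' c\<^sub>2 t\<^sub>2 M'')
  from exec_Seq.prems obtain u\<^sub>1 N' u\<^sub>2 where
    run: "exec w s c\<^sub>1 M u\<^sub>1 N'" "exec w s c\<^sub>2 N' u\<^sub>2 N" and u: "u = u\<^sub>1 + u\<^sub>2"
    by (rule exec_SeqE)
  from exec_Seq.IH(1) [OF run(1)] have "t\<^sub>1 = u\<^sub>1" "N' = M'" by blast+
  with exec_Seq.IH(2) [of u\<^sub>2 N] run(2) u show ?case by blast
next
  case (exec_If_true M b v c\<^sub>1 t M' c\<^sub>2)
  from exec_If_true.prems exec_If_true.hyps obtain u' where
    run: "exec w s c\<^sub>1 M u' N" and u: "u = cost b + 1 + u'"
    by (cases rule: exec_IfE) auto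
  from exec_If_true.IH [OF run] u show ?case by blast
next
  case (exec_If_false M b c\<^sub>2 t M' c\<^sub>1)
  from exec_If_false.prems exec_If_false.hyps obtain u' where
    run: "exec w s c\<^sub>2 M u' N" and u: "u = cost b + 1 + u'"
    by (cases rule: exec_IfE) auto
  from exec_If_false.IH [OF run] u show ?case by blast
next
  case (exec_While_true M b v c t\<^sub>1 M' t\<^sub>2 M'')
  from exec_While_true.prems exec_While_true.hyps(1,2) obtain u\<^sub>1 N' u\<^sub>2 where
    run: "exec w s c M u\<^sub>1 N'" "exec w s (While b c) N' u\<^sub>2 N" and
    u: "u = cost b + 1 + u\<^sub>1 + u\<^sub>2"
    by (cases rule: exec_WhileE) auto
  from exec_While_true.IH(1) [OF run(1)] have "t\<^sub>1 = u\<^sub>1" "N' = M'" by blast+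
  with exec_While_true.IH(2) [of u\<^sub>2 N] run(2) u show ?case by blast
next
  case (exec_While_false M b c)
  from exec_While_false.prems exec_While_false.hyps show ?case
    by (cases rule: exec_WhileE) auto
qed


section \<open>Input, queries and answers\<close>

text \<open>
  The vertices are \<open>0, \<dots>, n - 1\<close>; the arcs are numbered by their positions in an arbitrary
  enumeration \<open>es\<close>. Cells not mentioned here may initially contain anything.
\<close>

definition encodes_arc :: "'v arc list \<Rightarrow> nat \<Rightarrow> 'v arc \<Rightarrow> bool" where
  "encodes_arc es j e \<longleftrightarrow> j < length es \<and> es ! j = e"

definition input_memory ::
    "nat \<Rightarrow> nat set set \<Rightarrow> nat arc list \<Rightarrow> (nat arc \<Rightarrow> nat arc) \<Rightarrow> nat rr_state \<Rightarrow> memory \<Rightarrow> bool"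
  where
  "input_memory n E es nxt S\<^sub>0 M \<longleftrightarrow>
     M ''n'' 0 = n \<and> M ''m'' 0 = card E \<and>
     (\<forall>j<length es. M ''tail'' j = fst (es ! j) \<and> M ''head'' j = snd (es ! j) \<and>
        encodes_arc es (M ''next'' j) (nxt (es ! j))) \<and>
     (\<forall>v<n. encodes_arc es (M ''pointer'' v) (pointer S\<^sub>0 v) \<and> M ''tokens'' v = tokens S\<^sub>0 v)"

definition output_state :: "nat \<Rightarrow> nat arc list \<Rightarrow> nat rr_state \<Rightarrow> memory \<Rightarrow> bool" where
  "output_state n es S M \<longleftrightarrow>
     (\<forall>v<n. encodes_arc es (M ''out_pointer'' v) (pointer S v) \<and> M ''out_tokens'' v = tokens S v)"

definition output_count :: "nat \<Rightarrow> memory \<Rightarrow> bool" where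
  "output_count c M \<longleftrightarrow> M ''count'' 0 = c"

definition set_scalar :: "string \<Rightarrow> nat \<Rightarrow> memory \<Rightarrow> memory" where
  "set_scalar x a M = M(x := (M x)(0 := a))"

definition pose_state_query :: "nat \<Rightarrow> memory \<Rightarrow> memory" where
  "pose_state_query \<tau> M = set_scalar ''tau'' \<tau> M"

definition pose_count_query :: "nat \<Rightarrow> nat \<Rightarrow> memory \<Rightarrow> memory" where
  "pose_count_query \<tau> j M = set_scalar ''arc'' j (set_scalar ''tau'' \<tau> M)"

text \<open>
  The memories that can arise from the preprocessed memory \<open>M\<^sub>0\<close> by answering finitely many
  queries, where \<open>w \<tau>\<close> bounds the words during a query about time \<open>\<tau>\<close>, \<open>qs\<close> and \<open>qc\<close> are the
  programs for the two kinds of queries, and \<open>l\<close> is the number of arcs. The queries have no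
  space bound of their own: indices only have to fit into a word.
\<close>

inductive after_queries ::
    "(nat \<Rightarrow> nat) \<Rightarrow> com \<Rightarrow> com \<Rightarrow> nat \<Rightarrow> memory \<Rightarrow> memory \<Rightarrow> bool" for w qs qc l M\<^sub>0 where
  none: "after_queries w qs qc l M\<^sub>0 M\<^sub>0"
| state_query:
    "after_queries w qs qc l M\<^sub>0 M \<Longrightarrow>
     exec (w \<tau>) (w \<tau>) qs (pose_state_query \<tau> M) t M' \<Longrightarrow> after_queries w qs qc l M\<^sub>0 M'"
| count_query:
    "after_queries w qs qc l M\<^sub>0 M \<Longrightarrow> j < l \<Longrightarrow>
     exec (w \<tau>) (w \<tau>) qc (pose_count_query \<tau> j M) t M' \<Longrightarrow> after_queries w qs qc l M\<^sub>0 M'"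

end

theory Submission
  imports Defs
begin

text \<open>
  Counting tokens cumulatively turns the rotor-router system into the recurrence
  \<open>C (t + 1) e = \<lceil>(tok v + (\<Sum>f into v. C t f) - pos e) / deg v\<rceil>\<close> for the arcs \<open>e\<close> leaving \<open>v\<close>.
  The loads of the arcs leaving a vertex during any time window differ by at most 1, whereas their sum
  is that of the loads of the incoming arcs during the preceding window. Hence for every window length
  the sum of squared window loads never increases, and it strictly decreases as long as some vertex has
  incoming arcs whose window loads differ by 2 or more.

  While the loads are far apart, the potential for windows of length 1 forces the spread to halve every
  \<open>O(l\<^sup>5)\<close> steps, where \<open>l = 2 m\<close>; this costs the factor \<open>log k\<close>. Afterwards the potentials of all
  windows of length at most \<open>W = 2 l\<^sup>2\<close> are polynomial, so within polynomially many steps there is a block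
  of \<open>W\<close> steps without any decrease. During this block the cumulative loads of the arcs entering a vertex
  are linearly ordered and form a staircase, just as those of the leaving arcs do. Matching the
  two staircases gives a permutation \<open>pred\<close> of the arcs along which the loads are passed on, and since
  orbits have length at most \<open>l\<close> and the block has length \<open>2 l\<^sup>2\<close>, this continues forever.

  The algorithm therefore simulates until a polynomial horizon \<open>T\<close> that is certainly past that
  block, reads off \<open>pred\<close> from the next \<open>W\<close> steps, and stores the cumulative loads up to \<open>T\<close> and prefix sums
  of the loads along the orbits of \<open>pred\<close>. A later cumulative load then takes a division with remainder by
  the orbit length, and the cumulative loads of all arcs determine the state.
\<close>

section \<open>Staircases\<close>

text \<open>Balance of single steps says nothing about the order of cumulative loads: differences of
  1 could add up or alternate. Balance of every window inside one block does: the difference of two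
  cumulative loads then changes by at most 1 between any two times of the block, so once it is
  positive it is nowhere negative. Hence one order of the entering arcs serves the whole block.

  Windows longer than one step are considered only after the spread s has dropped to 2 l^2. Their
  potentials are of order l (i s)^2 for length i, and with s = k the search for a settled block
  would take a number of steps polynomial in k. Halving the spread first is what brings this down to
  log k.

  The program never tests whether the system is settled. Settledness persists, so the explicit time
  (g + 1) l^20 with k < 2^g can be used, however early the system settles. The exponents 20, 44 and
  100 are generous roundings that keep the estimates short.\<close>

definition stair :: "nat \<Rightarrow> nat \<Rightarrow> nat \<Rightarrow> nat" where
  "stair d X p = (X + (d - 1 - p)) div d"

lemma stair_eq:
  assumes "r < d" "p < d"
  shows "stair d (d * q + r) p = q + (if p < r then 1 else 0)"
proof -
  have "stair d (d * q + r) p = q + (r + (d - 1 - p)) div d"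
    using assms by (simp only: stair_def add.assoc) (subst mult.commute, subst div_mult_self3, auto)
  moreover have "(r + (d - 1 - p)) div d = (if p < r then 1 else 0)"
  proof (cases "p < r")
    case True
    then have "r + (d - 1 - p) = (r - 1 - p) + 1 * d"
      using assms by simp
    moreover have "((r - 1 - p) + 1 * d) div d = 1"
      using assms by (subst div_mult_self1) auto
    ultimately show ?thesis
      using True by simp
  next
    case False
    then show ?thesis
      using assms by simp
  qed
  ultimately show ?thesis
    by simp
qed

lemma stair_cases:
  assumes "p < d"
  shows "stair d X p = X div d + (if p < X mod d then 1 else 0)"
  using stair_eq[of "X mod d" d p "X div d"] assms by simp

lemma sum_stair:
  assumes "0 < d"
  shows "(\<Sum>p<d. stair d X p) = X"
proof -
  have "(\<Sum>p<d. stair d X p) = (\<Sum>p<d. X div d + (if p < X mod d then 1 else 0))"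
    by (rule sum.cong) (auto simp: stair_cases)
  also have "\<dots> = d * (X div d) + card {p. p < d \<and> p < X mod d}"
    by (simp add: sum.distrib sum.If_cases Int_def)
  also have "{p. p < d \<and> p < X mod d} = {..<X mod d}"
    using assms by (auto intro: less_trans)
  finally show ?thesis
    by simp
qed

lemma stair_mono: "X \<le> Y \<Longrightarrow> stair d X p \<le> stair d Y p"
  by (simp add: stair_def div_le_mono)

lemma stair_0: "p < d \<Longrightarrow> stair d 0 p = 0"
  by (simp add: stair_cases)

text \<open>Values that never increase along the ranks and span at most 1 are q + 1 up to some rank
  and q from there on, so division with remainder recovers all of them from their sum. This is how a
  mere order of arcs becomes exact loads.\<close>

lemma stair_unique:
  assumes "0 < d" and "bij_betw rk I {..<d}"
    and st: "\<And>f f'. f \<in> I \<Longrightarrow> f' \<in> I \<Longrightarrow> rk f < rk f' \<Longrightarrow> g f' \<le> g f \<and> g f \<le> g f' + 1"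
    and "f \<in> I"
  shows "g f = stair d (sum g I) (rk f)"
proof -
  let ?iv = "the_inv_into I rk"
  define G where "G = (\<lambda>p. g (?iv p))"
  have bij': "bij_betw ?iv {..<d} I"
    using assms(2) by (rule bij_betw_the_inv_into)
  have rk_iv: "rk (?iv p) = p" if "p < d" for p
    using assms(2) that f_the_inv_into_f_bij_betw by (metis lessThan_iff)
  have iv_I: "?iv p \<in> I" if "p < d" for p
    using bij' that by (auto simp: bij_betw_def)
  have G: "G p' \<le> G p \<and> G p \<le> G p' + 1" if "p < p'" "p' < d" for p p'
    using st[OF iv_I[of p] iv_I[of p']] that by (auto simp: G_def rk_iv)
  have sum: "sum g I = (\<Sum>p<d. G p)"
    unfolding G_def by (rule sum.reindex_bij_betw[OF bij', symmetric])
  \<comment> \<open>The smallest value sits at the last rank; \<open>r\<close> is the first rank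
    that attains it.\<close>
  define q where "q = G (d - 1)"
  define r where "r = (LEAST p. G p = q)"
  have "G r = q" and "r \<le> d - 1"
    unfolding r_def by (rule LeastI[of _ "d - 1"], simp add: q_def, rule Least_le, simp add: q_def)
  have q_le: "q \<le> G p \<and> G p \<le> q + 1" if "p < d" for p
    using G[of p "d - 1"] that by (cases "p = d - 1") (auto simp: q_def)
  have Gp: "G p = q + (if p < r then 1 else 0)" if "p < d" for p
  proof (cases "p < r")
    case True
    then have "G p \<noteq> q"
      unfolding r_def using not_less_Least by blast
    then show ?thesis
      using q_le[OF that] True by auto
  next
    case False
    then have "G p \<le> G r"
      using G[of r p] that by (cases "p = r") auto
    then show ?thesis
      using q_le[OF that] False \<open>G r = q\<close> by auto
  qed
  have "sum g I = (\<Sum>p<d. q + (if p < r then 1 else 0))"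
    unfolding sum by (rule sum.cong) (auto simp: Gp)
  also have "\<dots> = d * q + card {p. p < d \<and> p < r}"
    by (simp add: sum.distrib sum.If_cases Int_def)
  also have "{p. p < d \<and> p < r} = {..<r}"
    using \<open>r \<le> d - 1\<close> assms(1) by auto
  finally have "sum g I = d * q + r"
    by simp
  moreover have "rk f < d"
    using assms(2,4) by (auto simp: bij_betw_def)
  moreover have "g f = G (rk f)"
    using assms(2,4) by (simp add: G_def bij_betw_def the_inv_into_f_f)
  ultimately show ?thesis
    using \<open>r \<le> d - 1\<close> assms(1) by (simp add: Gp stair_eq)
qed

section \<open>Staircases after a shift of the rotor\<close>

lemma rotate_diff:
  fixes p r d :: nat
  assumes "p < d" "r < d"
  shows "(p + d - r) mod d = (if p < r then p + d - r else p - r)"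
proof (cases "p < r")
  case True
  then show ?thesis
    using assms by simp
next
  case False
  then have "p + d - r = (p - r) + d"
    by simp
  then have "(p + d - r) mod d = (p - r) mod d"
    by (simp only: mod_add_self2)
  then show ?thesis
    using False assms by simp
qed

text \<open>After U tokens the rotor stands at port \<open>U mod d\<close>, and dealing X more is a
  fresh deal with ports counted from there. Hence loads in any time window form a staircase too. The
  summand \<open>d\<close> keeps the natural subtraction from truncating.\<close>

lemma stair_add:
  assumes "p < d"
  shows "stair d (U + X) p = stair d U p + stair d X ((p + d - U mod d) mod d)"
proof -
  define q r where "q = U div d" and "r = U mod d"
  have U: "U = q * d + r" and r: "r < d"
    using assms by (simp_all add: q_def r_def)
  have "stair d (U + X) p = q + stair d (r + X) p"
    using assms unfolding stair_def U add.assoc by (subst div_mult_self3) auto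
  moreover have "stair d (r + X) p =
      (if p < r then 1 else 0) + stair d X (if p < r then p + d - r else p - r)"
  proof (cases "p < r")
    case True
    then have "r + X + (d - 1 - p) = (X + (d - 1 - (p + d - r))) + 1 * d"
      using r by linarith
    then show ?thesis
      using True r unfolding stair_def by (simp only: div_mult_self1) simp
  next
    case False
    then have "r + X + (d - 1 - p) = X + (d - 1 - (p - r))"
      using assms by linarith
    then show ?thesis
      using False unfolding stair_def by (simp only: if_False add_0_left)
  qed
  ultimately show ?thesis
    using stair_cases[OF assms, of U] rotate_diff[OF assms r]
    by (simp add: q_def[symmetric] r_def[symmetric])
qed

text \<open>The origin of \<open>stair\<close>: dealing tokens cyclically to d ports gives port p
  the ceiling of (U - p) / d of them. The definition adds \<open>d - 1 - p\<close> before dividing,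
  which avoids negative numbers.\<close>

lemma card_mod_eq_stair:
  assumes "p < d"
  shows "card {i. i < U \<and> i mod d = p} = stair d U p"
proof (induction U)
  case 0
  then show ?case
    using assms by (simp add: stair_0)
next
  case (Suc U)
  have *: "{i. i < Suc U \<and> i mod d = p} =
      (if U mod d = p then insert U {i. i < U \<and> i mod d = p} else {i. i < U \<and> i mod d = p})"
    by (auto simp: less_Suc_eq)
  define r where "r = U mod d"
  have r: "r < d"
    using assms by (simp add: r_def)
  have "stair d (Suc U) p = stair d U p + stair d 1 ((p + d - r) mod d)"
    using stair_add[OF assms, of U 1] by (simp add: r_def)
  also have "stair d 1 ((p + d - r) mod d) = (if r = p then 1 else 0)"
    using assms r unfolding rotate_diff[OF assms r]
    by (cases "d = 1") (auto simp: stair_cases)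
  finally show ?case
    by (simp add: * Suc.IH r_def)
qed

section \<open>Rotor dynamics and the quadratic potentials\<close>

text \<open>The graph is reduced to arithmetic on arc numbers. \<open>pos\<close> stands for the
  port of an arc counted from the initial pointer of its tail, and \<open>outs_ex\<close> keeps all
  divisors positive.\<close>

locale rotor_network =
  fixes n l :: nat and src dst rev pos tok :: "nat \<Rightarrow> nat"
  assumes src_less: "j < l \<Longrightarrow> src j < n"
    and rev_less: "j < l \<Longrightarrow> rev j < l"
    and rev_rev: "j < l \<Longrightarrow> rev (rev j) = j"
    and src_rev: "j < l \<Longrightarrow> src (rev j) = dst j"
    and pos_bij: "v < n \<Longrightarrow> bij_betw pos {j. j < l \<and> src j = v} {..<card {j. j < l \<and> src j = v}}"
    and outs_ex: "v < n \<Longrightarrow> \<exists>j<l. src j = v"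
    and l_ge: "2 \<le> l"
begin

definition outs :: "nat \<Rightarrow> nat set" where "outs v = {j. j < l \<and> src j = v}"
definition ins :: "nat \<Rightarrow> nat set" where "ins v = {j. j < l \<and> dst j = v}"
definition deg :: "nat \<Rightarrow> nat" where "deg v = card (outs v)"

lemma finite_outs [simp]: "finite (outs v)" and finite_ins [simp]: "finite (ins v)"
  by (simp_all add: outs_def ins_def)

lemma dst_rev: "j < l \<Longrightarrow> dst (rev j) = src j"
  by (metis rev_less rev_rev src_rev)

lemma dst_less: "j < l \<Longrightarrow> dst j < n"
  by (metis rev_less src_less src_rev)

text \<open>Undirectedness enters here: equal in- and out-degrees make sums of squares over the two
  sides of a vertex comparable.\<close>

lemma rev_bij_ins: "bij_betw rev (outs v) (ins v)"
  by (rule bij_betwI[of _ _ _ rev]) (auto simp: outs_def ins_def rev_less rev_rev src_rev dst_rev)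

lemma card_ins: "card (ins v) = deg v"
  unfolding deg_def by (rule bij_betw_same_card[OF rev_bij_ins, symmetric])

lemma card_outs: "card (outs v) = deg v"
  by (simp add: deg_def)

lemma deg_pos: "e < l \<Longrightarrow> 0 < deg (src e)"
  by (auto simp: deg_def card_gt_0_iff outs_def)

lemma deg_le: "deg v \<le> l"
proof -
  have "outs v \<subseteq> {..<l}"
    by (auto simp: outs_def)
  from card_mono[OF _ this] show ?thesis
    by (simp add: deg_def)
qed

lemma pos_bij_outs: "v < n \<Longrightarrow> bij_betw pos (outs v) {..<deg v}"
  using pos_bij by (simp add: outs_def deg_def)

lemma pos_less: "e < l \<Longrightarrow> pos e < deg (src e)"
  using pos_bij_outs[OF src_less] by (auto simp: bij_betw_def outs_def)

text \<open>\<open>C t e\<close> is the load of \<open>e\<close> accumulated during the first \<open>t\<close> steps, and \<open>U t v\<close> the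
  number of tokens that have left \<open>v\<close> by then: they are the tokens that started at \<open>v\<close>
  or reached it one step earlier.\<close>

fun C :: "nat \<Rightarrow> nat \<Rightarrow> nat" where
  "C 0 e = 0"
| "C (Suc t) e = stair (deg (src e)) (tok (src e) + (\<Sum>f\<in>ins (src e). C t f)) (pos e)"

fun U :: "nat \<Rightarrow> nat \<Rightarrow> nat" where
  "U 0 v = 0"
| "U (Suc t) v = tok v + (\<Sum>f\<in>ins v. C t f)"

definition L :: "nat \<Rightarrow> nat \<Rightarrow> nat" where
  "L t e = C (Suc t) e - C t e"

lemma C_eq_stair: "e < l \<Longrightarrow> C t e = stair (deg (src e)) (U t (src e)) (pos e)"
  by (cases t) (simp_all add: stair_0 pos_less)

lemma C_mono_Suc: "C t e \<le> C (Suc t) e"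
proof (induction t arbitrary: e)
  case (Suc t)
  have "tok (src e) + (\<Sum>f\<in>ins (src e). C t f) \<le> tok (src e) + (\<Sum>f\<in>ins (src e). C (Suc t) f)"
    by (intro add_left_mono sum_mono Suc.IH)
  then show ?case
    unfolding C.simps(2)[of "Suc t"] C.simps(2)[of t e] by (rule stair_mono)
qed simp

lemma C_mono: "s \<le> t \<Longrightarrow> C s e \<le> C t e"
  by (rule lift_Suc_mono_le[of "\<lambda>t. C t e"]) (rule C_mono_Suc)

lemma U_mono: "s \<le> t \<Longrightarrow> U s v \<le> U t v"
  by (cases s; cases t) (auto intro!: sum_mono C_mono)

lemma C_Suc_L: "C (Suc t) e = C t e + L t e"
  using C_mono_Suc[of t e] by (simp add: L_def)

lemma deg_pos': "v < n \<Longrightarrow> 0 < deg v"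
  using outs_ex deg_pos by blast

lemma sum_outs_C:
  assumes "v < n"
  shows "(\<Sum>e\<in>outs v. C t e) = U t v"
proof -
  have "(\<Sum>e\<in>outs v. C t e) = (\<Sum>e\<in>outs v. stair (deg v) (U t v) (pos e))"
    by (rule sum.cong) (auto simp: outs_def C_eq_stair)
  also have "\<dots> = (\<Sum>p<deg v. stair (deg v) (U t v) p)"
    by (rule sum.reindex_bij_betw[OF pos_bij_outs[OF assms]])
  finally show ?thesis
    using sum_stair[OF deg_pos'[OF assms]] by simp
qed

lemma sum_over_outs: "(\<Sum>e<l. g e) = (\<Sum>v<n. \<Sum>e\<in>outs v. g e)" for g :: "nat \<Rightarrow> 'b::comm_monoid_add"
  using sum.group[of "{..<l}" "{..<n}" src g] src_less by (simp add: outs_def image_subset_iff)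

lemma sum_over_ins: "(\<Sum>e<l. g e) = (\<Sum>v<n. \<Sum>e\<in>ins v. g e)" for g :: "nat \<Rightarrow> 'b::comm_monoid_add"
  using sum.group[of "{..<l}" "{..<n}" dst g] dst_less by (simp add: ins_def image_subset_iff)

text \<open>Every token moves in every step. The bounds derived from this, \<open>U_le\<close> and
  \<open>C_le\<close>, later control the sizes of machine words.\<close>

lemma sum_U: "(\<Sum>v<n. U t v) = t * (\<Sum>v<n. tok v)"
proof (induction t)
  case (Suc t)
  have "(\<Sum>v<n. U (Suc t) v) = (\<Sum>v<n. tok v) + (\<Sum>v<n. \<Sum>f\<in>ins v. C t f)"
    by (simp add: sum.distrib)
  also have "(\<Sum>v<n. \<Sum>f\<in>ins v. C t f) = (\<Sum>v<n. \<Sum>f\<in>outs v. C t f)"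
    using sum_over_ins[of "C t"] sum_over_outs[of "C t"] by simp
  also have "\<dots> = (\<Sum>v<n. U t v)"
    by (rule sum.cong) (auto simp: sum_outs_C)
  finally show ?case
    by (simp add: Suc.IH)
qed simp

lemma U_le: "v < n \<Longrightarrow> U t v \<le> t * (\<Sum>v<n. tok v)"
  using member_le_sum[of v "{..<n}" "U t"] by (simp add: sum_U)

lemma C_le: "e < l \<Longrightarrow> C t e \<le> t * (\<Sum>v<n. tok v)"
  using member_le_sum[of e "outs (src e)" "C t"] sum_outs_C[OF src_less, of e t]
    U_le[OF src_less, of e t] by (simp add: outs_def)

section \<open>Window loads and their quadratic potential\<close>

definition win :: "nat \<Rightarrow> nat \<Rightarrow> nat \<Rightarrow> int" where
  "win t i e = int (C (t + i) e) - int (C t e)"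

lemma win_1: "win t (Suc 0) e = int (L t e)"
  by (simp add: win_def C_Suc_L del: C.simps)

lemma win_out_stair:
  assumes "e < l"
  shows "win t i e = int (stair (deg (src e)) (U (t + i) (src e) - U t (src e))
    ((pos e + deg (src e) - U t (src e) mod deg (src e)) mod deg (src e)))"
proof -
  have "U t (src e) \<le> U (t + i) (src e)"
    by (rule U_mono) simp
  then have "U (t + i) (src e) = U t (src e) + (U (t + i) (src e) - U t (src e))"
    by simp
  then have "C (t + i) e = C t e + stair (deg (src e)) (U (t + i) (src e) - U t (src e))
    ((pos e + deg (src e) - U t (src e) mod deg (src e)) mod deg (src e))"
    using stair_add[OF pos_less[OF assms], of "U t (src e)" "U (t + i) (src e) - U t (src e)"]
    unfolding C_eq_stair[OF assms] by (simp only:)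
  then show ?thesis
    by (simp add: win_def)
qed

text \<open>The floor of the mean load of the leaving arcs: by \<open>win_out\<close> each of them
  carries this value or one more.\<close>

definition quot :: "nat \<Rightarrow> nat \<Rightarrow> nat \<Rightarrow> int" where
  "quot t i v = int ((U (t + i) v - U t v) div deg v)"

lemma win_out:
  assumes "e \<in> outs v"
  shows "win t i e = quot t i v \<or> win t i e = quot t i v + 1"
proof -
  have "e < l" "src e = v"
    using assms by (auto simp: outs_def)
  moreover have "x mod deg (src e) < deg (src e)" for x
    using deg_pos[OF \<open>e < l\<close>] by simp
  ultimately show ?thesis
    by (simp add: win_out_stair stair_cases quot_def)
qed

text \<open>Tokens arriving in a window leave in the window one step later; the tokens initially at
  v cancel from the difference.\<close>

lemma sum_ins_win:
  assumes "v < n"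
  shows "(\<Sum>f\<in>ins v. win t i f) = (\<Sum>e\<in>outs v. win (Suc t) i e)"
proof -
  have "(\<Sum>e\<in>outs v. win (Suc t) i e) = int (\<Sum>e\<in>outs v. C (Suc (t + i)) e) - int (\<Sum>e\<in>outs v. C (Suc t) e)"
    by (simp add: win_def sum_subtractf)
  also have "\<dots> = int (U (Suc (t + i)) v) - int (U (Suc t) v)"
    by (simp only: sum_outs_C[OF assms])
  finally show ?thesis
    by (simp add: win_def sum_subtractf)
qed

text \<open>With q the floor of the mean, (x - q)(x - q - 1) is nonnegative for integers x and
  vanishes exactly at q and q + 1, the values found on the leaving arcs one step later. The sum is
  the exact loss of squares in \<open>pot_step\<close>.\<close>

definition defect :: "nat \<Rightarrow> nat \<Rightarrow> int" where
  "defect t i = (\<Sum>f<l. (win t i f - quot (Suc t) i (dst f)) * (win t i f - quot (Suc t) i (dst f) - 1))"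

lemma int_mult_pred_nonneg: "0 \<le> x * (x - 1)" for x :: int
  by (cases "x \<le> 0") (auto simp: mult_nonpos_nonpos)

lemma defect_nonneg: "0 \<le> defect t i"
  unfolding defect_def by (intro sum_nonneg int_mult_pred_nonneg)

text \<open>A square is the defect polynomial plus an affine function of the load. The affine parts
  agree on both sides of the vertex, since degrees and total loads agree, and the defect polynomial
  vanishes on the leaving side.\<close>

lemma sum_square_outs:
  fixes \<beta> :: int
  assumes "v < n"
  shows "(\<Sum>e\<in>outs v. (\<beta> - win (Suc t) i e)\<^sup>2) = (\<Sum>f\<in>ins v. (\<beta> - win t i f)\<^sup>2)
    - (\<Sum>f\<in>ins v. (win t i f - quot (Suc t) i v) * (win t i f - quot (Suc t) i v - 1))"
proof -
  define q where "q = quot (Suc t) i v"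
  have *: "(\<beta> - x)\<^sup>2 = (x - q) * (x - q - 1) + (\<beta>\<^sup>2 - q\<^sup>2 - q) + (2 * q + 1 - 2 * \<beta>) * x" for x
    by (simp add: power2_eq_square algebra_simps)
  have "(\<Sum>e\<in>outs v. (win (Suc t) i e - q) * (win (Suc t) i e - q - 1)) = 0"
    by (rule sum.neutral) (use win_out q_def in fastforce)
  then show ?thesis
    unfolding q_def[symmetric] * sum.distrib sum_distrib_left[symmetric] sum_ins_win[OF assms]
    by (simp add: card_ins card_outs)
qed

text \<open>
  In a bipartite graph the loads of the two sides never mix, so loads are only compared with reference
  values that are constant on each class of arcs linked by common tails or heads. Reversal carries the
  classes of one step to those of the next.
\<close>

definition compat :: "(nat \<Rightarrow> int) \<Rightarrow> bool" where
  "compat b \<longleftrightarrow> (\<forall>e<l. \<forall>f<l. src e = src f \<or> dst e = dst f \<longrightarrow> b e = b f)"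

definition pot :: "(nat \<Rightarrow> int) \<Rightarrow> nat \<Rightarrow> nat \<Rightarrow> int" where
  "pot b t i = (\<Sum>e<l. (b e - win t i e)\<^sup>2)"

lemma compatD: "compat b \<Longrightarrow> e < l \<Longrightarrow> f < l \<Longrightarrow> src e = src f \<or> dst e = dst f \<Longrightarrow> b e = b f"
  unfolding compat_def by blast

lemma compat_rev:
  assumes "compat b"
  shows "compat (\<lambda>e. b (rev e))"
  unfolding compat_def
proof (intro allI impI)
  fix e f
  assume "e < l" "f < l" "src e = src f \<or> dst e = dst f"
  then show "b (rev e) = b (rev f)"
    by (intro compatD[OF assms]) (auto simp: rev_less src_rev dst_rev)
qed

lemma compat_at:
  assumes "compat b" "v < n"
  obtains \<beta> where "\<And>f. f \<in> ins v \<Longrightarrow> b f = \<beta>" "\<And>e. e \<in> outs v \<Longrightarrow> b (rev e) = \<beta>"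
proof -
  obtain j where j: "j < l" "src j = v"
    using outs_ex[OF assms(2)] by blast
  show thesis
  proof (rule that[of "b (rev j)"])
    show "b f = b (rev j)" if "f \<in> ins v" for f
      by (rule compatD[OF assms(1)]) (use that j in \<open>simp_all add: ins_def rev_less dst_rev\<close>)
    show "b (rev e) = b (rev j)" if "e \<in> outs v" for e
      by (rule compatD[OF compat_rev[OF assms(1)]]) (use that j in \<open>simp_all add: outs_def\<close>)
  qed
qed

text \<open>An arc e leaving v is judged by the value of the arcs entering v, one of which is
  \<open>rev e\<close>; this is why the reference is reversed in each step. The sum over vertices
  groups arcs by tail after the step and by head before it.\<close>

lemma pot_step:
  assumes "compat b"
  shows "pot (\<lambda>e. b (rev e)) (Suc t) i = pot b t i - defect t i"
proof -
  let ?d = "\<lambda>f. (win t i f - quot (Suc t) i (dst f)) * (win t i f - quot (Suc t) i (dst f) - 1)"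
  have "(\<Sum>e\<in>outs v. (b (rev e) - win (Suc t) i e)\<^sup>2) = (\<Sum>f\<in>ins v. (b f - win t i f)\<^sup>2 - ?d f)"
    if "v < n" for v
  proof -
    from compat_at[OF assms that] obtain \<beta> where \<beta>: "\<And>f. f \<in> ins v \<Longrightarrow> b f = \<beta>" "\<And>e. e \<in> outs v \<Longrightarrow> b (rev e) = \<beta>"
      by blast
    have "(\<Sum>e\<in>outs v. (b (rev e) - win (Suc t) i e)\<^sup>2) = (\<Sum>e\<in>outs v. (\<beta> - win (Suc t) i e)\<^sup>2)"
      by (rule sum.cong) (auto simp: \<beta>)
    also have "\<dots> = (\<Sum>f\<in>ins v. (b f - win t i f)\<^sup>2 - ?d f)"
      unfolding sum_square_outs[OF that] sum_subtractf[symmetric]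
      by (rule sum.cong) (auto simp: \<beta> ins_def)
    finally show ?thesis .
  qed
  then have "pot (\<lambda>e. b (rev e)) (Suc t) i = (\<Sum>v<n. \<Sum>f\<in>ins v. (b f - win t i f)\<^sup>2 - ?d f)"
    unfolding pot_def by (subst sum_over_outs) (rule sum.cong, simp, simp)
  also have "\<dots> = (\<Sum>f<l. (b f - win t i f)\<^sup>2 - ?d f)"
    by (rule sum_over_ins[symmetric])
  finally show ?thesis
    by (simp add: pot_def defect_def sum_subtractf)
qed

text \<open>Telescoping of \<open>pot_step\<close>, leaving a nonnegative final potential. The
  induction generalizes b, which is replaced by its reversal in each step.\<close>

lemma sum_defect_le:
  assumes "compat b"
  shows "(\<Sum>j<k. defect (t + j) i) \<le> pot b t i"
proof -
  have "(\<Sum>j<k. defect (t + j) i) \<le> pot b t i" if "compat b" for b t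
    using that
  proof (induction k arbitrary: b t)
    case 0
    show ?case
      by (simp add: pot_def sum_nonneg)
  next
    case (Suc k)
    have "(\<Sum>j<Suc k. defect (t + j) i) = defect t i + (\<Sum>j<k. defect (Suc t + j) i)"
      by (simp add: sum.lessThan_Suc_shift del: sum.lessThan_Suc)
    also have "\<dots> \<le> defect t i + pot (\<lambda>e. b (rev e)) (Suc t) i"
      by (intro add_left_mono Suc.IH compat_rev Suc.prems)
    finally show ?case
      by (simp add: pot_step[OF Suc.prems])
  qed
  then show ?thesis
    using assms by blast
qed

text \<open>For loads at distances x and y from q, twice their two defects plus 1 exceeds (x - y)^2
  by (x + y - 1)^2. The cheapest way to have a given gap is thus to lie symmetrically about q +
  1/2.\<close>

lemma defect_ge:
  assumes "e < l" "f < l" "dst e = dst f" and "win t i f + int s \<le> win t i e" and "1 \<le> s"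
  shows "int s ^ 2 - 1 \<le> 2 * defect t i"
proof -
  let ?d = "\<lambda>f. (win t i f - quot (Suc t) i (dst f)) * (win t i f - quot (Suc t) i (dst f) - 1)"
  have "e \<noteq> f"
    using assms(4,5) by auto
  then have "?d e + ?d f = sum ?d {e, f}"
    by simp
  also have "\<dots> \<le> defect t i"
    unfolding defect_def by (rule sum_mono2) (use assms in \<open>auto intro: int_mult_pred_nonneg\<close>)
  finally have "?d e + ?d f \<le> defect t i" .
  moreover define x y where "x = win t i e - quot (Suc t) i (dst f)" and "y = win t i f - quot (Suc t) i (dst f)"
  ultimately have "x * (x - 1) + y * (y - 1) \<le> defect t i"
    using assms(3) by simp
  moreover have "(x - y)\<^sup>2 \<le> 2 * (x * (x - 1) + y * (y - 1)) + 1"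
    using zero_le_power2[of "x + y - 1"] by (simp add: power2_eq_square algebra_simps)
  moreover have "(int s)\<^sup>2 \<le> (x - y)\<^sup>2"
    by (rule power_mono) (use assms(4) in \<open>auto simp: x_def y_def\<close>)
  moreover define z where "z = x * (x - 1) + y * (y - 1)"
  ultimately have "z \<le> defect t i" "(int s)\<^sup>2 \<le> 2 * z + 1"
    by (auto intro: order_trans)
  then show ?thesis
    by linarith
qed

definition balanced :: "nat \<Rightarrow> nat \<Rightarrow> bool" where
  "balanced t i \<longleftrightarrow> (\<forall>e<l. \<forall>f<l. dst e = dst f \<longrightarrow> win t i e \<le> win t i f + 1)"

text \<open>By \<open>defect_ge\<close>, a gap of 2 costs a defect of at least 3/2.\<close>

lemma balanced_if_defect:
  assumes "defect t i \<le> 0"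
  shows "balanced t i"
proof (rule ccontr)
  assume "\<not> balanced t i"
  then obtain e f where "e < l" "f < l" "dst e = dst f" "win t i f + int 2 \<le> win t i e"
    unfolding balanced_def by force
  from defect_ge[OF this] show False
    using assms by simp
qed

end

section \<open>Decay of the load differences\<close>

context rotor_network begin

definition spread :: "nat \<Rightarrow> nat \<Rightarrow> bool" where
  "spread t s \<longleftrightarrow> (\<exists>b. compat b \<and> (\<forall>e<l. b e - int s \<le> int (L t e) \<and> int (L t e) \<le> b e))"

text \<open>Leaving loads differ by at most 1, so if one of them exceeded the bound, all would reach
  it and their sum would exceed what the entering arcs can supply.\<close>

lemma out_le_if_in_le:
  fixes \<beta> :: int
  assumes "v < n" "e \<in> outs v" and "\<And>f. f \<in> ins v \<Longrightarrow> win t i f \<le> \<beta>"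
  shows "win (Suc t) i e \<le> \<beta>"
proof (rule ccontr)
  assume gt: "\<not> win (Suc t) i e \<le> \<beta>"
  have ge: "\<beta> \<le> win (Suc t) i e'" if "e' \<in> outs v" for e'
    using win_out[OF that, of "Suc t" i] win_out[OF assms(2), of "Suc t" i] gt by auto
  have "(\<Sum>e'\<in>outs v. \<beta>) < (\<Sum>e'\<in>outs v. win (Suc t) i e')"
    by (rule sum_strict_mono_ex1, simp, use ge in simp, rule bexI[OF _ assms(2)], use gt in simp)
  moreover have "(\<Sum>f\<in>ins v. win t i f) \<le> (\<Sum>f\<in>ins v. \<beta>)"
    by (rule sum_mono) (use assms(3) in auto)
  ultimately show False
    by (simp add: sum_ins_win[OF assms(1)] card_ins card_outs)
qed

lemma out_ge_if_in_ge:
  fixes \<beta> :: int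
  assumes "v < n" "e \<in> outs v" and "\<And>f. f \<in> ins v \<Longrightarrow> \<beta> \<le> win t i f"
  shows "\<beta> \<le> win (Suc t) i e"
proof (rule ccontr)
  assume gt: "\<not> \<beta> \<le> win (Suc t) i e"
  have ge: "win (Suc t) i e' \<le> \<beta>" if "e' \<in> outs v" for e'
    using win_out[OF that, of "Suc t" i] win_out[OF assms(2), of "Suc t" i] gt by auto
  have "(\<Sum>e'\<in>outs v. win (Suc t) i e') < (\<Sum>e'\<in>outs v. \<beta>)"
    by (rule sum_strict_mono_ex1, simp, use ge in simp, rule bexI[OF _ assms(2)], use gt in simp)
  moreover have "(\<Sum>f\<in>ins v. \<beta>) \<le> (\<Sum>f\<in>ins v. win t i f)"
    by (rule sum_mono) (use assms(3) in auto)
  ultimately show False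
    by (simp add: sum_ins_win[OF assms(1)] card_ins card_outs)
qed

lemma bounds_step:
  assumes "compat b" and b: "\<And>e. e < l \<Longrightarrow> b e - int s \<le> int (L t e) \<and> int (L t e) \<le> b e" and "e < l"
  shows "b (rev e) - int s \<le> int (L (Suc t) e) \<and> int (L (Suc t) e) \<le> b (rev e)"
proof -
  from compat_at[OF assms(1) src_less[OF assms(3)]] obtain \<beta>
    where \<beta>: "\<And>f. f \<in> ins (src e) \<Longrightarrow> b f = \<beta>" "\<And>e'. e' \<in> outs (src e) \<Longrightarrow> b (rev e') = \<beta>"
    by blast
  have e: "e \<in> outs (src e)"
    using assms(3) by (simp add: outs_def)
  have in_b: "\<beta> - int s \<le> win t 1 f \<and> win t 1 f \<le> \<beta>" if "f \<in> ins (src e)" for f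
    using b[of f] \<beta>(1)[OF that] that by (simp add: win_1 ins_def)
  show ?thesis
    using out_le_if_in_le[OF src_less[OF assms(3)] e, of t 1 \<beta>]
      out_ge_if_in_ge[OF src_less[OF assms(3)] e, of "\<beta> - int s" t 1] in_b \<beta>(2)[OF e]
    by (simp add: win_1)
qed

lemma spread_Suc: "spread t s \<Longrightarrow> spread (Suc t) s"
  unfolding spread_def using bounds_step compat_rev by blast

lemma spread_mono:
  assumes "spread t s" "s \<le> s'" "t \<le> t'"
  shows "spread t' s'"
proof -
  have "spread t' s"
    using assms(3,1) by (induction rule: dec_induct) (auto intro: spread_Suc)
  then show ?thesis
    unfolding spread_def using assms(2) by fastforce
qed

text \<open>A window load is a sum of i one-step loads. Their reference values are obtained from b
  by successive reversals, and adding them up multiplies the width by i.\<close>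

lemma window_bounds:
  assumes "compat b" "\<And>e. e < l \<Longrightarrow> b e - int s \<le> int (L t e) \<and> int (L t e) \<le> b e"
  shows "\<exists>b'. compat b' \<and> (\<forall>e<l. b' e - int i * int s \<le> win t i e \<and> win t i e \<le> b' e)"
  using assms
proof (induction i arbitrary: b t)
  case 0
  show ?case
    by (rule exI[of _ "\<lambda>_. 0"]) (simp add: compat_def win_def)
next
  case (Suc i)
  from Suc.IH[OF compat_rev[OF Suc.prems(1)] bounds_step[OF Suc.prems]]
  obtain b' where b': "compat b'" "\<And>e. e < l \<Longrightarrow> b' e - int i * int s \<le> win (Suc t) i e \<and> win (Suc t) i e \<le> b' e"
    by blast
  have w: "win t (Suc i) e = int (L t e) + win (Suc t) i e" for e
    by (simp add: win_def L_def C_mono_Suc of_nat_diff del: C.simps)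
  have "compat (\<lambda>e. b e + b' e)"
    unfolding compat_def
  proof (intro allI impI)
    fix e f
    assume "e < l" "f < l" "src e = src f \<or> dst e = dst f"
    then show "b e + b' e = b f + b' f"
      using compatD[OF Suc.prems(1), of e f] compatD[OF b'(1), of e f] by simp
  qed
  moreover have "\<forall>e<l. (b e + b' e) - int (Suc i) * int s \<le> win t (Suc i) e \<and> win t (Suc i) e \<le> b e + b' e"
  proof (intro allI impI)
    fix e assume "e < l"
    then show "(b e + b' e) - int (Suc i) * int s \<le> win t (Suc i) e \<and> win t (Suc i) e \<le> b e + b' e"
      using Suc.prems(2)[of e] b'(2)[of e] unfolding w by (simp add: algebra_simps)
  qed
  ultimately show ?case
    by blast
qed

text \<open>The bound does not depend on the number of steps, so long runs must contain steps with
  small defect.\<close>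

lemma sum_defect_spread:
  assumes "spread t s"
  shows "(\<Sum>j<k. defect (t + j) i) \<le> int (l * (i * s)\<^sup>2)"
proof -
  from assms obtain b where "compat b" "\<And>e. e < l \<Longrightarrow> b e - int s \<le> int (L t e) \<and> int (L t e) \<le> b e"
    unfolding spread_def by blast
  from window_bounds[OF this, of i] obtain b' where
    b': "compat b'" "\<And>e. e < l \<Longrightarrow> b' e - int i * int s \<le> win t i e \<and> win t i e \<le> b' e"
    by blast
  have "(\<Sum>j<k. defect (t + j) i) \<le> pot b' t i"
    by (rule sum_defect_le[OF b'(1)])
  also have "\<dots> \<le> (\<Sum>e<l. (int (i * s))\<^sup>2)"
    unfolding pot_def
  proof (rule sum_mono)
    fix e assume "e \<in> {..<l}"
    then show "(b' e - win t i e)\<^sup>2 \<le> (int (i * s))\<^sup>2"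
      using b'(2)[of e] by (intro power_mono) auto
  qed
  finally show ?thesis
    by simp
qed

section \<open>From differences at single vertices to the spread of whole classes\<close>

lemma win_src_le:
  assumes "e < l" "f < l" "src e = src f"
  shows "\<bar>win t i e - win t i f\<bar> \<le> 1"
  using win_out[of e "src e" t i] win_out[of f "src e" t i] assms by (auto simp: outs_def)

text \<open>Any two arcs in the same class are joined by a chain of arcs that alternately share tails
  and heads.\<close>

lemma spread_local:
  assumes d: "\<And>e f. e < l \<Longrightarrow> f < l \<Longrightarrow> dst e = dst f \<Longrightarrow> L t e \<le> L t f + \<delta>" and "1 \<le> \<delta>"
  shows "spread t (l * l * \<delta>)"
proof -
  define r where "r = {(e, f). e < l \<and> f < l \<and> (src e = src f \<or> dst e = dst f)}"
  have r_sub: "r \<subseteq> {..<l} \<times> {..<l}"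
    by (auto simp: r_def)
  then have fin: "finite r" and card: "card r \<le> l * l"
    using finite_subset card_mono[OF _ r_sub] by (auto simp: card_cartesian_product)
  have "sym r"
    by (auto simp: r_def sym_def)
  then have sym: "(f, e) \<in> r\<^sup>*" if "(e, f) \<in> r\<^sup>*" for e f
    using that by (metis symD sym_rtrancl)
  have "L t e \<le> L t f + \<delta>" if "(e, f) \<in> r" for e f
    using that d[of e f] win_src_le[of e f t 1] assms(2) by (auto simp: r_def win_1)
  then have step: "L t e \<le> L t f + k * \<delta>" if "(e, f) \<in> r ^^ k" for e f k
    using that
  proof (induction k arbitrary: f)
    case (Suc k)
    then obtain g where "(e, g) \<in> r ^^ k" "(g, f) \<in> r"
      by auto
    from Suc.IH[OF Suc.prems(1) \<open>(e, g) \<in> r ^^ k\<close>] Suc.prems(1)[OF \<open>(g, f) \<in> r\<close>] show ?case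
      by simp
  qed simp
  have near: "L t e \<le> L t f + l * l * \<delta>" if "(e, f) \<in> r\<^sup>*" for e f
  proof -
    \<comment> \<open>In a finite relation, reachability needs at most as many steps as there are
      pairs, here at most l^2.\<close>
    from that obtain k where "k \<le> card r" "(e, f) \<in> r ^^ k"
      unfolding rtrancl_finite_eq_relpow[OF fin] by blast
    with step[of e f k] card have "L t e \<le> L t f + k * \<delta>" "k \<le> l * l"
      by auto
    then have "L t e \<le> L t f + k * \<delta>" "k * \<delta> \<le> l * l * \<delta>"
      by (simp_all only: mult_right_mono)
    then show ?thesis
      by linarith
  qed
  define K where "K e = r\<^sup>* `` {e}" for e
  have K_sub: "K e \<subseteq> {..<l}" if "e < l" for e
    using that by (auto simp: K_def elim: rtranclE simp: r_def)
  have fin_K: "finite (K e)" if "e < l" for e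
    using K_sub[OF that] finite_subset by blast
  have K_refl: "e \<in> K e" for e
    by (simp add: K_def)
  \<comment> \<open>The maximum over a class is constant on the class, hence compatible, and it is
    attained, so \<open>near\<close> applies to it.\<close>
  define b where "b e = int (Max (L t ` K e))" for e
  have "compat b"
    unfolding compat_def
  proof (intro allI impI)
    fix e f
    assume "e < l" "f < l" "src e = src f \<or> dst e = dst f"
    then have "(e, f) \<in> r"
      by (simp add: r_def)
    then have "K e = K f"
      using sym by (auto simp: K_def intro: rtrancl_trans converse_rtrancl_into_rtrancl)
    then show "b e = b f"
      by (simp add: b_def)
  qed
  moreover have "b e - int (l * l * \<delta>) \<le> int (L t e) \<and> int (L t e) \<le> b e" if "e < l" for e
  proof -
    have "Max (L t ` K e) \<in> L t ` K e"
      by (rule Max_in) (use fin_K[OF that] K_refl[of e] in auto)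
    then obtain f where "f \<in> K e" "Max (L t ` K e) = L t f"
      by blast
    with near[of f e] sym[of e f] have "Max (L t ` K e) \<le> L t e + l * l * \<delta>"
      by (simp add: K_def)
    moreover have "L t e \<le> Max (L t ` K e)"
      by (rule Max_ge) (use fin_K[OF that] K_refl[of e] in auto)
    ultimately show ?thesis
      unfolding b_def by linarith
  qed
  ultimately show ?thesis
    unfolding spread_def by blast
qed

text \<open>While the spread exceeds \<open>s / 2\<close>, some vertex sees a difference of order \<open>s / l\<^sup>2\<close> among its
  incoming arcs, so that every step lowers the quadratic potential, at most \<open>l s\<^sup>2\<close>, by order
  \<open>(s / l\<^sup>2)\<^sup>2\<close>.\<close>

lemma spread_halve:
  assumes "spread t s" "2 * (l * l) \<le> s"
  shows "spread (t + 16 * l ^ 5) (s div 2)"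
proof -
  define N where "N = l * l"
  \<comment> \<open>The tolerated gap: \<open>N * \<delta> \<le> s div 2\<close> lets
    \<open>spread_local\<close> deliver half the spread, while
    \<open>s < 2 * N * (\<delta> + 1)\<close> makes larger gaps costly.\<close>
  define \<delta> where "\<delta> = s div (2 * N)"
  have N: "0 < N"
    using l_ge by (simp add: N_def)
  have \<delta>: "1 \<le> \<delta>"
    using assms(2) N by (simp add: \<delta>_def N_def div_greater_zero_iff Suc_le_eq)
  have "2 * N * \<delta> \<le> s"
    unfolding \<delta>_def by (rule times_div_less_eq_dividend)
  then have "N * \<delta> \<le> s div 2"
    unfolding mult.assoc by linarith
  have s_less: "s < 2 * N * (\<delta> + 1)"
    using N dividend_less_times_div[of "2 * N" s] by (simp add: \<delta>_def)
  show ?thesis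
  \<comment> \<open>If all these steps had a gap above \<delta>, the losses would sum to at least 4
    l^5 (\<delta> + 1)^2, but the potential provides only l s^2 < 4 l^5 (\<delta> + 1)^2. The number
    16 l^5 makes the two sides meet.\<close>
  proof (cases "\<exists>j<16 * l ^ 5. \<forall>e<l. \<forall>f<l. dst e = dst f \<longrightarrow> L (t + j) e \<le> L (t + j) f + \<delta>")
    case True
    then obtain j where "j < 16 * l ^ 5"
      and "\<And>e f. e < l \<Longrightarrow> f < l \<Longrightarrow> dst e = dst f \<Longrightarrow> L (t + j) e \<le> L (t + j) f + \<delta>"
      by blast
    have "spread (t + j) (N * \<delta>)"
      unfolding N_def by (rule spread_local[OF _ \<delta>]) fact
    then show ?thesis
      by (rule spread_mono) (use \<open>N * \<delta> \<le> s div 2\<close> \<open>j < 16 * l ^ 5\<close> in simp_all)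
  next
    case False
    \<comment> \<open>\<open>defect_ge\<close> gives half of (\<delta> + 1)^2 - 1; the subtracted 1
      is absorbed because (\<delta> + 1)^2 is at least 4.\<close>
    have "int ((\<delta> + 1)\<^sup>2) \<le> 4 * defect (t + j) 1" if "j < 16 * l ^ 5" for j
    proof -
      from False that obtain e f where "e < l" "f < l" "dst e = dst f" "\<not> L (t + j) e \<le> L (t + j) f + \<delta>"
        by blast
      then have "int (\<delta> + 1) ^ 2 - 1 \<le> 2 * defect (t + j) 1"
        by (intro defect_ge[of e f]) (auto simp: win_1)
      moreover have "2 ^ 2 \<le> int (\<delta> + 1) ^ 2"
        by (rule power_mono) (use \<delta> in auto)
      moreover have "(2::int) ^ 2 = 4"
        by simp
      ultimately have "int (\<delta> + 1) ^ 2 \<le> 4 * defect (t + j) 1"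
        by linarith
      then show ?thesis
        by (simp only: of_nat_power)
    qed
    then have "(\<Sum>j<16 * l ^ 5. int ((\<delta> + 1)\<^sup>2)) \<le> (\<Sum>j<16 * l ^ 5. 4 * defect (t + j) 1)"
      by (intro sum_mono) auto
    also have "\<dots> \<le> 4 * int (l * (1 * s)\<^sup>2)"
      unfolding sum_distrib_left[symmetric] using sum_defect_spread[OF assms(1), where k = "16 * l ^ 5" and i = 1] by simp
    finally have "int (16 * l ^ 5 * (\<delta> + 1)\<^sup>2) \<le> int (4 * (l * s\<^sup>2))"
      by simp
    then have "16 * l ^ 5 * (\<delta> + 1)\<^sup>2 \<le> 4 * (l * s\<^sup>2)"
      by (simp only: of_nat_le_iff)
    also have "\<dots> < 4 * (l * (2 * N * (\<delta> + 1))\<^sup>2)"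
      using l_ge power_strict_mono[OF s_less, of 2] by simp
    also have "\<dots> = 16 * l ^ 5 * (\<delta> + 1)\<^sup>2"
      by (simp add: N_def power2_eq_square power_def numeral_eq_Suc algebra_simps)
    finally show ?thesis
      by simp
  qed
qed

text \<open>\<open>spread_halve\<close> works only down to width 2 l^2, where the tolerated gap
  would drop below 1. Each factor 2 in the initial width costs one further round, so g is a
  logarithm of the number of tokens.\<close>

lemma spread_small:
  assumes "spread t s" "s < 2 ^ g * (2 * (l * l))"
  shows "spread (t + g * (16 * l ^ 5)) (2 * (l * l))"
  using assms
proof (induction g arbitrary: t s)
  case 0
  then show ?case
    by (auto intro: spread_mono)
next
  case (Suc g)
  show ?case
  proof (cases "s < 2 * (l * l)")
    case True
    then show ?thesis
      using Suc.prems(1) by (auto intro: spread_mono)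
  next
    case False
    then have "spread (t + 16 * l ^ 5) (s div 2)"
      by (intro spread_halve Suc.prems(1)) simp
    moreover have "s div 2 < 2 ^ g * (2 * (l * l))"
      using Suc.prems(2) by (simp add: less_mult_imp_div_less)
    ultimately show ?thesis
      using Suc.IH[of "t + 16 * l ^ 5" "s div 2"] by (simp add: add.assoc)
  qed
qed

lemma spread_0: "spread 0 (\<Sum>v<n. tok v)"
  unfolding spread_def
proof (intro exI[of _ "\<lambda>_. int (\<Sum>v<n. tok v)"] conjI allI impI)
  fix e assume "e < l"
  then show "int (L 0 e) \<le> int (\<Sum>v<n. tok v)"
    using C_le[of e 1] by (simp add: L_def del: of_nat_sum)
qed (simp_all add: compat_def)

end

section \<open>The periodic regime\<close>

lemma rank_bij:
  fixes P :: "nat \<Rightarrow> nat \<Rightarrow> bool"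
  assumes "finite I"
    and irrefl: "\<And>x. \<not> P x x" and trans: "\<And>x y z. P x y \<Longrightarrow> P y z \<Longrightarrow> P x z"
    and total: "\<And>x y. x \<in> I \<Longrightarrow> y \<in> I \<Longrightarrow> x \<noteq> y \<Longrightarrow> P x y \<or> P y x"
  shows "bij_betw (\<lambda>x. card {y \<in> I. P y x}) I {..<card I}"
    and "\<And>x y. x \<in> I \<Longrightarrow> y \<in> I \<Longrightarrow> card {z \<in> I. P z x} < card {z \<in> I. P z y} \<Longrightarrow> P x y"
proof -
  let ?rk = "\<lambda>x. card {y \<in> I. P y x}"
  have less: "?rk x < ?rk y" if "x \<in> I" "P x y" for x y
    by (rule psubset_card_mono, simp add: assms(1), use that irrefl trans in blast)
  show "P x y" if "x \<in> I" "y \<in> I" "?rk x < ?rk y" for x y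
    using total[OF that(1,2)] less[OF that(2), of x] that(3) by fastforce
  have inj: "inj_on ?rk I"
  proof (rule inj_onI, rule ccontr)
    fix x y
    assume *: "x \<in> I" "y \<in> I" "?rk x = ?rk y" "x \<noteq> y"
    from total[OF *(1,2,4)] show False
      using less[of x y] less[of y x] *(1-3) by auto
  qed
  have "?rk x < card I" if "x \<in> I" for x
    by (rule psubset_card_mono, rule assms(1), use that irrefl in blast)
  then have "?rk ` I \<subseteq> {..<card I}"
    by auto
  then have "?rk ` I = {..<card I}"
    by (rule card_subset_eq[rotated]) (simp_all add: card_image[OF inj])
  with inj show "bij_betw ?rk I {..<card I}"
    by (simp add: bij_betw_def)
qed

lemma funpow_closed: "\<forall>j<l. f j < l \<Longrightarrow> j < l \<Longrightarrow> (f ^^ i) j < (l::nat)"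
  by (induction i) auto

text \<open>Pigeonhole on l + 1 iterates gives a repetition, and injectivity strips the common
  prefix, so the orbit returns to its starting point.\<close>

lemma orbit_period:
  fixes f :: "nat \<Rightarrow> nat"
  assumes closed: "\<forall>j<l. f j < l" and inj: "inj_on f {..<l}" and "j < l"
  shows "\<exists>p. 0 < p \<and> p \<le> l \<and> (f ^^ p) j = j"
proof -
  have "(\<lambda>i. (f ^^ i) j) ` {..l} \<subseteq> {..<l}"
    using funpow_closed[OF closed assms(3)] by blast
  then have "\<not> inj_on (\<lambda>i. (f ^^ i) j) {..l}"
    using card_inj_on_le[of _ "{..l}" "{..<l}"] by fastforce
  then obtain a b where ab: "a < b" "b \<le> l" "(f ^^ a) j = (f ^^ b) j"
    by (auto simp: inj_on_def) (metis linorder_neqE_nat)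
  have "(f ^^ (b - k)) j = (f ^^ (a - k)) j" if "k \<le> a" for k
    using that
  proof (induction k)
    case (Suc k)
    then have "f ((f ^^ (b - Suc k)) j) = f ((f ^^ (a - Suc k)) j)"
      using ab(1) by (metis Suc_diff_Suc Suc_leD Suc_le_lessD comp_apply funpow.simps(2) less_trans)
    then show ?case
      using inj funpow_closed[OF closed assms(3)] by (auto dest: inj_onD)
  qed (use ab(3) in simp)
  from this[of a] have "(f ^^ (b - a)) j = j"
    by simp
  then show ?thesis
    using ab by (intro exI[of _ "b - a"]) auto
qed

lemma funpow_mult_fixed: "(f ^^ p) j = j \<Longrightarrow> (f ^^ (q * p)) j = j"
  by (induction q) (simp_all add: funpow_add)

section \<open>Settled blocks and the predecessor permutation\<close>

context rotor_network begin

definition W :: nat where "W = 2 * (l * l)"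

text \<open>Windows with any start inside the block are included, since \<open>dominance\<close>
  compares two interior times.\<close>

definition settled :: "nat \<Rightarrow> bool" where
  "settled T \<longleftrightarrow> (\<forall>t i. T \<le> t \<longrightarrow> t + i \<le> T + W \<longrightarrow> balanced t i)"

text \<open>Pigeonhole: over any number of steps, the defects of all window lengths up to W sum to
  at most M, but each of M + 1 disjoint blocks that is not settled contributes at least 1.\<close>

lemma exists_settled:
  assumes "spread t\<^sub>0 s"
  shows "\<exists>T \<ge> t\<^sub>0. T \<le> t\<^sub>0 + Suc W * (l * (W * s)\<^sup>2) * W \<and> settled T"
proof (rule ccontr)
  define M where "M = Suc W * (l * (W * s)\<^sup>2)"
  define D where "D t = (\<Sum>i\<le>W. defect t i)" for t
  assume contr: "\<not> ?thesis"
  have D_nonneg: "0 \<le> D t" for t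
    unfolding D_def by (intro sum_nonneg defect_nonneg)
  have block: "1 \<le> (\<Sum>j\<in>{b * W..<b * W + W}. D (t\<^sub>0 + j))" if "b \<le> M" for b
  proof -
    have "t\<^sub>0 + b * W \<le> t\<^sub>0 + M * W"
      using that by simp
    with contr have "\<not> settled (t\<^sub>0 + b * W)"
      unfolding M_def using le_add1 by blast
    then obtain t i where t: "t\<^sub>0 + b * W \<le> t" "t + i \<le> t\<^sub>0 + b * W + W" "\<not> balanced t i"
      unfolding settled_def by blast
    \<comment> \<open>A nonempty window starts strictly before the end of its block, so the
      half-open blocks contain all starting times.\<close>
    have "i \<noteq> 0"
    proof
      assume "i = 0"
      then have "balanced t i"
        by (simp add: balanced_def win_def)
      with t(3) show False ..
    qed
    define j where "j = t - t\<^sub>0"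
    have j: "t = t\<^sub>0 + j" "j \<in> {b * W..<b * W + W}"
      using t(1,2) \<open>i \<noteq> 0\<close> by (auto simp: j_def)
    have "1 \<le> defect t i"
      using balanced_if_defect[of t i] t(3) by force
    also have "\<dots> \<le> D t"
      unfolding D_def by (rule member_le_sum) (use t(1,2) defect_nonneg in auto)
    also have "\<dots> \<le> (\<Sum>j\<in>{b * W..<b * W + W}. D (t\<^sub>0 + j))"
      unfolding j(1) by (rule member_le_sum[of j _ "\<lambda>j. D (t\<^sub>0 + j)"]) (use j(2) D_nonneg in auto)
    finally show ?thesis .
  qed
  have "int (Suc M) = (\<Sum>b<Suc M. 1)"
    by simp
  also have "\<dots> \<le> (\<Sum>b<Suc M. \<Sum>j\<in>{b * W..<b * W + W}. D (t\<^sub>0 + j))"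
    by (rule sum_mono) (use block in auto)
  also have "\<dots> = (\<Sum>j<Suc M * W. D (t\<^sub>0 + j))"
    by (rule sum.nat_group)
  also have "\<dots> = (\<Sum>i\<le>W. \<Sum>j<Suc M * W. defect (t\<^sub>0 + j) i)"
    unfolding D_def by (rule sum.swap)
  also have "\<dots> \<le> (\<Sum>i\<le>W. int (l * (W * s)\<^sup>2))"
  proof (rule sum_mono)
    fix i assume "i \<in> {..W}"
    then have "l * (i * s)\<^sup>2 \<le> l * (W * s)\<^sup>2"
      by (intro mult_left_mono power_mono mult_right_mono) auto
    with sum_defect_spread[OF assms, where k = "Suc M * W" and i = i]
    show "(\<Sum>j<Suc M * W. defect (t\<^sub>0 + j) i) \<le> int (l * (W * s)\<^sup>2)"
      by (meson of_nat_le_iff order_trans)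
  qed
  also have "\<dots> = int M"
    by (simp add: M_def algebra_simps)
  finally show False
    by simp
qed

text \<open>
  In a settled phase the cumulative loads of two arcs entering the same vertex differ always in the same
  direction, so that comparing their sums over \<open>W\<close> steps orders the arcs. The position of \<open>e\<close> counted from the
  pointer of its tail at time \<open>T + 1\<close> is \<open>offset T e\<close>, and \<open>pred T e\<close> is the arc whose load \<open>e\<close> repeats one
  step later.
\<close>

definition score :: "nat \<Rightarrow> nat \<Rightarrow> nat" where
  "score T f = (\<Sum>\<tau><Suc W. C (T + \<tau>) f - C T f)"

text \<open>Larger scores come first because \<open>stair\<close> decreases with the position. Ties
  are broken by arc numbers to obtain a strict total order.\<close>

definition before :: "nat \<Rightarrow> nat \<Rightarrow> nat \<Rightarrow> bool" where
  "before T f' f \<longleftrightarrow> score T f < score T f' \<or> (score T f' = score T f \<and> f' < f)"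

definition rank :: "nat \<Rightarrow> nat \<Rightarrow> nat" where
  "rank T f = card {f' \<in> ins (dst f). before T f' f}"

definition offset :: "nat \<Rightarrow> nat \<Rightarrow> nat" where
  "offset T e = (pos e + deg (src e) - U (Suc T) (src e) mod deg (src e)) mod deg (src e)"

definition pred :: "nat \<Rightarrow> nat \<Rightarrow> nat" where
  "pred T e = (THE f. f \<in> ins (src e) \<and> rank T f = offset T e)"

lemma rank_bij_ins: "bij_betw (rank T) (ins v) {..<deg v}"
  and before_if_rank: "f \<in> ins v \<Longrightarrow> f' \<in> ins v \<Longrightarrow> rank T f < rank T f' \<Longrightarrow> before T f f'"
proof -
  note * = rank_bij[of "ins v" "before T"]
  have r: "rank T f = card {f' \<in> ins v. before T f' f}" if "f \<in> ins v" for f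
    using that by (simp add: rank_def ins_def)
  have "bij_betw (rank T) (ins v) {..<deg v} \<longleftrightarrow>
      bij_betw (\<lambda>f. card {f' \<in> ins v. before T f' f}) (ins v) {..<card (ins v)}"
    unfolding card_ins by (rule bij_betw_cong) (rule r)
  then show "bij_betw (rank T) (ins v) {..<deg v}"
    using *(1)[OF finite_ins] unfolding before_def by (smt (verit) linorder_less_linear order_less_trans less_irrefl)
  show "before T f f'" if "f \<in> ins v" "f' \<in> ins v" "rank T f < rank T f'"
    by (rule *(2)[OF finite_ins]) (use that in \<open>auto simp: before_def r\<close>)
qed

text \<open>Suppose f' were ahead of f at \<tau>. The window between \<tau> and any other time
  changes the difference by at most 1, so f' would never be behind in the block and would have the
  larger score.\<close>

lemma dominance:
  assumes "settled T" "f < l" "f' < l" "dst f = dst f'" "score T f' \<le> score T f" "\<tau> \<le> W"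
  shows "win T \<tau> f' \<le> win T \<tau> f \<and> win T \<tau> f \<le> win T \<tau> f' + 1"
proof
  have bal: "win t i f' \<le> win t i f + 1 \<and> win t i f \<le> win t i f' + 1" if "T \<le> t" "t + i \<le> T + W" for t i
    using assms(1-4) that unfolding settled_def balanced_def by metis
  show "win T \<tau> f \<le> win T \<tau> f' + 1"
    using bal[of T \<tau>] assms(6) by simp
  show "win T \<tau> f' \<le> win T \<tau> f"
  proof (rule ccontr)
    assume "\<not> win T \<tau> f' \<le> win T \<tau> f"
    then have neg: "win T \<tau> f < win T \<tau> f'"
      by simp
    have le: "win T \<tau>' f \<le> win T \<tau>' f'" if "\<tau>' \<le> W" for \<tau>'
    proof (cases "\<tau> \<le> \<tau>'")
      case True
      with bal[of "T + \<tau>" "\<tau>' - \<tau>"] that neg show ?thesis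
        by (simp add: win_def)
    next
      case False
      with bal[of "T + \<tau>'" "\<tau> - \<tau>'"] assms(6) neg show ?thesis
        by (simp add: win_def)
    qed
    have "int (score T f) = (\<Sum>\<tau><Suc W. win T \<tau> f)" for f
      unfolding score_def win_def of_nat_sum by (intro sum.cong refl of_nat_diff C_mono) simp
    moreover have "(\<Sum>\<tau><Suc W. win T \<tau> f) < (\<Sum>\<tau><Suc W. win T \<tau> f')"
      by (rule sum_strict_mono_ex1, simp, use le in simp, rule bexI[of _ \<tau>], rule neg, use assms(6) in simp)
    ultimately show False
      using assms(5) by (metis not_le of_nat_less_iff)
  qed
qed

lemma offset_less: "e < l \<Longrightarrow> offset T e < deg (src e)"
  by (simp add: offset_def deg_pos)

lemma offset_inj:
  assumes "e < l" "e' < l" "src e = src e'" "offset T e = offset T e'"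
  shows "e = e'"
proof -
  define d c where "d = deg (src e)" and "c = U (Suc T) (src e) mod d"
  have "c < d" "pos e < d" "pos e' < d"
    using deg_pos[OF assms(1)] pos_less[OF assms(1)] pos_less[OF assms(2)] assms(3) by (auto simp: c_def d_def)
  moreover have "(pos e + d - c) mod d = (pos e' + d - c) mod d"
    using assms(3,4) by (simp add: offset_def d_def c_def del: U.simps)
  ultimately have "pos e = pos e'"
    by (auto simp: rotate_diff split: if_splits)
  then show ?thesis
    using pos_bij_outs[OF src_less[OF assms(1)]] assms(1-3) by (auto simp: bij_betw_def outs_def dest: inj_onD)
qed

text \<open>Ranks of the entering arcs exhaust the ports, so exactly one fits the offset. The
  equivalence is the test by which the program finds \<open>pred\<close>.\<close>

lemma pred_unique:
  assumes "e < l"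
  shows "f \<in> ins (src e) \<and> rank T f = offset T e \<longleftrightarrow> f = pred T e"
proof -
  have "offset T e \<in> rank T ` ins (src e)"
    using rank_bij_ins[of T "src e"] offset_less[OF assms, of T] by (simp add: bij_betw_def)
  then obtain f\<^sub>0 where f\<^sub>0: "f\<^sub>0 \<in> ins (src e)" "rank T f\<^sub>0 = offset T e"
    by auto
  have "\<exists>!f. f \<in> ins (src e) \<and> rank T f = offset T e"
  proof (rule ex1I[of _ f\<^sub>0])
    show "f = f\<^sub>0" if "f \<in> ins (src e) \<and> rank T f = offset T e" for f
      by (rule inj_onD[OF bij_betw_imp_inj_on[OF rank_bij_ins[of T]]]) (use that f\<^sub>0 in auto)
  qed (use f\<^sub>0 in simp)
  from theI'[OF this] this show ?thesis
    unfolding pred_def by blast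
qed

lemma pred_props:
  assumes "e < l"
  shows "pred T e < l" "dst (pred T e) = src e" "rank T (pred T e) = offset T e"
  using pred_unique[OF assms, of "pred T e" T] by (auto simp: ins_def)

text \<open>The head of \<open>pred T e\<close> is the tail of e and its rank is the offset of e,
  which together determine e.\<close>

lemma pred_inj: "inj_on (pred T) {..<l}"
proof (rule inj_onI)
  fix e e'
  assume "e \<in> {..<l}" "e' \<in> {..<l}" "pred T e = pred T e'"
  then show "e = e'"
    using pred_props(2,3)[of e T] pred_props(2,3)[of e' T] offset_inj[of e e' T] by simp
qed

lemma pred_image_outs:
  assumes "f < l"
  shows "\<exists>e<l. src e = dst f \<and> pred T e = f"
proof -
  have "pred T ` {..<l} \<subseteq> {..<l}"
    using pred_props(1) by auto
  then have "pred T ` {..<l} = {..<l}"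
    by (simp add: card_subset_eq card_image[OF pred_inj])
  then obtain e where "e < l" "pred T e = f"
    using assms by (metis imageE lessThan_iff)
  then show ?thesis
    using pred_props(2)[of e T] by auto
qed

text \<open>Loads entering a vertex and loads leaving it one step later have the same sum. Both are
  staircases, one along \<open>rank\<close> and the other along \<open>offset\<close>, so arcs with
  equal position have equal loads by \<open>stair_unique\<close>.\<close>

lemma shift_if_stair:
  assumes "e < l"
    and st: "\<And>f f'. f \<in> ins (src e) \<Longrightarrow> f' \<in> ins (src e) \<Longrightarrow> rank T f < rank T f' \<Longrightarrow>
      win T \<tau> f' \<le> win T \<tau> f \<and> win T \<tau> f \<le> win T \<tau> f' + 1"
  shows "win (Suc T) \<tau> e = win T \<tau> (pred T e)"
proof -
  define g where "g f = C (T + \<tau>) f - C T f" for f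
  have g: "win T \<tau> f = int (g f)" for f
    using C_mono[of T "T + \<tau>" f] by (simp add: g_def win_def)
  have "int (sum g (ins (src e))) = (\<Sum>f\<in>ins (src e). win T \<tau> f)"
    by (simp add: g)
  also have "\<dots> = int (U (Suc T + \<tau>) (src e)) - int (U (Suc T) (src e))"
    by (simp add: win_def sum_subtractf)
  also have "\<dots> = int (U (Suc T + \<tau>) (src e) - U (Suc T) (src e))"
    by (intro of_nat_diff[symmetric] U_mono) simp
  finally have sum: "sum g (ins (src e)) = U (Suc T + \<tau>) (src e) - U (Suc T) (src e)"
    by (simp only: of_nat_eq_iff)
  have "g (pred T e) = stair (deg (src e)) (sum g (ins (src e))) (rank T (pred T e))"
  proof (rule stair_unique[OF deg_pos[OF assms(1)] rank_bij_ins])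
    show "g f' \<le> g f \<and> g f \<le> g f' + 1" if "f \<in> ins (src e)" "f' \<in> ins (src e)" "rank T f < rank T f'" for f f'
      using st[OF that] by (simp add: g)
    show "pred T e \<in> ins (src e)"
      using pred_props[OF assms(1)] by (simp add: ins_def)
  qed
  then show ?thesis
    unfolding win_out_stair[OF assms(1)] g sum pred_props(3)[OF assms(1)] offset_def by simp
qed

text \<open>If loads are passed on along \<open>pred T\<close>, the load of f at step T + s is the
  load at step T of its s-th predecessor.\<close>

definition path_load :: "nat \<Rightarrow> nat \<Rightarrow> nat \<Rightarrow> nat" where
  "path_load T \<tau> f = (\<Sum>s<\<tau>. L T ((pred T ^^ s) f))"

lemma path_load_Suc: "path_load T (Suc \<tau>) e = L T e + path_load T \<tau> (pred T e)"
  by (simp add: path_load_def sum.lessThan_Suc_shift funpow_Suc_right del: sum.lessThan_Suc funpow.simps)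

lemma path_load_add: "(pred T ^^ p) e = e \<Longrightarrow> path_load T (p + \<tau>) e = path_load T p e + path_load T \<tau> e"
  by (induction \<tau>) (simp_all add: path_load_def funpow_add add.commute[of p])

lemma win_Suc: "win T (Suc \<tau>) e = int (L T e) + win (Suc T) \<tau> e"
  by (simp add: win_def L_def C_mono_Suc of_nat_diff del: C.simps)

text \<open>The staircase premise may use the formula for the same time, since the induction has it
  available by then. This serves twice: inside the block the premise comes from
  \<open>dominance\<close>, and for all later times from properties of \<open>path_load\<close>
  alone.\<close>

lemma win_eq_path_load_if:
  assumes "\<And>\<tau> f f'. \<tau> < k \<Longrightarrow> f < l \<Longrightarrow> f' < l \<Longrightarrow> dst f = dst f' \<Longrightarrow> rank T f < rank T f' \<Longrightarrow>
      win T \<tau> f = int (path_load T \<tau> f) \<Longrightarrow> win T \<tau> f' = int (path_load T \<tau> f') \<Longrightarrow>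
      win T \<tau> f' \<le> win T \<tau> f \<and> win T \<tau> f \<le> win T \<tau> f' + 1"
  shows "\<tau> \<le> k \<Longrightarrow> e < l \<Longrightarrow> win T \<tau> e = int (path_load T \<tau> e)"
proof (induction \<tau> arbitrary: e)
  case 0
  then show ?case
    by (simp add: win_def path_load_def)
next
  case (Suc \<tau>)
  have "win (Suc T) \<tau> e = win T \<tau> (pred T e)"
    by (rule shift_if_stair[OF Suc.prems(2)])
      (rule assms, use Suc in \<open>auto simp: ins_def\<close>)
  also have "\<dots> = int (path_load T \<tau> (pred T e))"
    by (rule Suc.IH) (use Suc.prems pred_props(1) in auto)
  finally show ?case
    by (simp add: win_Suc path_load_Suc)
qed

section \<open>Persistence of the periodic regime\<close>

context
  fixes T
  assumes settled: "settled T"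
begin

lemma stair_early:
  assumes "\<tau> \<le> W" "f < l" "f' < l" "dst f = dst f'" "rank T f < rank T f'"
  shows "win T \<tau> f' \<le> win T \<tau> f \<and> win T \<tau> f \<le> win T \<tau> f' + 1"
proof (rule dominance[OF settled assms(2,3,4) _ assms(1)])
  have "before T f f'"
    by (rule before_if_rank[of _ "dst f"]) (use assms in \<open>auto simp: ins_def\<close>)
  then show "score T f' \<le> score T f"
    by (auto simp: before_def)
qed

lemma win_eq_early: "\<tau> \<le> W \<Longrightarrow> e < l \<Longrightarrow> win T \<tau> e = int (path_load T \<tau> e)"
  by (rule win_eq_path_load_if[of W], rule stair_early) simp_all

text \<open>The loads of two arcs with a common head have the common period \<open>q \<le> l\<^sup>2\<close>. A nonzero drift
  of their difference over one period would exceed 1 after two periods, that is, within \<open>W\<close> steps.\<close>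

lemma stair_path_load:
  assumes "f < l" "f' < l" "dst f = dst f'" "rank T f < rank T f'"
  shows "path_load T \<tau> f' \<le> path_load T \<tau> f \<and> path_load T \<tau> f \<le> path_load T \<tau> f' + 1"
proof -
  have closed: "\<forall>j<l. pred T j < l"
    by (simp add: pred_props(1))
  obtain p p' where p: "0 < p" "p \<le> l" "(pred T ^^ p) f = f" and p': "0 < p'" "p' \<le> l" "(pred T ^^ p') f' = f'"
    using orbit_period[OF closed pred_inj] assms(1,2) by metis
  define q where "q = p * p'"
  have q: "0 < q" "q \<le> l * l" "(pred T ^^ q) f = f" "(pred T ^^ q) f' = f'"
    using p p' funpow_mult_fixed[of p "pred T" f p'] funpow_mult_fixed[of p' "pred T" f' p]
    by (auto simp: q_def mult_le_mono mult.commute)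
  have early: "path_load T \<tau> f' \<le> path_load T \<tau> f \<and> path_load T \<tau> f \<le> path_load T \<tau> f' + 1" if "\<tau> \<le> W" for \<tau>
    using stair_early[OF that assms] win_eq_early[OF that assms(1)] win_eq_early[OF that assms(2)] by simp
  have eq: "path_load T q f = path_load T q f'"
    using early[of q] early[of "q + q"] path_load_add[OF q(3), of q] path_load_add[OF q(4), of q] q(2)
    by (simp add: W_def)
  show ?thesis
  proof (induction \<tau> rule: less_induct)
    case (less \<tau>)
    show ?case
    proof (cases "\<tau> \<le> q")
      case True
      then show ?thesis
        using early q(2) by (simp add: W_def)
    next
      case False
      then have \<tau>: "\<tau> = q + (\<tau> - q)"
        by simp
      show ?thesis
        using less.IH[of "\<tau> - q"] eq q(1) False path_load_add[OF q(3), of "\<tau> - q"] path_load_add[OF q(4), of "\<tau> - q"]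
        by simp
    qed
  qed
qed

lemma win_eq_path_load: "e < l \<Longrightarrow> win T \<tau> e = int (path_load T \<tau> e)"
proof (rule win_eq_path_load_if[of \<tau>])
  fix \<tau>' f f'
  assume "f < l" "f' < l" "dst f = dst f'" "rank T f < rank T f'"
    and w: "win T \<tau>' f = int (path_load T \<tau>' f)" "win T \<tau>' f' = int (path_load T \<tau>' f')"
  from stair_path_load[OF this(1-4), of \<tau>']
  show "win T \<tau>' f' \<le> win T \<tau>' f \<and> win T \<tau>' f \<le> win T \<tau>' f' + 1"
    unfolding w by linarith
qed simp_all

lemma C_after_settled: "e < l \<Longrightarrow> C (T + \<tau>) e = C T e + path_load T \<tau> e"
  using win_eq_path_load[of e \<tau>] by (simp add: win_def)

lemma win_Suc_pred:
  assumes "T \<le> t" "e < l"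
  shows "win (Suc t) i e = win t i (pred T e)"
proof -
  have shift: "win (Suc T) \<tau> e = win T \<tau> (pred T e)" for \<tau>
    using win_eq_path_load[OF assms(2), of "Suc \<tau>"] win_eq_path_load[OF pred_props(1)[OF assms(2)], of \<tau> T]
    by (simp add: win_Suc path_load_Suc)
  from assms(1) obtain a where t: "t = T + a"
    using le_Suc_ex by blast
  show ?thesis
    using shift[of "a + i"] shift[of a] unfolding t by (simp add: win_def add.assoc del: C.simps)
qed

text \<open>Each arc entering a vertex is the predecessor of an arc leaving it, and window loads of
  arcs with a common tail always differ by at most 1.\<close>

lemma balanced_after_settled:
  assumes "T \<le> t"
  shows "balanced t i"
  unfolding balanced_def
proof (intro allI impI)
  fix f f'
  assume f: "f < l" "f' < l" "dst f = dst f'"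
  from pred_image_outs[OF f(1), of T] pred_image_outs[OF f(2), of T]
  obtain e e' where e: "e < l" "src e = dst f" "pred T e = f" and e': "e' < l" "src e' = dst f'" "pred T e' = f'"
    by blast
  have "win (Suc t) i e \<le> win (Suc t) i e' + 1"
    using win_src_le[of e e' "Suc t" i] e e' f(3) by simp
  then show "win t i f \<le> win t i f' + 1"
    using win_Suc_pred[OF assms] e e' by simp
qed

text \<open>Licenses a horizon fixed in advance: overshooting does no harm, as \<open>pred\<close>
  is taken at the later time.\<close>

lemma settled_mono: "T \<le> T' \<Longrightarrow> settled T'"
  unfolding settled_def using balanced_after_settled by simp

end

text \<open>Halving takes at most \<open>g * (16 * l ^ 5)\<close> steps and finding a settled block
  at most 96 l^13 more. As l is at least 2, l^4 absorbs 16 and l^7 absorbs 96.\<close>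

lemma settled_horizon:
  assumes "(\<Sum>v<n. tok v) < 2 ^ g"
  shows "settled ((g + 1) * l ^ 20)"
proof -
  have "spread (0 + g * (16 * l ^ 5)) (2 * (l * l))"
  proof (rule spread_small[OF spread_0])
    have "1 \<le> 2 * (l * l)"
      using l_ge by simp
    then have "(2::nat) ^ g * 1 \<le> 2 ^ g * (2 * (l * l))"
      by (rule mult_left_mono) simp
    with assms show "(\<Sum>v<n. tok v) < 2 ^ g * (2 * (l * l))"
      by linarith
  qed
  from exists_settled[OF this] obtain T where
    T: "T \<le> g * (16 * l ^ 5) + Suc W * (l * (W * (2 * (l * l)))\<^sup>2) * W" "settled T"
    by auto
  have pw: "2 ^ k \<le> l ^ k" for k
    using l_ge by (rule power_mono) simp
  have "16 * l ^ 5 \<le> l ^ 4 * l ^ 5"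
    using pw[of 4] by (intro mult_right_mono) auto
  also have "\<dots> = l ^ 9"
    by (simp flip: power_add)
  also have "\<dots> \<le> l ^ 20"
    using l_ge by (intro power_increasing) auto
  finally have 1: "g * (16 * l ^ 5) \<le> g * l ^ 20"
    by (intro mult_left_mono) auto
  have "Suc W * (l * (W * (2 * (l * l)))\<^sup>2) * W \<le> (3 * (l * l)) * (l * (W * (2 * (l * l)))\<^sup>2) * W"
    using l_ge by (intro mult_right_mono) (auto simp: W_def)
  also have "\<dots> = 96 * l ^ 13"
    by (simp add: W_def power2_eq_square numeral_eq_Suc algebra_simps)
  also have "\<dots> \<le> l ^ 7 * l ^ 13"
    using pw[of 7] by (intro mult_right_mono) auto
  also have "\<dots> = l ^ 20"
    by (simp flip: power_add)
  finally have "T \<le> g * l ^ 20 + l ^ 20"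
    using T(1) 1 by linarith
  then have "T \<le> (g + 1) * l ^ 20"
    by simp
  with T(2) show ?thesis
    using settled_mono by blast
qed

end

section \<open>Correspondence with the token model\<close>

text \<open>The iterates before the least return time are distinct and exhaust the orbit, so that
  time is its cardinality.\<close>

lemma cycle_funpow:
  assumes "cyclic_on f S" "finite S" "x \<in> S"
  shows "(f ^^ card S) x = x" "inj_on (\<lambda>i. (f ^^ i) x) {..<card S}" "(\<lambda>i. (f ^^ i) x) ` {..<card S} = S"
proof -
  have S: "S = orbit f x"
    using assms(1,3) by (simp add: orbit_cyclic_eq3)
  have "x \<in> orbit f x"
    using assms(3) S by simp
  then have "\<exists>k. 0 < k \<and> (f ^^ k) x = x"
    by (auto simp: orbit_altdef)
  define p where "p = (LEAST k. 0 < k \<and> (f ^^ k) x = x)"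
  have p: "0 < p" "(f ^^ p) x = x"
    using LeastI_ex[OF \<open>\<exists>k. 0 < k \<and> (f ^^ k) x = x\<close>] by (auto simp: p_def)
  have least: "(f ^^ k) x \<noteq> x" if "0 < k" "k < p" for k
    using not_less_Least[of k "\<lambda>k. 0 < k \<and> (f ^^ k) x = x"] that by (auto simp: p_def)
  have image: "(\<lambda>i. (f ^^ i) x) ` {..<p} = S"
    unfolding S orbit_altdef_bounded[OF p(2,1)] by auto
  have inj: "inj_on (\<lambda>i. (f ^^ i) x) {..<p}"
  proof (rule linorder_inj_onI)
    fix i j
    assume ij: "i < j" "i \<in> {..<p}" "j \<in> {..<p}"
    show "(f ^^ i) x \<noteq> (f ^^ j) x"
    proof
      assume "(f ^^ i) x = (f ^^ j) x"
      then have "(f ^^ (p - j)) ((f ^^ i) x) = (f ^^ (p - j)) ((f ^^ j) x)"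
        by simp
      then have "(f ^^ (p - j + i)) x = (f ^^ (p - j + j)) x"
        by (simp only: funpow_add comp_apply)
      then have "(f ^^ (p - j + i)) x = x"
        using ij p(2) by simp
      moreover have "(f ^^ (p - j + i)) x \<noteq> x"
        by (rule least) (use ij in auto)
      ultimately show False
        by contradiction
    qed
  qed auto
  have "card S = p"
    unfolding image[symmetric] by (simp add: card_image[OF inj])
  then show "(f ^^ card S) x = x" "inj_on (\<lambda>i. (f ^^ i) x) {..<card S}" "(\<lambda>i. (f ^^ i) x) ` {..<card S} = S"
    using p(2) inj image by simp_all
qed

lemma card_arcs:
  assumes "finite E" "\<forall>e\<in>E. card e = 2"
  shows "card (arcs E) = 2 * card E" "finite (arcs E)"
proof -
  have *: "card {(u, v). {u, v} = e} = 2 \<and> finite {(u, v). {u, v} = e}" if "e \<in> E" for e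
  proof -
    have "card e = 2"
      using assms(2) that by blast
    then obtain a b where "e = {a, b}" "a \<noteq> b"
      by (auto simp: card_2_iff)
    then have "{(u, v). {u, v} = e} = {(a, b), (b, a)}"
      by (auto simp: doubleton_eq_iff)
    then show ?thesis
      using \<open>a \<noteq> b\<close> by simp
  qed
  have arcs: "arcs E = (\<Union>e\<in>E. {(u, v). {u, v} = e})"
    by (auto simp: arcs_def)
  have "card (arcs E) = (\<Sum>e\<in>E. card {(u, v). {u, v} = e})"
    unfolding arcs by (rule card_UN_disjoint) (use assms(1) * in auto)
  then show "card (arcs E) = 2 * card E"
    using * by simp
  show "finite (arcs E)"
    unfolding arcs using assms(1) * by blast
qed

locale rotor_graph =
  fixes n :: nat and E :: "nat set set" and nxt :: "nat arc \<Rightarrow> nat arc"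
    and S\<^sub>0 :: "nat rr_state" and es :: "nat arc list"
  assumes graph: "connected_graph {..<n} E"
    and orderings: "cyclic_orderings {..<n} E nxt"
    and valid: "valid_state {..<n} E S\<^sub>0"
    and es: "distinct es" "set es = arcs E"
begin

definition src :: "nat \<Rightarrow> nat" where "src j = fst (es ! j)"
definition dst :: "nat \<Rightarrow> nat" where "dst j = snd (es ! j)"
definition rev :: "nat \<Rightarrow> nat" where "rev j = (THE i. i < length es \<and> es ! i = prod.swap (es ! j))"
definition pos :: "nat \<Rightarrow> nat" where
  "pos j = (THE i. i < card (out_arcs E (src j)) \<and> (nxt ^^ i) (pointer S\<^sub>0 (src j)) = es ! j)"

lemma es_index: "e \<in> arcs E \<Longrightarrow> \<exists>!j. j < length es \<and> es ! j = e"
  using es by (metis distinct_Ex1)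

lemma nth_arcs: "j < length es \<Longrightarrow> es ! j \<in> arcs E"
  using es(2) nth_mem by blast

lemma edges: "finite E" "\<forall>e\<in>E. card e = 2"
  using graph finite_subset[of E "Pow {..<n}"] by (auto simp: connected_graph_def)

lemma finite_arcs: "finite (arcs E)"
  using card_arcs[OF edges] by simp

lemma length_es: "length es = 2 * card E"
  using distinct_card[OF es(1)] es(2) card_arcs[OF edges] by simp

lemma arcs_less: "(u, v) \<in> arcs E \<Longrightarrow> u < n \<and> v < n"
  using graph by (force simp: connected_graph_def arcs_def)

lemma es_inj: "i < length es \<Longrightarrow> j < length es \<Longrightarrow> es ! i = es ! j \<Longrightarrow> i = j"
  using es(1) nth_eq_iff_index_eq by blast

lemma rev_props: 
  assumes "j < length es"
  shows "rev j < length es" "es ! rev j = prod.swap (es ! j)"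
proof -
  have "prod.swap (es ! j) \<in> arcs E"
    using nth_arcs[OF assms] by (auto simp: arcs_def insert_commute)
  from theI'[OF es_index[OF this]] show "rev j < length es" "es ! rev j = prod.swap (es ! j)"
    by (auto simp: rev_def)
qed

lemma bij_out: "bij_betw ((!) es) {j. j < length es \<and> src j = v} (out_arcs E v)"
proof (rule bij_betw_imageI)
  show "inj_on ((!) es) {j. j < length es \<and> src j = v}"
    by (auto intro: inj_onI es_inj)
  show "(!) es ` {j. j < length es \<and> src j = v} = out_arcs E v"
    using es(2) by (force simp: out_arcs_def src_def in_set_conv_nth image_iff)
qed

lemma bij_in: "bij_betw ((!) es) {j. j < length es \<and> dst j = v} {e \<in> arcs E. snd e = v}"
proof (rule bij_betw_imageI)
  show "inj_on ((!) es) {j. j < length es \<and> dst j = v}"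
    by (auto intro: inj_onI es_inj)
  show "(!) es ` {j. j < length es \<and> dst j = v} = {e \<in> arcs E. snd e = v}"
    using es(2) by (force simp: dst_def in_set_conv_nth image_iff)
qed

lemma finite_out: "finite (out_arcs E v)"
  using finite_arcs by (auto simp: out_arcs_def)

lemma card_out: "card (out_arcs E v) = card {j. j < length es \<and> src j = v}"
  by (rule bij_betw_same_card[OF bij_out, symmetric])

lemma cyclic: "v < n \<Longrightarrow> cyclic_on nxt (out_arcs E v)"
  using orderings by (simp add: cyclic_orderings_def)

lemma pointer_out: "v < n \<Longrightarrow> pointer S\<^sub>0 v \<in> out_arcs E v"
  using valid by (simp add: valid_state_def)

lemma src_less: "j < length es \<Longrightarrow> src j < n"
  using nth_arcs[of j] arcs_less[of "fst (es ! j)" "snd (es ! j)"] by (simp add: src_def)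

lemma dst_less: "j < length es \<Longrightarrow> dst j < n"
  using nth_arcs[of j] arcs_less[of "fst (es ! j)" "snd (es ! j)"] by (simp add: dst_def)

lemma nth_out: "j < length es \<Longrightarrow> es ! j \<in> out_arcs E (src j)"
  using nth_arcs by (simp add: out_arcs_def src_def)

lemma pos_props:
  assumes "j < length es"
  shows "pos j < card (out_arcs E (src j))" "(nxt ^^ pos j) (pointer S\<^sub>0 (src j)) = es ! j"
proof -
  let ?d = "card (out_arcs E (src j))" and ?p = "pointer S\<^sub>0 (src j)"
  note c = cycle_funpow[OF cyclic[OF src_less[OF assms]] finite_out pointer_out[OF src_less[OF assms]]]
  have "es ! j \<in> (\<lambda>i. (nxt ^^ i) ?p) ` {..<?d}"
    using c(3) nth_out[OF assms] by simp
  then obtain i where i: "i < ?d" "(nxt ^^ i) ?p = es ! j"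
    by auto
  have "\<exists>!i. i < ?d \<and> (nxt ^^ i) ?p = es ! j"
  proof (rule ex1I[of _ i])
    show "i' = i" if "i' < ?d \<and> (nxt ^^ i') ?p = es ! j" for i'
      by (rule inj_onD[OF c(2)]) (use i that in auto)
  qed (use i in simp)
  from theI'[OF this] show "pos j < ?d" "(nxt ^^ pos j) ?p = es ! j"
    unfolding pos_def by auto
qed

lemma pos_eqI:
  assumes "j < length es" "i < card (out_arcs E (src j))" "(nxt ^^ i) (pointer S\<^sub>0 (src j)) = es ! j"
  shows "pos j = i"
proof -
  note c = cycle_funpow[OF cyclic[OF src_less[OF assms(1)]] finite_out pointer_out[OF src_less[OF assms(1)]]]
  show ?thesis
    by (rule inj_onD[OF c(2)]) (use assms pos_props[OF assms(1)] in auto)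
qed

lemma pointer_eq_iff:
  assumes "j < length es"
  shows "(nxt ^^ i) (pointer S\<^sub>0 (src j)) = es ! j \<longleftrightarrow> i mod card (out_arcs E (src j)) = pos j"
proof -
  let ?d = "card (out_arcs E (src j))" and ?p = "pointer S\<^sub>0 (src j)"
  note c = cycle_funpow[OF cyclic[OF src_less[OF assms]] finite_out pointer_out[OF src_less[OF assms]]]
  have "(nxt ^^ i) ?p = (nxt ^^ (i mod ?d)) ?p"
    by (rule funpow_mod_eq[OF c(1), symmetric])
  moreover have "i mod ?d < ?d"
    using pos_props(1)[OF assms] by simp
  ultimately show ?thesis
    using pos_eqI[OF assms] pos_props(2)[OF assms] by metis
qed

sublocale rotor_network n "length es" src dst rev pos "tokens S\<^sub>0"
proof
  show "bij_betw pos {j. j < length es \<and> src j = v} {..<card {j. j < length es \<and> src j = v}}" if "v < n" for v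
  proof -
    let ?J = "{j. j < length es \<and> src j = v}"
    have inj: "inj_on pos ?J"
    proof (rule inj_onI)
      fix i j assume "i \<in> ?J" "j \<in> ?J" "pos i = pos j"
      then have "es ! i = es ! j"
        using pos_props(2)[of i] pos_props(2)[of j] by simp
      then show "i = j"
        using \<open>i \<in> ?J\<close> \<open>j \<in> ?J\<close> es_inj by blast
    qed
    have "pos ` ?J \<subseteq> {..<card ?J}"
      using pos_props(1)[unfolded card_out] by auto
    then have "pos ` ?J = {..<card ?J}"
      by (rule card_subset_eq[rotated]) (simp_all add: card_image[OF inj])
    with inj show ?thesis
      by (simp add: bij_betw_def)
  qed
  show "\<exists>j<length es. src j = v" if "v < n" for v
    using pointer_out[OF that] bij_out[of v] by (auto simp: bij_betw_def)
  show "rev (rev j) = j" if "j < length es" for j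
    using that by (intro es_inj) (simp_all add: rev_props)
  show "src (rev j) = dst j" if "j < length es" for j
    using that by (simp add: src_def dst_def rev_props)
  \<comment> \<open>Vertex 0 has a pointer, so there is an arc; the number of arcs is even and hence
    at least 2.\<close>
  have "0 < n"
    using graph by (auto simp: connected_graph_def)
  from pointer_out[OF this] have "es \<noteq> []"
    using es(2) by (auto simp: out_arcs_def)
  then have "0 < length es"
    by simp
  then show "2 \<le> length es"
    using length_es by arith
qed (simp_all add: src_less rev_props)

lemma deg_eq: "deg v = card (out_arcs E v)"
  by (simp add: deg_def outs_def card_out)

lemma card_visits:
  assumes "j < length es"
  shows "card {i. i < X \<and> (nxt ^^ i) (pointer S\<^sub>0 (src j)) = es ! j} = stair (deg (src j)) X (pos j)"
  using card_mod_eq_stair[OF pos_less[OF assms], of X] by (simp add: pointer_eq_iff[OF assms] deg_eq)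

lemma card_visits_shift:
  assumes "j < length es"
  shows "card {i. i < X \<and> (nxt ^^ i) ((nxt ^^ Y) (pointer S\<^sub>0 (src j))) = es ! j} =
    stair (deg (src j)) (Y + X) (pos j) - stair (deg (src j)) Y (pos j)"
proof -
  define P where "P i \<longleftrightarrow> (nxt ^^ i) (pointer S\<^sub>0 (src j)) = es ! j" for i
  have "{i. i < X + Y \<and> P i} = {i. i < Y \<and> P i} \<union> (\<lambda>i. i + Y) ` {i. i < X \<and> P (i + Y)}"
    by (auto simp: image_iff) (metis add.commute le_Suc_ex not_less add_less_cancel_left)
  also have "card \<dots> = card {i. i < Y \<and> P i} + card {i. i < X \<and> P (i + Y)}"
    by (subst card_Un_disjoint) (auto simp: card_image)
  finally show ?thesis
    unfolding card_visits[OF assms, symmetric] by (simp add: P_def funpow_add add.commute)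
qed

lemma state_at_Suc: "state_at E nxt S\<^sub>0 (Suc t) = rr_step E nxt (state_at E nxt S\<^sub>0 t)"
  by (simp add: state_at_def)

lemma sent_if_state:
  assumes "j < length es" and "pointer S (src j) = (nxt ^^ U t (src j)) (pointer S\<^sub>0 (src j))"
    and "tokens S (src j) = U (Suc t) (src j) - U t (src j)"
  shows "sent nxt S (es ! j) = C (Suc t) j - C t j"
proof -
  have "sent nxt S (es ! j) = card {i. i < U (Suc t) (src j) - U t (src j) \<and>
      (nxt ^^ i) ((nxt ^^ U t (src j)) (pointer S\<^sub>0 (src j))) = es ! j}"
    unfolding sent_def src_def[symmetric] assms(2,3) ..
  also have "\<dots> = C (Suc t) j - C t j"
    using U_mono[of t "Suc t" "src j"] unfolding card_visits_shift[OF assms(1)] C_eq_stair[OF assms(1)]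
    by (simp del: U.simps)
  finally show ?thesis .
qed

text \<open>\<open>U (Suc t) v\<close> counts the tokens that started at v or arrived there by time
  t. Subtracting the departures leaves those present, and each departure has advanced the pointer
  once.\<close>

lemma state_at_eq:
  assumes "v < n"
  shows "pointer (state_at E nxt S\<^sub>0 t) v = (nxt ^^ U t v) (pointer S\<^sub>0 v) \<and>
    tokens (state_at E nxt S\<^sub>0 t) v = U (Suc t) v - U t v"
  using assms
proof (induction t arbitrary: v)
  case 0
  then show ?case
    by (simp add: state_at_def)
next
  case (Suc t)
  let ?S = "state_at E nxt S\<^sub>0 t"
  have "pointer (rr_step E nxt ?S) v = (nxt ^^ (U (Suc t) v - U t v)) ((nxt ^^ U t v) (pointer S\<^sub>0 v))"
    using Suc by (simp add: rr_step_def)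
  also have "\<dots> = (nxt ^^ (U (Suc t) v - U t v + U t v)) (pointer S\<^sub>0 v)"
    by (simp only: funpow_add comp_apply)
  finally have ptr: "pointer (rr_step E nxt ?S) v = (nxt ^^ U (Suc t) v) (pointer S\<^sub>0 v)"
    using U_mono[of t "Suc t" v] by (simp del: U.simps)
  have "tokens (rr_step E nxt ?S) v = (\<Sum>e\<in>{e \<in> arcs E. snd e = v}. sent nxt ?S e)"
    by (simp add: rr_step_def)
  also have "\<dots> = (\<Sum>j\<in>ins v. sent nxt ?S (es ! j))"
    unfolding ins_def by (rule sum.reindex_bij_betw[OF bij_in, symmetric])
  also have "\<dots> = (\<Sum>j\<in>ins v. C (Suc t) j - C t j)"
    by (rule sum.cong) (use Suc.IH src_less in \<open>auto intro!: sent_if_state simp: ins_def simp del: C.simps U.simps\<close>)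
  also have "\<dots> = U (Suc (Suc t)) v - U (Suc t) v"
    by (simp add: sum_subtractf_nat[OF C_mono_Suc] del: C.simps)
  finally show ?case
    using ptr by (simp only: state_at_Suc)
qed

lemma cumulative_load_eq:
  assumes "j < length es"
  shows "cumulative_load E nxt S\<^sub>0 t (es ! j) = C t j"
proof (induction t)
  case 0
  then show ?case
    by (simp add: cumulative_load_def)
next
  case (Suc t)
  have "arc_load E nxt S\<^sub>0 t (es ! j) = C (Suc t) j - C t j"
    unfolding arc_load_def by (rule sent_if_state[OF assms]) (use state_at_eq[OF src_less[OF assms]] in auto)
  with Suc C_mono_Suc[of t j] show ?case
    by (simp add: cumulative_load_def del: C.simps)
qed

end

section \<open>Reasoning about programs\<close>

fun ev :: "memory \<Rightarrow> expr \<Rightarrow> nat" where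
  "ev M (Const c) = c"
| "ev M (Cell x a) = M x (ev M a)"
| "ev M (Bin f a b) = apply_binop f (ev M a) (ev M b)"

text \<open>Splitting \<open>eval\<close> into a total value and a side condition lets values be
  computed by rewriting, with word and index bounds as separate goals.\<close>

fun ok :: "nat \<Rightarrow> nat \<Rightarrow> memory \<Rightarrow> expr \<Rightarrow> bool" where
  "ok w s M (Const c) \<longleftrightarrow> c < w"
| "ok w s M (Cell x a) \<longleftrightarrow> ok w s M a \<and> ev M a < s \<and> M x (ev M a) < w"
| "ok w s M (Bin f a b) \<longleftrightarrow> ok w s M a \<and> ok w s M b \<and> apply_binop f (ev M a) (ev M b) < w"

fun vars :: "expr \<Rightarrow> string set" where
  "vars (Const c) = {}"
| "vars (Cell x a) = insert x (vars a)"
| "vars (Bin f a b) = vars a \<union> vars b"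

lemma eval_if_ok: "ok w s M e \<Longrightarrow> eval w s M e = Some (ev M e)"
  by (induction e) auto

lemma ev_cong: "(\<And>x. x \<in> vars e \<Longrightarrow> M' x = M x) \<Longrightarrow> ev M' e = ev M e"
  by (induction e) auto

lemma ok_cong: "(\<And>x. x \<in> vars e \<Longrightarrow> M' x = M x) \<Longrightarrow> ok w s M' e = ok w s M e"
proof (induction e)
  case (Cell x a)
  then have "ev M' a = ev M a"
    by (intro ev_cong) simp
  with Cell show ?case
    by simp
next
  case (Bin f a b)
  then have "ev M' a = ev M a" "ev M' b = ev M b"
    by (auto intro: ev_cong)
  with Bin show ?case
    by simp
qed simp

fun writes :: "com \<Rightarrow> string set" where
  "writes Skip = {}"
| "writes (Store x a b) = {x}"
| "writes (Seq c d) = writes c \<union> writes d"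
| "writes (If b c d) = writes c \<union> writes d"
| "writes (While b c) = writes c"

text \<open>The running time when every loop makes at most \<open>Z\<close> iterations.\<close>

fun time_bound :: "nat \<Rightarrow> com \<Rightarrow> nat" where
  "time_bound Z Skip = 1"
| "time_bound Z (Store x a b) = cost a + cost b + 1"
| "time_bound Z (Seq c d) = time_bound Z c + time_bound Z d"
| "time_bound Z (If b c d) = cost b + 1 + time_bound Z c + time_bound Z d"
| "time_bound Z (While b c) = Z * (cost b + 1 + time_bound Z c) + (cost b + 1)"

fun nesting :: "com \<Rightarrow> nat" where
  "nesting Skip = 0"
| "nesting (Store x a b) = 0"
| "nesting (Seq c d) = max (nesting c) (nesting d)"
| "nesting (If b c d) = max (nesting c) (nesting d)"
| "nesting (While b c) = Suc (nesting c)"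

text \<open>Each loop level contributes one factor Z. For a fixed program the rest is a constant, so
  nesting depth is the polynomial degree, and depth 1 makes queries linear.\<close>

lemma time_bound_le:
  assumes "1 \<le> Z"
  shows "time_bound Z c \<le> time_bound 1 c * Z ^ nesting c"
proof (induction c)
  case (Seq c d)
  have "time_bound 1 c * Z ^ nesting c \<le> time_bound 1 c * Z ^ nesting (Seq c d)"
    "time_bound 1 d * Z ^ nesting d \<le> time_bound 1 d * Z ^ nesting (Seq c d)"
    using assms by (intro mult_left_mono power_increasing; simp)+
  with Seq.IH have "time_bound Z c \<le> time_bound 1 c * Z ^ nesting (Seq c d)"
    "time_bound Z d \<le> time_bound 1 d * Z ^ nesting (Seq c d)"
    by (blast intro: order_trans)+
  then show ?case
    unfolding time_bound.simps add_mult_distrib by (rule add_mono)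
next
  case (If b c d)
  have "time_bound 1 c * Z ^ nesting c \<le> time_bound 1 c * Z ^ nesting (If b c d)"
    "time_bound 1 d * Z ^ nesting d \<le> time_bound 1 d * Z ^ nesting (If b c d)"
    using assms by (intro mult_left_mono power_increasing; simp)+
  with If.IH have "time_bound Z c \<le> time_bound 1 c * Z ^ nesting (If b c d)"
    "time_bound Z d \<le> time_bound 1 d * Z ^ nesting (If b c d)"
    by (blast intro: order_trans)+
  moreover have "(cost b + 1) * 1 \<le> (cost b + 1) * Z ^ nesting (If b c d)"
    using assms by (intro mult_left_mono) auto
  then have "cost b + 1 \<le> (cost b + 1) * Z ^ nesting (If b c d)"
    by simp
  ultimately show ?case
    unfolding time_bound.simps add_mult_distrib[of _ "time_bound 1 d"] add_mult_distrib[of "cost b + 1"]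
    by (intro add_mono)
next
  case (While b c)
  define a x where "a = cost b + 1" and "x = Z ^ nesting c"
  have "1 \<le> x"
    using assms by (simp add: x_def)
  then have "a * Z * 1 \<le> a * Z * x"
    by (rule mult_left_mono) simp
  moreover have "a * 1 \<le> a * (Z * x)"
    using assms \<open>1 \<le> x\<close> by (intro mult_left_mono) simp_all
  moreover have "Z * time_bound Z c \<le> Z * (time_bound 1 c * x)"
    using While unfolding x_def by (rule mult_left_mono) simp
  moreover have "time_bound Z (While b c) = a * Z + Z * time_bound Z c + a"
    by (simp add: a_def algebra_simps)
  moreover have "time_bound 1 (While b c) * Z ^ nesting (While b c) =
      a * Z * x + Z * (time_bound 1 c * x) + a * (Z * x)"
    by (simp add: a_def x_def algebra_simps)
  ultimately show ?case
    by linarith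
qed simp_all

lemma exec_frame: "exec w s c M t M' \<Longrightarrow> x \<notin> writes c \<Longrightarrow> M' x = M x"
  by (induction rule: exec.induct) auto

text \<open>The syntactic time bound is part of the triple, so loop invariants never mention
  time.\<close>

definition runs :: "nat \<Rightarrow> nat \<Rightarrow> nat \<Rightarrow> com \<Rightarrow> memory \<Rightarrow> (memory \<Rightarrow> bool) \<Rightarrow> bool" where
  "runs w s Z c M Q \<longleftrightarrow> (\<exists>t M'. exec w s c M t M' \<and> t \<le> time_bound Z c \<and> Q M')"

definition frame :: "string set \<Rightarrow> memory \<Rightarrow> memory \<Rightarrow> bool" where
  "frame X M M' \<longleftrightarrow> (\<forall>y. y \<notin> X \<longrightarrow> M' y = M y)"

lemma frameD: "frame X M M' \<Longrightarrow> y \<notin> X \<Longrightarrow> M' y = M y"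
  by (simp add: frame_def)

lemma runs_conseq:
  "runs w s Z c M Q \<Longrightarrow> (\<And>M'. Q M' \<Longrightarrow> frame (writes c) M M' \<Longrightarrow> Q' M') \<Longrightarrow> runs w s Z c M Q'"
  unfolding runs_def frame_def using exec_frame by blast

lemma runs_Skip: "Q M \<Longrightarrow> runs w s Z Skip M Q"
  unfolding runs_def using exec_Skip[of w s M] by (intro exI conjI) auto

lemma runs_Store:
  assumes "ok w s M a" "ev M a < s" "ok w s M b" "Q (M(x := (M x)(ev M a := ev M b)))"
  shows "runs w s Z (Store x a b) M Q"
  unfolding runs_def
  using exec_Store[OF eval_if_ok[OF assms(1)] assms(2) eval_if_ok[OF assms(3)], of x] assms(4)
  by (intro exI conjI) auto

lemma runs_Seq:
  assumes "runs w s Z c M (\<lambda>M'. runs w s Z d M' Q)"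
  shows "runs w s Z (Seq c d) M Q"
proof -
  from assms obtain t M' u M'' where "exec w s c M t M'" "t \<le> time_bound Z c"
    "exec w s d M' u M''" "u \<le> time_bound Z d" "Q M''"
    unfolding runs_def by blast
  then show ?thesis
    unfolding runs_def by (intro exI[of _ "t + u"] exI[of _ M'']) (auto intro: exec_Seq)
qed

lemma runs_If:
  assumes "ok w s M b" "ev M b \<noteq> 0 \<Longrightarrow> runs w s Z c M Q" "ev M b = 0 \<Longrightarrow> runs w s Z d M Q"
  shows "runs w s Z (If b c d) M Q"
proof (cases "ev M b = 0")
  case True
  with assms(3) obtain t M' where "exec w s d M t M'" "t \<le> time_bound Z d" "Q M'"
    unfolding runs_def by blast
  moreover from this(1) have "exec w s (If b c d) M (cost b + 1 + t) M'"
    using eval_if_ok[OF assms(1)] True by (intro exec_If_false) simp_all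
  ultimately show ?thesis
    unfolding runs_def by (intro exI[of _ "cost b + 1 + t"] exI[of _ M']) simp
next
  case False
  with assms(2) obtain t M' where "exec w s c M t M'" "t \<le> time_bound Z c" "Q M'"
    unfolding runs_def by blast
  moreover from this(1) have "exec w s (If b c d) M (cost b + 1 + t) M'"
    using eval_if_ok[OF assms(1)] False by (intro exec_If_true) simp_all
  ultimately show ?thesis
    unfolding runs_def by (intro exI[of _ "cost b + 1 + t"] exI[of _ M']) simp
qed

lemma runs_While:
  assumes "I 0 M" "N \<le> Z"
    and step: "\<And>i M'. i < N \<Longrightarrow> I i M' \<Longrightarrow> ok w s M' b \<and> ev M' b \<noteq> 0 \<and> runs w s Z c M' (I (Suc i))"
    and stop: "\<And>M'. I N M' \<Longrightarrow> ok w s M' b \<and> ev M' b = 0"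
  shows "runs w s Z (While b c) M (I N)"
proof -
  have "\<exists>t M''. exec w s (While b c) M' t M'' \<and> t \<le> k * (cost b + 1 + time_bound Z c) + (cost b + 1) \<and> I N M''"
    if "I (N - k) M'" "k \<le> N" for k M'
    using that
  proof (induction k arbitrary: M')
    case 0
    then have "I N M'"
      by simp
    moreover from stop[OF this] have "exec w s (While b c) M' (cost b + 1) M'"
      using eval_if_ok[of w s M' b] by (intro exec_While_false) simp
    ultimately show ?case
      by (intro exI[of _ "cost b + 1"] exI[of _ M']) simp
  next
    case (Suc k)
    then have i: "N - Suc k < N" "Suc (N - Suc k) = N - k"
      by auto
    from step[OF i(1) Suc.prems(1)] obtain t M\<^sub>1 where 1: "ok w s M' b" "ev M' b \<noteq> 0"
      "exec w s c M' t M\<^sub>1" "t \<le> time_bound Z c" "I (N - k) M\<^sub>1"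
      unfolding runs_def i(2) by blast
    from Suc.IH[OF 1(5)] Suc.prems(2) obtain u M\<^sub>2 where 2: "exec w s (While b c) M\<^sub>1 u M\<^sub>2"
      "u \<le> k * (cost b + 1 + time_bound Z c) + (cost b + 1)" "I N M\<^sub>2"
      by auto
    have "exec w s (While b c) M' (cost b + 1 + t + u) M\<^sub>2"
      by (rule exec_While_true[OF eval_if_ok[OF 1(1)] 1(2,3) 2(1)])
    with 1(4) 2(2,3) show ?case
      by (intro exI[of _ "cost b + 1 + t + u"] exI[of _ M\<^sub>2]) (simp add: algebra_simps)
  qed
  from this[of N M] assms(1) obtain t M'' where
    "exec w s (While b c) M t M''" "t \<le> N * (cost b + 1 + time_bound Z c) + (cost b + 1)" "I N M''"
    by auto
  moreover have "N * (cost b + 1 + time_bound Z c) \<le> Z * (cost b + 1 + time_bound Z c)"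
    using assms(2) by (rule mult_right_mono) simp
  ultimately show ?thesis
    unfolding runs_def by (intro exI[of _ t] exI[of _ M'']) simp
qed

section \<open>Counting loops and two-dimensional tables\<close>

abbreviation V :: "string \<Rightarrow> expr" where "V x \<equiv> Cell x (Const 0)"

abbreviation setv :: "string \<Rightarrow> nat \<Rightarrow> memory \<Rightarrow> memory" where
  "setv x a M \<equiv> M(x := (M x)(0 := a))"

definition For :: "string \<Rightarrow> expr \<Rightarrow> com \<Rightarrow> com" where
  "For x b c = Seq (Store x (Const 0) (Const 0))
     (While (Bin Less (V x) b) (Seq c (Store x (Const 0) (Bin Add (V x) (Const 1)))))"

lemma writes_For [simp]: "writes (For x b c) = insert x (writes c)"
  by (auto simp: For_def)

lemma nesting_For [simp]: "nesting (For x b c) = Suc (nesting c)"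
  by (simp add: For_def)

text \<open>The invariant refers to the moment of the loop test, so the body has to establish it for
  the memory with the advanced counter. The conditions on names protect counter and bound from the
  body.\<close>

lemma runs_For:
  assumes "ev M b = N" "ok w s M b" "vars b \<inter> insert x (writes c) = {}" "x \<notin> writes c"
    and "N \<le> Z" "N < w" "1 < w" "0 < s"
    and init: "I 0 (setv x 0 M)"
    and step: "\<And>i M'. i < N \<Longrightarrow> I i M' \<Longrightarrow> M' x 0 = i \<Longrightarrow> frame (insert x (writes c)) M M' \<Longrightarrow>
      runs w s Z c M' (\<lambda>M''. I (Suc i) (setv x (Suc i) M''))"
    and post: "\<And>M'. I N M' \<Longrightarrow> frame (insert x (writes c)) M M' \<Longrightarrow> Q M'"
  shows "runs w s Z (For x b c) M Q"
proof -
  let ?X = "insert x (writes c)"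
  define J where "J i M' \<longleftrightarrow> I i M' \<and> M' x 0 = i \<and> frame ?X M M'" for i M'
  have b: "ev M' b = N \<and> ok w s M' b" if "frame ?X M M'" for M'
  proof -
    have "M' y = M y" if "y \<in> vars b" for y
      using \<open>frame ?X M M'\<close> that assms(3) unfolding frame_def by blast
    then show ?thesis
      using ev_cong[of b M' M] ok_cong[of b M' M w s] assms(1,2) by simp
  qed
  have "runs w s Z (While (Bin Less (V x) b) (Seq c (Store x (Const 0) (Bin Add (V x) (Const 1)))))
      (setv x 0 M) (J N)"
  proof (rule runs_While[OF _ \<open>N \<le> Z\<close>])
    show "J 0 (setv x 0 M)"
      using init by (simp add: J_def frame_def)
  next
    fix i M'
    assume i: "i < N" and J: "J i M'"
    then have "I i M'" "M' x 0 = i" "frame ?X M M'"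
      by (simp_all add: J_def)
    from step[OF i this] have "runs w s Z c M' (\<lambda>M''. I (Suc i) (setv x (Suc i) M''))" .
    then have "runs w s Z c M' (\<lambda>M''. runs w s Z (Store x (Const 0) (Bin Add (V x) (Const 1))) M'' (J (Suc i)))"
    proof (rule runs_conseq)
      fix M''
      assume M'': "I (Suc i) (setv x (Suc i) M'')" "frame (writes c) M' M''"
      then have "M'' x 0 = i"
        using \<open>M' x 0 = i\<close> assms(4) by (simp add: frame_def)
      then show "runs w s Z (Store x (Const 0) (Bin Add (V x) (Const 1))) M'' (J (Suc i))"
        using assms(6-8) i M'' \<open>frame ?X M M'\<close> by (intro runs_Store) (simp_all add: J_def frame_def)
    qed
    then show "ok w s M' (Bin Less (V x) b) \<and> ev M' (Bin Less (V x) b) \<noteq> 0 \<and>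
        runs w s Z (Seq c (Store x (Const 0) (Bin Add (V x) (Const 1)))) M' (J (Suc i))"
      using b[OF \<open>frame ?X M M'\<close>] \<open>M' x 0 = i\<close> i assms(6-8) by (auto intro: runs_Seq)
  next
    fix M'
    assume "J N M'"
    then show "ok w s M' (Bin Less (V x) b) \<and> ev M' (Bin Less (V x) b) = 0"
      using b[of M'] assms(6-8) by (simp add: J_def)
  qed
  then show ?thesis
    unfolding For_def
    by (intro runs_Seq runs_Store) (use assms(7,8) post in \<open>auto simp: J_def intro: runs_conseq\<close>)
qed

text \<open>All two-dimensional tables are laid out with the row length stored in the variable \<open>b\<close>.\<close>

definition idx :: "nat \<Rightarrow> nat \<Rightarrow> nat \<Rightarrow> nat" where "idx b j i = j * b + i"

definition Ix :: "expr \<Rightarrow> expr \<Rightarrow> expr" where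
  "Ix a c = Bin Add (Bin Mul a (V ''b'')) c"

lemma idx_eq_iff:
  assumes "i < b" "i' < b"
  shows "idx b j i = idx b j' i' \<longleftrightarrow> j = j' \<and> i = i'"
proof -
  have "idx b j i div b = j" "idx b j i mod b = i" if "i < b" for i j
    using that by (simp_all add: idx_def)
  then show ?thesis
    using assms by metis
qed

lemma ev_Ix [simp]: "ev M (Ix a c) = idx (M ''b'' 0) (ev M a) (ev M c)"
  by (simp add: Ix_def idx_def)

lemma vars_Ix [simp]: "vars (Ix a c) = insert ''b'' (vars a \<union> vars c)"
  by (auto simp: Ix_def)

lemma ok_Ix [simp]: "ok w s M (Ix a c) \<longleftrightarrow> ok w s M a \<and> ok w s M c \<and> 0 < w \<and> 0 < s \<and> M ''b'' 0 < w \<and>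
    idx (M ''b'' 0) (ev M a) (ev M c) < w"
  by (auto simp: Ix_def idx_def)

lemma idx_less: "j < G \<Longrightarrow> i < b \<Longrightarrow> b \<le> G \<Longrightarrow> idx b j i < G * G"
proof -
  assume "j < G" "i < b" "b \<le> G"
  then have "j * b + i < Suc j * b" "Suc j * b \<le> G * G"
    by (auto intro: mult_le_mono simp del: mult_Suc) simp
  then show ?thesis
    by (simp add: idx_def)
qed

section \<open>Orbit tables\<close>

lemma runs_SeqI:
  assumes "runs w s Z c M P" "\<And>M'. P M' \<Longrightarrow> frame (writes c) M M' \<Longrightarrow> runs w s Z d M' Q"
  shows "runs w s Z (Seq c d) M Q"
  by (rule runs_Seq) (rule runs_conseq[OF assms])

definition period :: "(nat \<Rightarrow> nat) \<Rightarrow> nat \<Rightarrow> nat" where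
  "period F j = (LEAST p. 0 < p \<and> (F ^^ p) j = j)"

lemma period_props:
  assumes "0 < p" "(F ^^ p) j = j"
  shows "0 < period F j" "(F ^^ period F j) j = j" "period F j \<le> p"
  unfolding period_def using LeastI[of "\<lambda>p. 0 < p \<and> (F ^^ p) j = j" p] Least_le[of "\<lambda>p. 0 < p \<and> (F ^^ p) j = j" p] assms
  by auto

definition orbit_row :: "string \<Rightarrow> string \<Rightarrow> com" where
  "orbit_row f tab =
    Seq (Store tab (Ix (V ''j'') (Const 0)) (V ''j''))
      (For ''i'' (V ''l'') (Store tab (Ix (V ''j'') (Bin Add (V ''i'') (Const 1)))
        (Cell f (Cell tab (Ix (V ''j'') (V ''i''))))))"

text \<open>Scanning downwards leaves the least period.\<close>

definition orbit_period :: "string \<Rightarrow> string \<Rightarrow> com" where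
  "orbit_period tab per =
    For ''i'' (V ''l'')
      (If (Bin Eq (Cell tab (Ix (V ''j'') (Bin Sub (V ''l'') (V ''i'')))) (V ''j''))
        (Store per (V ''j'') (Bin Sub (V ''l'') (V ''i''))) Skip)"

definition orbit_prog :: "string \<Rightarrow> string \<Rightarrow> string \<Rightarrow> com" where
  "orbit_prog f tab per = For ''j'' (V ''l'') (Seq (orbit_row f tab) (orbit_period tab per))"

lemma writes_orbit [simp]: "writes (orbit_row f tab) = {''i'', tab}" "writes (orbit_period tab per) = {''i'', per}"
    "writes (orbit_prog f tab per) = {''j'', ''i'', tab, per}"
  by (auto simp: orbit_row_def orbit_period_def orbit_prog_def)

text \<open>Rows have room for the l + 1 iterates 0 to l, hence \<open>l < b\<close>. With at most G
  rows of length at most G, every table fits into the \<open>G * G\<close> cells allowed.\<close>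

locale machine =
  fixes w s Z l b G :: nat
  assumes l_less: "l < b" and b_le: "b \<le> G" and G2: "G * G \<le> s" and s_le: "s \<le> w" and l_le_Z: "l \<le> Z"
    and G_ge: "2 \<le> G"
begin

lemma G_le: "G \<le> s"
proof -
  show ?thesis
    using le_square[of G] G2 by linarith
qed

lemma less_if_G [simp]: "x < G \<Longrightarrow> x < s" "x < G \<Longrightarrow> x < w" "x \<le> l \<Longrightarrow> x < w" "x \<le> l \<Longrightarrow> x < s"
    "x < s \<Longrightarrow> x < w"
  using G_le s_le l_less b_le by auto

lemma constants_less [simp]: "0 < w" "Suc 0 < w" "0 < s" "Suc 0 < s" "l < w" "l < s" "l < G" "0 < G" "Suc 0 < G"
  using G_le s_le l_less b_le G_ge by auto

lemma b_less [simp]: "b < s" "b < w"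
proof -
  have "G * 2 \<le> G * G"
    using G_ge by (rule mult_le_mono2)
  then show "b < s" "b < w"
    using G2 s_le b_le G_ge by linarith+
qed

lemma idx_bound [simp]: "j < G \<Longrightarrow> i < b \<Longrightarrow> idx b j i < s" "j < G \<Longrightarrow> i < b \<Longrightarrow> idx b j i < w"
  using idx_less[of j G i b] b_le G2 s_le by auto

lemma less_b [simp]: "i \<le> l \<Longrightarrow> i < b" "i < l \<Longrightarrow> i < b" "i < l \<Longrightarrow> Suc i < b" "i < l \<Longrightarrow> i < G" "i \<le> l \<Longrightarrow> i < G"
  "i < l \<Longrightarrow> Suc i < w" "i < l \<Longrightarrow> i < w" "i < l \<Longrightarrow> i < s"
  using l_less b_le G_le s_le by auto

declare idx_eq_iff [simp]

lemma runs_orbit_row: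
  assumes names: "tab \<notin> {''j'', ''i'', ''l'', ''b'', f}" "f \<noteq> ''i''"
    and M: "M ''l'' 0 = l" "M ''b'' 0 = b" "M ''j'' 0 = j" "\<And>j. j < l \<Longrightarrow> M f j = F j"
    and F: "\<forall>j<l. F j < l" and j: "j < l"
  shows "runs w s Z (orbit_row f tab) M (\<lambda>M'. (\<forall>i\<le>l. M' tab (idx b j i) = (F ^^ i) j) \<and>
    (\<forall>j' i. j' \<noteq> j \<longrightarrow> i < b \<longrightarrow> M' tab (idx b j' i) = M tab (idx b j' i)))"
  unfolding orbit_row_def
proof (rule runs_SeqI)
  show "runs w s Z (Store tab (Ix (V ''j'') (Const 0)) (V ''j'')) M (\<lambda>M'. M' = M(tab := (M tab)(idx b j 0 := j)))"
    by (rule runs_Store) (use M j in simp_all)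
next
  fix M'
  assume M': "M' = M(tab := (M tab)(idx b j 0 := j))"
  let ?body = "Store tab (Ix (V ''j'') (Bin Add (V ''i'') (Const 1)))
      (Cell f (Cell tab (Ix (V ''j'') (V ''i''))))"
  let ?I = "\<lambda>k M'. (\<forall>i\<le>k. M' tab (idx b j i) = (F ^^ i) j) \<and>
    (\<forall>j' i. j' \<noteq> j \<longrightarrow> i < b \<longrightarrow> M' tab (idx b j' i) = M tab (idx b j' i))"
  show "runs w s Z (For ''i'' (V ''l'') ?body) M' (?I l)"
  proof (rule runs_For[where I = ?I and N = l])
    fix i M1
    assume i: "i < l" "?I i M1" "M1 ''i'' 0 = i" and fr: "frame (insert ''i'' (writes ?body)) M' M1"
    have M1: "M1 ''l'' 0 = l" "M1 ''b'' 0 = b" "M1 ''j'' 0 = j" "\<And>j. j < l \<Longrightarrow> M1 f j = F j"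
      using names M fr M' by (auto simp: frame_def)
    have Fi: "M1 tab (idx b j i) = (F ^^ i) j" "(F ^^ i) j < l" "F ((F ^^ i) j) < l"
      using i(2) F funpow_closed[OF F j] by auto
    show "runs w s Z ?body M1 (\<lambda>M''. ?I (Suc i) (setv ''i'' (Suc i) M''))"
      by (rule runs_Store) (use names i j M1 Fi in \<open>simp_all add: le_Suc_eq\<close>)
  qed (use names M M' l_le_Z j in auto)
qed

lemma runs_orbit_period:
  assumes names: "per \<notin> {''j'', ''i'', ''l'', ''b'', tab}" "tab \<noteq> ''i''"
    and M: "M ''l'' 0 = l" "M ''b'' 0 = b" "M ''j'' 0 = j" "\<And>i. i \<le> l \<Longrightarrow> M tab (idx b j i) = (F ^^ i) j"
    and F: "\<forall>j<l. F j < l" and j: "j < l" and per: "\<exists>p. 0 < p \<and> p \<le> l \<and> (F ^^ p) j = j"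
  shows "runs w s Z (orbit_period tab per) M (\<lambda>M'. M' per j = period F j \<and>
    (\<forall>j'. j' \<noteq> j \<longrightarrow> M' per j' = M per j'))"
  unfolding orbit_period_def
\<comment> \<open>After k rounds the lengths above \<open>l - k\<close> have been tested. Once the
  least period is among them, no later length can overwrite the entry.\<close>
proof (rule runs_For[where I = "\<lambda>k M'. (l - k < period F j \<longrightarrow> M' per j = period F j) \<and>
    (\<forall>j'. j' \<noteq> j \<longrightarrow> M' per j' = M per j')" and N = l])
  let ?I = "\<lambda>k M'. (l - k < period F j \<longrightarrow> M' per j = period F j) \<and>
    (\<forall>j'. j' \<noteq> j \<longrightarrow> M' per j' = M per j')"
  obtain p where p: "0 < p" "p \<le> l" "(F ^^ p) j = j"
    using per by blast
  note per_F = period_props[OF p(1,3)]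
  then have per_l: "\<not> l < period F j"
    using p(2) by simp
  fix i M1
  let ?body = "If (Bin Eq (Cell tab (Ix (V ''j'') (Bin Sub (V ''l'') (V ''i'')))) (V ''j''))
        (Store per (V ''j'') (Bin Sub (V ''l'') (V ''i''))) Skip"
  {
    assume i: "i < l" and I: "?I i M1"
      and M1i: "M1 ''i'' 0 = i" and fr: "frame (insert ''i'' (writes ?body)) M M1"
    have M1: "M1 ''l'' 0 = l" "M1 ''b'' 0 = b" "M1 ''j'' 0 = j" "M1 tab (idx b j (l - i)) = (F ^^ (l - i)) j"
      using names M fr by (auto simp: frame_def)
    have Fi: "(F ^^ (l - i)) j < l"
      using funpow_closed[OF F j] .
    show "runs w s Z ?body M1 (\<lambda>M''. ?I (Suc i) (setv ''i'' (Suc i) M''))"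
    proof (rule runs_If, goal_cases)
      case 1
      then show ?case
        using M1 M1i j i Fi by simp
    next
      case 2
      then have "(F ^^ (l - i)) j = j"
        using M1 M1i by (simp split: if_splits)
      then have "period F j \<le> l - i"
        using i by (intro period_props) auto
      then show ?case
        by (intro runs_Store) (use names M1 M1i i j I in auto)
    next
      case 3
      then have "(F ^^ (l - i)) j \<noteq> j"
        using M1 M1i by (simp split: if_splits)
      then have "period F j \<noteq> l - i"
        using per_F(2) by metis
      then show ?case
        using names I i by (intro runs_Skip) auto
    qed
  }
  {
    assume "?I l M1"
    then show "M1 per j = period F j \<and> (\<forall>j'. j' \<noteq> j \<longrightarrow> M1 per j' = M per j')"
      using per_F(1) by simp
  }
  show "?I 0 (setv ''i'' 0 M)"
    using per_l names by simp
qed (use names M l_le_Z in auto)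

lemma runs_orbit:
  assumes names: "tab \<notin> {''j'', ''i'', ''l'', ''b'', f}" "per \<notin> {''j'', ''i'', ''l'', ''b'', f}" "tab \<noteq> per"
      "f \<noteq> ''j''" "f \<noteq> ''i''"
    and M: "M ''l'' 0 = l" "M ''b'' 0 = b" "\<And>j. j < l \<Longrightarrow> M f j = F j" and F: "\<forall>j<l. F j < l"
    and per: "\<And>j. j < l \<Longrightarrow> \<exists>p. 0 < p \<and> p \<le> l \<and> (F ^^ p) j = j"
  shows "runs w s Z (orbit_prog f tab per) M (\<lambda>M'.
    (\<forall>j<l. \<forall>i\<le>l. M' tab (idx b j i) = (F ^^ i) j) \<and> (\<forall>j<l. M' per j = period F j))"
  unfolding orbit_prog_def
proof (rule runs_For[where I = "\<lambda>k M'. (\<forall>j<k. \<forall>i\<le>l. M' tab (idx b j i) = (F ^^ i) j) \<and>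
    (\<forall>j<k. M' per j = period F j)" and N = l])
  let ?I = "\<lambda>k M'. (\<forall>j<k. \<forall>i\<le>l. M' tab (idx b j i) = (F ^^ i) j) \<and> (\<forall>j<k. M' per j = period F j)"
  fix j M1
  assume j: "j < l" and I: "?I j M1"
    and M1j: "M1 ''j'' 0 = j" and fr: "frame (insert ''j'' (writes (Seq (orbit_row f tab) (orbit_period tab per)))) M M1"
  have M1: "M1 ''l'' 0 = l" "M1 ''b'' 0 = b" "\<And>j. j < l \<Longrightarrow> M1 f j = F j"
  proof -
    have "M1 ''l'' = M ''l''" "M1 ''b'' = M ''b''" "M1 f = M f"
      by (rule frameD[OF fr], use names in auto)+
    then show "M1 ''l'' 0 = l" "M1 ''b'' 0 = b" "\<And>j. j < l \<Longrightarrow> M1 f j = F j"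
      using M by simp_all
  qed
  show "runs w s Z (Seq (orbit_row f tab) (orbit_period tab per)) M1
      (\<lambda>M''. ?I (Suc j) (setv ''j'' (Suc j) M''))"
  proof (rule runs_SeqI[OF runs_orbit_row[where F = F and j = j]])
    fix M2
    assume M2: "(\<forall>i\<le>l. M2 tab (idx b j i) = (F ^^ i) j) \<and>
      (\<forall>j' i. j' \<noteq> j \<longrightarrow> i < b \<longrightarrow> M2 tab (idx b j' i) = M1 tab (idx b j' i))"
      and fr2: "frame (writes (orbit_row f tab)) M1 M2"
    show "runs w s Z (orbit_period tab per) M2
      (\<lambda>M''. ?I (Suc j) (setv ''j'' (Suc j) M''))"
    proof (rule runs_conseq[OF runs_orbit_period[where F = F and j = j]])
      fix M3
      assume M3: "M3 per j = period F j \<and> (\<forall>j'. j' \<noteq> j \<longrightarrow> M3 per j' = M2 per j')"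
        and fr3: "frame (writes (orbit_period tab per)) M2 M3"
      have "M3 tab = M2 tab" "M2 per = M1 per"
        using names fr2 fr3 by (auto simp: frame_def)
      then show "?I (Suc j) (setv ''j'' (Suc j) M3)"
        using names I M2 M3 by (simp add: less_Suc_eq all_conj_distrib disj_imp) auto
    qed (use names M1 M1j M2 fr2 F j per in \<open>auto simp: frame_def\<close>)
  qed (use names M1 M1j F j in auto)
qed (use names M l_le_Z in auto)

end

section \<open>Preprocessing\<close>

text \<open>The period of \<open>next\<close> at the initial pointer is the degree, so one full turn
  numbers all ports of the vertex.\<close>

definition pos_row :: com where
  "pos_row = For ''i'' (Cell ''nper'' (Cell ''pointer'' (V ''v'')))
     (Store ''pos'' (Cell ''ntab'' (Ix (Cell ''pointer'' (V ''v'')) (V ''i''))) (V ''i''))"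

definition pos_prog :: com where "pos_prog = For ''v'' (V ''n'') pos_row"

definition tokens_left :: "string \<Rightarrow> com" where
  "tokens_left t = Seq (For ''v'' (V ''n'') (Store ''u'' (V ''v'') (Cell ''tokens'' (V ''v''))))
    (For ''j'' (V ''l'') (Store ''u'' (Cell ''head'' (V ''j''))
      (Bin Add (Cell ''u'' (Cell ''head'' (V ''j''))) (Cell ''cum'' (Ix (V t) (V ''j''))))))"

lemma writes_tokens_left [simp]: "writes (tokens_left t) = {''u'', ''v'', ''j''}"
  by (auto simp: tokens_left_def)

text \<open>\<open>w_ge\<close> is dictated by the scores: fewer than G summands, each a difference
  of cumulative loads and at most \<open>G * K\<close>. \<open>T_less\<close> makes every simulated
  time a legal row index.\<close>

locale rotor_program = rotor_network n l src dst rev pos tok + machine w s Z l b G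
  for n l :: nat and src dst rev pos tok :: "nat \<Rightarrow> nat" and w s Z b G :: nat +
  fixes nx ptr :: "nat \<Rightarrow> nat" and T K :: nat
  assumes nx_less: "j < l \<Longrightarrow> nx j < l"
    and nx_period: "j < l \<Longrightarrow> (nx ^^ deg (src j)) j = j" "j < l \<Longrightarrow> period nx j = deg (src j)"
    and ptr: "v < n \<Longrightarrow> ptr v < l" "v < n \<Longrightarrow> src (ptr v) = v"
    and pos_ptr: "v < n \<Longrightarrow> i < deg v \<Longrightarrow> src ((nx ^^ i) (ptr v)) = v \<and> pos ((nx ^^ i) (ptr v)) = i"
    and K: "K = (\<Sum>v<n. tok v)"
    and n_less: "n < G" "n \<le> Z"
    and T_less: "T + W + 1 < G"
    and w_ge: "G * G * (K + 1) \<le> w"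
begin

lemma two_less_w [simp]: "Suc (Suc 0) < w"
proof -
  have "2 * 2 \<le> G * G"
    using G_ge by (intro mult_le_mono)
  then show ?thesis
    using G2 s_le by linarith
qed

lemma GK_less: "G * (K + 1) < w"
proof -
  have "1 * (G * (K + 1)) < G * (G * (K + 1))"
    using G_ge by (intro mult_strict_right_mono) auto
  then show ?thesis
    using w_ge by (simp only: mult.assoc mult_1) 
qed

lemma C_le_GK: "t \<le> T + W + 1 \<Longrightarrow> e < l \<Longrightarrow> C t e \<le> G * K"
  unfolding K using T_less by (intro order_trans[OF C_le] mult_le_mono1) auto

lemma U_le_GK: "t \<le> T + W + 1 \<Longrightarrow> v < n \<Longrightarrow> U t v \<le> G * K"
  unfolding K using T_less by (intro order_trans[OF U_le] mult_le_mono1) auto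

lemma less_w_if_le_GK: "x \<le> G * K \<Longrightarrow> y \<le> G \<Longrightarrow> x + y < w"
  using GK_less by simp

lemma C_less_w: "t \<le> T + W + 1 \<Longrightarrow> e < l \<Longrightarrow> C t e < w"
  using C_le_GK[of t e] less_w_if_le_GK[of _ 0] by fastforce

lemma U_less_w: "t \<le> T + W + 1 \<Longrightarrow> v < n \<Longrightarrow> U t v < w"
  using U_le_GK[of t v] less_w_if_le_GK[of _ 0] by fastforce

lemma less_n [simp]: "v < n \<Longrightarrow> v < G" "v < n \<Longrightarrow> v < w" "v < n \<Longrightarrow> v < s" "n < w" "v < n \<Longrightarrow> Suc v < w"
  using n_less G_le s_le by auto

lemma less_T [simp]: "t \<le> T + W + 1 \<Longrightarrow> t < G" "t \<le> T + W + 1 \<Longrightarrow> t < w" "t \<le> T + W + 1 \<Longrightarrow> t < s" 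
  using T_less G_le s_le by auto

lemma src_less_w [simp]: "j < l \<Longrightarrow> src j < w" "j < l \<Longrightarrow> dst j < w" "j < l \<Longrightarrow> src j < s" "j < l \<Longrightarrow> dst j < s"
  using src_less[of j] dst_less[of j] by auto

definition inp :: "memory \<Rightarrow> bool" where
  "inp M \<longleftrightarrow> M ''n'' 0 = n \<and> M ''l'' 0 = l \<and> M ''b'' 0 = b \<and>
    (\<forall>j<l. M ''tail'' j = src j) \<and> (\<forall>j<l. M ''head'' j = dst j) \<and> (\<forall>j<l. M ''next'' j = nx j) \<and>
    (\<forall>v<n. M ''pointer'' v = ptr v) \<and> (\<forall>v<n. M ''tokens'' v = tok v)"

lemma inpD:
  assumes "inp M"
  shows "M ''n'' 0 = n" "M ''l'' 0 = l" "M ''b'' 0 = b" "\<And>j. j < l \<Longrightarrow> M ''tail'' j = src j"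
    "\<And>j. j < l \<Longrightarrow> M ''head'' j = dst j" "\<And>j. j < l \<Longrightarrow> M ''next'' j = nx j"
    "\<And>v. v < n \<Longrightarrow> M ''pointer'' v = ptr v" "\<And>v. v < n \<Longrightarrow> M ''tokens'' v = tok v"
  using assms by (simp_all add: inp_def)

definition input_names :: "string set" where
  "input_names = {''n'', ''l'', ''b'', ''tail'', ''head'', ''next'', ''pointer'', ''tokens''}"

lemma inp_frame:
  assumes "inp M" "frame X M M'" "X \<inter> input_names = {}"
  shows "inp M'"
proof -
  have "M' y = M y" if "y \<in> input_names" for y
    by (rule frameD[OF assms(2)]) (use assms(3) that in blast)
  then show ?thesis
    using assms(1) by (simp add: inp_def input_names_def)
qed

lemma tok_less_w [simp]: "v < n \<Longrightarrow> tok v < w"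
  using U_less_w[of 1 v] by (simp add: le_less_trans)

lemma runs_fill:
  assumes "ev M bd = N" "ok w s M bd" "vars bd \<inter> {x, arr} = {}" "x \<noteq> arr" "N \<le> Z" "N < G"
    and step: "\<And>i M'. i < N \<Longrightarrow> frame {x, arr} M M' \<Longrightarrow> M' x 0 = i \<Longrightarrow> ok w s M' e \<and> ev M' e = f i"
  shows "runs w s Z (For x bd (Store arr (V x) e)) M (\<lambda>M'. \<forall>i<N. M' arr i = f i)"
proof (rule runs_For[where I = "\<lambda>k M'. \<forall>i<k. M' arr i = f i" and N = N])
  fix i M1
  assume "i < N" "\<forall>j<i. M1 arr j = f j" "M1 x 0 = i" "frame (insert x (writes (Store arr (V x) e))) M M1"
  moreover from this(4) have "frame {x, arr} M M1"
    by simp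
  moreover have "i < G"
    using \<open>i < N\<close> assms(6) by simp
  ultimately show "runs w s Z (Store arr (V x) e) M1 (\<lambda>M''. \<forall>j<Suc i. setv x (Suc i) M'' arr j = f j)"
    using step[of i M1] assms(4) by (intro runs_Store) (auto simp: less_Suc_eq)
qed (use assms in auto)

lemma runs_accumulate:
  assumes names: "u \<noteq> ''j''" "u \<noteq> h" "h \<noteq> ''j''" "u \<noteq> ''l''"
    and M: "M ''l'' 0 = l" "\<And>j. j < l \<Longrightarrow> M h j = H j" and H: "\<And>j. j < l \<Longrightarrow> H j < n"
    and step: "\<And>j M'. j < l \<Longrightarrow> frame {''j'', u} M M' \<Longrightarrow> M' ''j'' 0 = j \<Longrightarrow> ok w s M' e \<and> ev M' e = g j"
    and bound: "\<And>v. v < n \<Longrightarrow> M u v + (\<Sum>j\<in>{j. j < l \<and> H j = v}. g j) < w"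
  shows "runs w s Z (For ''j'' (V ''l'') (Store u (Cell h (V ''j'')) (Bin Add (Cell u (Cell h (V ''j''))) e))) M
    (\<lambda>M'. \<forall>v<n. M' u v = M u v + (\<Sum>j\<in>{j. j < l \<and> H j = v}. g j))"
proof (rule runs_For[where I = "\<lambda>k M'. \<forall>v<n. M' u v = M u v + (\<Sum>j\<in>{j. j < k \<and> H j = v}. g j)" and N = l])
  fix j M1
  assume j: "j < l" and I: "\<forall>v<n. M1 u v = M u v + (\<Sum>i\<in>{i. i < j \<and> H i = v}. g i)" and M1j: "M1 ''j'' 0 = j"
    and "frame (insert ''j'' (writes (Store u (Cell h (V ''j'')) (Bin Add (Cell u (Cell h (V ''j''))) e)))) M M1"
  then have fr: "frame {''j'', u} M M1"
    by simp
  have h: "M1 h j = H j"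
    using frameD[OF fr, of h] names M(2) j by simp
  have Suc: "(\<Sum>i\<in>{i. i < Suc j \<and> H i = v}. g i) =
      (\<Sum>i\<in>{i. i < j \<and> H i = v}. g i) + (if H j = v then g j else 0)" for v
  proof -
    have "{i. i < Suc j \<and> H i = v} = (if H j = v then insert j {i. i < j \<and> H i = v} else {i. i < j \<and> H i = v})"
      by (auto simp: less_Suc_eq)
    then show ?thesis
      by simp
  qed
  \<comment> \<open>Partial sums are dominated by the full sum, the only quantity that
    \<open>bound\<close> controls.\<close>
  have "(\<Sum>i\<in>{i. i < Suc j \<and> H i = H j}. g i) \<le> (\<Sum>i\<in>{i. i < l \<and> H i = H j}. g i)"
    by (rule sum_mono2) (use j in auto)
  then have le: "M u (H j) + (\<Sum>i\<in>{i. i < j \<and> H i = H j}. g i) + g j < w"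
    using bound[OF H[OF j]] by (simp add: Suc)
  note e = step[OF j fr M1j]
  show "runs w s Z (Store u (Cell h (V ''j'')) (Bin Add (Cell u (Cell h (V ''j''))) e)) M1
      (\<lambda>M''. \<forall>v<n. setv ''j'' (Suc j) M'' u v = M u v + (\<Sum>i\<in>{i. i < Suc j \<and> H i = v}. g i))"
  proof (rule runs_Store)
    show "ok w s M1 (Bin Add (Cell u (Cell h (V ''j''))) e)"
      using e I le j M1j h H[OF j] by simp
  qed (use e I j M1j h H[OF j] names in \<open>simp_all add: Suc\<close>)
qed (use names M l_le_Z in auto)

lemma runs_pos_row:
  assumes M: "inp M" "M ''v'' 0 = v" "\<forall>j<l. \<forall>i\<le>l. M ''ntab'' (idx b j i) = (nx ^^ i) j" "\<forall>j<l. M ''nper'' j = deg (src j)"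
    and v: "v < n" and pos: "\<forall>j<l. src j < v \<longrightarrow> M ''pos'' j = pos j"
  shows "runs w s Z pos_row M (\<lambda>M'. \<forall>j<l. src j < Suc v \<longrightarrow> M' ''pos'' j = pos j)"
  unfolding pos_row_def
proof (rule runs_For[where N = "deg v" and I = "\<lambda>k M'. \<forall>j<l. src j < v \<or> src j = v \<and> pos j < k \<longrightarrow> M' ''pos'' j = pos j"])
  let ?body = "Store ''pos'' (Cell ''ntab'' (Ix (Cell ''pointer'' (V ''v'')) (V ''i''))) (V ''i'')"
  fix i M1
  assume i: "i < deg v" and I: "\<forall>j<l. src j < v \<or> src j = v \<and> pos j < i \<longrightarrow> M1 ''pos'' j = pos j"
    and M1i: "M1 ''i'' 0 = i" and fr: "frame (insert ''i'' (writes ?body)) M M1"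
  define e where "e = (nx ^^ i) (ptr v)"
  have e: "e < l" "src e = v" "pos e = i"
    using pos_ptr[OF v i] funpow_closed[of l nx "ptr v" i] nx_less ptr(1)[OF v] by (auto simp: e_def)
  have il: "i < l"
    using i deg_le[of v] by simp
  have M1: "M1 ''v'' 0 = v" "M1 ''pointer'' v = ptr v" "M1 ''b'' 0 = b" "M1 ''ntab'' (idx b (ptr v) i) = e"
    using fr M(2,3) inpD[OF M(1)] v il ptr(1)[OF v] by (auto simp: frame_def e_def)
  have uniq: "j = e" if "j < l" "src j = v" "pos j = i" for j
    using pos_bij_outs[OF v] that e by (auto simp: bij_betw_def outs_def dest: inj_onD)
  show "runs w s Z ?body M1 (\<lambda>M''. \<forall>j<l. src j < v \<or> src j = v \<and> pos j < Suc i \<longrightarrow> setv ''i'' (Suc i) M'' ''pos'' j = pos j)"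
  proof (rule runs_Store)
    have "M1 ''pos'' j = pos j" if "j < l" "src j < v \<or> src j = v \<and> pos j < Suc i" "j \<noteq> e" for j
      using I uniq[of j] that by (auto simp: less_Suc_eq)
    then show "\<forall>j<l. src j < v \<or> src j = v \<and> pos j < Suc i \<longrightarrow> setv ''i'' (Suc i)
        (M1(''pos'' := (M1 ''pos'')(ev M1 (Cell ''ntab'' (Ix (Cell ''pointer'' (V ''v'')) (V ''i''))) := ev M1 (V ''i'')))) ''pos'' j = pos j"
      using M1 M1i e by simp
  qed (use M1 M1i e v il ptr(1)[OF v] in simp_all)
next
  show "\<forall>j<l. src j < Suc v \<longrightarrow> M' ''pos'' j = pos j"
    if "\<forall>j<l. src j < v \<or> src j = v \<and> pos j < deg v \<longrightarrow> M' ''pos'' j = pos j" for M'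
    using that pos_less by (auto simp: less_Suc_eq)
  show "deg v < w" "deg v \<le> Z"
    using deg_le[of v] l_le_Z by (auto intro: less_if_G)
qed (use M v pos ptr[OF v] inpD[OF M(1)] deg_le in auto)

lemma runs_pos:
  assumes M: "inp M" "\<forall>j<l. \<forall>i\<le>l. M ''ntab'' (idx b j i) = (nx ^^ i) j" "\<forall>j<l. M ''nper'' j = deg (src j)"
  shows "runs w s Z pos_prog M (\<lambda>M'. \<forall>j<l. M' ''pos'' j = pos j)"
  unfolding pos_prog_def
proof (rule runs_For[where N = n and I = "\<lambda>k M'. \<forall>j<l. src j < k \<longrightarrow> M' ''pos'' j = pos j"])
  fix v M1
  assume v: "v < n" and I: "\<forall>j<l. src j < v \<longrightarrow> M1 ''pos'' j = pos j" and M1v: "M1 ''v'' 0 = v"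
    and "frame (insert ''v'' (writes pos_row)) M M1"
  then have fr: "frame {''v'', ''i'', ''pos''} M M1"
    by (simp add: pos_row_def)
  have "inp M1" "M1 ''ntab'' = M ''ntab''" "M1 ''nper'' = M ''nper''"
    using inp_frame[OF M(1) fr, unfolded input_names_def] frameD[OF fr] by simp_all
  then show "runs w s Z pos_row M1 (\<lambda>M''. \<forall>j<l. src j < Suc v \<longrightarrow> setv ''v'' (Suc v) M'' ''pos'' j = pos j)"
    using runs_pos_row[of M1 v] M M1v v I by simp
qed (use M inpD[OF M(1)] n_less src_less in \<open>auto simp: pos_row_def\<close>)

lemma runs_tokens_left:
  assumes "tn \<notin> {''u'', ''v'', ''j''}" and M: "inp M" "M tn 0 = t" "\<forall>j<l. M ''cum'' (idx b t j) = C t j"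
    and t: "t \<le> T + W"
  shows "runs w s Z (tokens_left tn) M (\<lambda>M'. \<forall>v<n. M' ''u'' v = U (Suc t) v)"
  unfolding tokens_left_def
proof (rule runs_SeqI)
  show "runs w s Z (For ''v'' (V ''n'') (Store ''u'' (V ''v'') (Cell ''tokens'' (V ''v'')))) M (\<lambda>M'. \<forall>v<n. M' ''u'' v = tok v)"
    by (rule runs_fill) (use inpD[OF M(1)] n_less in \<open>auto simp: frame_def\<close>)
next
  fix M1
  assume M1u: "\<forall>v<n. M1 ''u'' v = tok v"
    and "frame (writes (For ''v'' (V ''n'') (Store ''u'' (V ''v'') (Cell ''tokens'' (V ''v''))))) M M1"
  then have fr: "frame {''v'', ''u''} M M1"
    by simp
  have M1: "inp M1" "M1 tn 0 = t" "M1 ''cum'' = M ''cum''"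
    using inp_frame[OF M(1) fr, unfolded input_names_def] frameD[OF fr] assms(1) M(2) by simp_all
  have U: "tok v + (\<Sum>j\<in>{j. j < l \<and> dst j = v}. C t j) = U (Suc t) v" for v
    by (simp add: ins_def)
  show "runs w s Z (For ''j'' (V ''l'') (Store ''u'' (Cell ''head'' (V ''j''))
      (Bin Add (Cell ''u'' (Cell ''head'' (V ''j''))) (Cell ''cum'' (Ix (V tn) (V ''j'')))))) M1
    (\<lambda>M'. \<forall>v<n. M' ''u'' v = U (Suc t) v)"
  proof (rule runs_conseq[OF runs_accumulate[where H = dst and g = "C t"]])
    fix j M2
    assume j: "j < l" and fr2: "frame {''j'', ''u''} M1 M2" and M2j: "M2 ''j'' 0 = j"
    have "M2 ''b'' 0 = b" "M2 tn 0 = t" "M2 ''cum'' (idx b t j) = C t j"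
      using frameD[OF fr2] inpD[OF M1(1)] M1(2,3) assms(1) M(3) j by simp_all
    then show "ok w s M2 (Cell ''cum'' (Ix (V tn) (V ''j''))) \<and> ev M2 (Cell ''cum'' (Ix (V tn) (V ''j''))) = C t j"
      using j M2j t C_less_w[of t j] by simp
  next
    show "M1 ''u'' v + sum (C t) {j. j < l \<and> dst j = v} < w" if "v < n" for v
      using that M1u U[of v] U_less_w[of "Suc t" v] t by simp
  qed (use inpD[OF M1(1)] M1u U dst_less in auto)
qed

end

section \<open>Programs for cumulative loads, ranks, predecessors and prefix sums\<close>

definition load_expr :: expr where
  "load_expr = Bin Div (Bin Add (Cell ''u'' (Cell ''tail'' (V ''j'')))
    (Bin Sub (Bin Sub (Cell ''nper'' (V ''j'')) (Const 1)) (Cell ''pos'' (V ''j'')))) (Cell ''nper'' (V ''j''))"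

definition cum_row :: com where
  "cum_row = For ''j'' (V ''l'') (Store ''cum'' (Ix (Bin Add (V ''t'') (Const 1)) (V ''j'')) load_expr)"

definition cum_prog :: com where
  "cum_prog = Seq (For ''j'' (V ''l'') (Store ''cum'' (V ''j'') (Const 0)))
    (For ''t'' (V ''R'') (Seq (tokens_left ''t'') cum_row))"

definition score_row :: com where
  "score_row = For ''t'' (Bin Add (V ''W'') (Const 1)) (Store ''sc'' (V ''j'') (Bin Add (Cell ''sc'' (V ''j''))
    (Bin Sub (Cell ''cum'' (Ix (Bin Add (V ''T'') (V ''t'')) (V ''j''))) (Cell ''cum'' (Ix (V ''T'') (V ''j''))))))"

definition score_prog :: com where
  "score_prog = For ''j'' (V ''l'') (Seq (Store ''sc'' (V ''j'') (Const 0)) score_row)"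

text \<open>Products of truth values act as conjunctions, and the sum as a disjunction of exclusive
  cases.\<close>

definition before_expr :: expr where
  "before_expr = Bin Mul (Bin Eq (Cell ''head'' (V ''i'')) (Cell ''head'' (V ''j'')))
    (Bin Add (Bin Less (Cell ''sc'' (V ''j'')) (Cell ''sc'' (V ''i'')))
      (Bin Mul (Bin Eq (Cell ''sc'' (V ''i'')) (Cell ''sc'' (V ''j''))) (Bin Less (V ''i'') (V ''j''))))"

definition rank_prog :: com where
  "rank_prog = For ''j'' (V ''l'') (Seq (Store ''rk'' (V ''j'') (Const 0))
    (For ''i'' (V ''l'') (If before_expr (Store ''rk'' (V ''j'') (Bin Add (Cell ''rk'' (V ''j'')) (Const 1))) Skip)))"

text \<open>The test from \<open>pred_unique\<close>; \<open>u\<close> has to hold the departures up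
  to time T + 1, from which offsets are counted.\<close>

definition match_expr :: expr where
  "match_expr = Bin Mul (Bin Eq (Cell ''head'' (V ''i'')) (Cell ''tail'' (V ''j'')))
    (Bin Eq (Cell ''rk'' (V ''i''))
      (Bin Mod (Bin Sub (Bin Add (Cell ''pos'' (V ''j'')) (Cell ''nper'' (V ''j'')))
        (Bin Mod (Cell ''u'' (Cell ''tail'' (V ''j''))) (Cell ''nper'' (V ''j'')))) (Cell ''nper'' (V ''j''))))"

definition pred_prog :: com where
  "pred_prog = For ''j'' (V ''l'') (For ''i'' (V ''l'') (If match_expr (Store ''pred'' (V ''j'') (V ''i'')) Skip))"

definition prefix_expr :: expr where
  "prefix_expr = Bin Add (Cell ''atab'' (Ix (V ''j'') (V ''i'')))
    (Bin Sub (Cell ''cum'' (Ix (Bin Add (V ''T'') (Const 1)) (Cell ''stab'' (Ix (V ''j'') (V ''i'')))))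
      (Cell ''cum'' (Ix (V ''T'') (Cell ''stab'' (Ix (V ''j'') (V ''i''))))))"

definition atab_row :: com where
  "atab_row = Seq (Store ''atab'' (Ix (V ''j'') (Const 0)) (Const 0))
    (For ''i'' (V ''l'') (Store ''atab'' (Ix (V ''j'') (Bin Add (V ''i'') (Const 1))) prefix_expr))"

definition atab_prog :: com where "atab_prog = For ''j'' (V ''l'') atab_row"

lemma writes_blocks [simp]: "writes pos_prog = {''v'', ''i'', ''pos''}" "writes cum_row = {''j'', ''cum''}"
  "writes cum_prog = {''u'', ''v'', ''j'', ''t'', ''cum''}" "writes score_prog = {''j'', ''t'', ''sc''}"
  "writes rank_prog = {''j'', ''i'', ''rk''}" "writes pred_prog = {''j'', ''i'', ''pred''}"
  "writes atab_row = {''i'', ''atab''}" "writes atab_prog = {''j'', ''i'', ''atab''}"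
  by (auto simp: pos_prog_def pos_row_def cum_row_def cum_prog_def score_prog_def score_row_def rank_prog_def pred_prog_def
      atab_row_def atab_prog_def)

context rotor_program begin

lemma less_TW [simp]: "t < T + W \<Longrightarrow> Suc t < G" "t < T + W \<Longrightarrow> Suc t < w" "t \<le> W \<Longrightarrow> T + t < G" "t \<le> W \<Longrightarrow> T + t < w"
  "T < w" "Suc T < w" "T < G" "Suc T < G" "W < w" "Suc W < w" "T + W < w" "t < Suc W \<Longrightarrow> t < w"
  using T_less G_le s_le by auto

lemma l_le_W: "l \<le> W" "1 \<le> W"
  using l_ge le_square[of l] unfolding W_def by linarith+

lemma runs_cum_row:
  assumes M: "inp M" "M ''t'' 0 = t" "\<forall>v<n. M ''u'' v = U (Suc t) v" "\<forall>j<l. M ''nper'' j = deg (src j)"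
      "\<forall>j<l. M ''pos'' j = pos j" and t: "t < T + W"
  shows "runs w s Z cum_row M (\<lambda>M'. (\<forall>j<l. M' ''cum'' (idx b (Suc t) j) = C (Suc t) j) \<and>
    (\<forall>t' i. t' \<noteq> Suc t \<longrightarrow> i < b \<longrightarrow> M' ''cum'' (idx b t' i) = M ''cum'' (idx b t' i)))"
  unfolding cum_row_def
proof (rule runs_For[where N = l and I = "\<lambda>k M'. (\<forall>j<k. M' ''cum'' (idx b (Suc t) j) = C (Suc t) j) \<and>
    (\<forall>t' i. t' \<noteq> Suc t \<longrightarrow> i < b \<longrightarrow> M' ''cum'' (idx b t' i) = M ''cum'' (idx b t' i))"])
  let ?I = "\<lambda>k M'. (\<forall>j<k. M' ''cum'' (idx b (Suc t) j) = C (Suc t) j) \<and>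
    (\<forall>t' i. t' \<noteq> Suc t \<longrightarrow> i < b \<longrightarrow> M' ''cum'' (idx b t' i) = M ''cum'' (idx b t' i))"
  let ?body = "Store ''cum'' (Ix (Bin Add (V ''t'') (Const 1)) (V ''j'')) load_expr"
  fix j M1
  assume j: "j < l" and I: "?I j M1" and M1j: "M1 ''j'' 0 = j" and "frame (insert ''j'' (writes ?body)) M M1"
  then have fr: "frame {''j'', ''cum''} M M1"
    by simp
  have M1: "M1 ''t'' 0 = t" "M1 ''b'' 0 = b" "M1 ''tail'' j = src j" "M1 ''u'' (src j) = U (Suc t) (src j)"
    "M1 ''nper'' j = deg (src j)" "M1 ''pos'' j = pos j"
    using frameD[OF fr] inpD[OF M(1)] M(2-5) j src_less[OF j] by (simp_all del: U.simps)
  have U: "U (Suc t) (src j) \<le> G * K"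
    using U_le_GK[of "Suc t" "src j"] t src_less[OF j] by simp
  have d: "deg (src j) \<le> l"
    by (rule deg_le)
  have U_less: "U (Suc t) (src j) < w" "U (Suc t) (src j) + (deg (src j) - Suc 0 - pos j) < w"
    "(U (Suc t) (src j) + (deg (src j) - Suc 0 - pos j)) div deg (src j) < w"
  proof -
    show *: "U (Suc t) (src j) + (deg (src j) - Suc 0 - pos j) < w"
      by (rule less_w_if_le_GK[OF U]) (use d l_less b_le in linarith)
    show "U (Suc t) (src j) < w"
      using * by linarith
    show "(U (Suc t) (src j) + (deg (src j) - Suc 0 - pos j)) div deg (src j) < w"
      using * by (rule le_less_trans[OF div_le_dividend])
  qed
  have small: "deg (src j) < w" "pos j < w" "deg (src j) - Suc 0 < w" "deg (src j) - Suc 0 - pos j < w"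
    using d pos_less[OF j] less_if_G(3)[of "deg (src j)"] by auto
  have C: "C (Suc t) j = (U (Suc t) (src j) + (deg (src j) - Suc 0 - pos j)) div deg (src j)"
    using C_eq_stair[OF j, of "Suc t"] by (simp add: stair_def del: C.simps U.simps)
  have "ok w s M1 load_expr \<and> ev M1 load_expr = C (Suc t) j"
    using M1 M1j C U_less small j src_less[OF j] by (simp add: load_expr_def del: C.simps U.simps)
  then show "runs w s Z ?body M1 (\<lambda>M''. ?I (Suc j) (setv ''j'' (Suc j) M''))"
    by (intro runs_Store) (use M1 M1j I j t in \<open>auto simp: less_Suc_eq simp del: C.simps U.simps\<close>)
qed (use M inpD[OF M(1)] l_le_Z in \<open>auto simp del: C.simps U.simps\<close>)

lemma runs_cum:
  assumes M: "inp M" "M ''R'' 0 = T + W" "\<forall>j<l. M ''nper'' j = deg (src j)" "\<forall>j<l. M ''pos'' j = pos j"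
    and Z: "T + W \<le> Z"
  shows "runs w s Z cum_prog M (\<lambda>M'. \<forall>t\<le>T + W. \<forall>j<l. M' ''cum'' (idx b t j) = C t j)"
  unfolding cum_prog_def
proof (rule runs_SeqI)
  show "runs w s Z (For ''j'' (V ''l'') (Store ''cum'' (V ''j'') (Const 0))) M (\<lambda>M'. \<forall>j<l. M' ''cum'' j = 0)"
    by (rule runs_fill) (use inpD[OF M(1)] l_le_Z in \<open>auto simp: frame_def\<close>)
next
  fix M0
  assume M0c: "\<forall>j<l. M0 ''cum'' j = 0" and "frame (writes (For ''j'' (V ''l'') (Store ''cum'' (V ''j'') (Const 0)))) M M0"
  then have fr0: "frame {''j'', ''cum''} M M0"
    by simp
  have M0: "inp M0" "M0 ''R'' 0 = T + W" "M0 ''nper'' = M ''nper''" "M0 ''pos'' = M ''pos''"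
    using inp_frame[OF M(1) fr0, unfolded input_names_def] frameD[OF fr0] M(2) by simp_all
  let ?I = "\<lambda>k M'. \<forall>t\<le>k. \<forall>j<l. M' ''cum'' (idx b t j) = C t j"
  show "runs w s Z (For ''t'' (V ''R'') (Seq (tokens_left ''t'') cum_row)) M0 (?I (T + W))"
  proof (rule runs_For[where N = "T + W" and I = ?I])
    show "?I 0 (setv ''t'' 0 M0)"
      using M0c by (simp add: idx_def)
  next
    fix t M1
    assume t: "t < T + W" and I: "?I t M1" and M1t: "M1 ''t'' 0 = t"
      and "frame (insert ''t'' (writes (Seq (tokens_left ''t'') cum_row))) M0 M1"
    then have fr1: "frame {''t'', ''u'', ''v'', ''j'', ''cum''} M0 M1"
      by (simp add: insert_commute)
    have M1: "inp M1" "M1 ''nper'' = M ''nper''" "M1 ''pos'' = M ''pos''"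
      using inp_frame[OF M0(1) fr1, unfolded input_names_def] frameD[OF fr1] M0 by simp_all
    show "runs w s Z (Seq (tokens_left ''t'') cum_row) M1 (\<lambda>M''. ?I (Suc t) (setv ''t'' (Suc t) M''))"
    proof (rule runs_SeqI[OF runs_tokens_left[where t = t]])
      fix M2
      assume M2u: "\<forall>v<n. M2 ''u'' v = U (Suc t) v" and "frame (writes (tokens_left ''t'')) M1 M2"
      then have fr2: "frame {''u'', ''v'', ''j''} M1 M2"
        by simp
      have M2: "inp M2" "M2 ''t'' 0 = t" "M2 ''nper'' = M ''nper''" "M2 ''pos'' = M ''pos''" "M2 ''cum'' = M1 ''cum''"
        using inp_frame[OF M1(1) fr2, unfolded input_names_def] frameD[OF fr2] M1 M1t by simp_all
      show "runs w s Z cum_row M2 (\<lambda>M''. ?I (Suc t) (setv ''t'' (Suc t) M''))"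
      proof (rule runs_conseq[OF runs_cum_row[where t = t]])
        fix M3
        assume M3: "(\<forall>j<l. M3 ''cum'' (idx b (Suc t) j) = C (Suc t) j) \<and>
          (\<forall>t' i. t' \<noteq> Suc t \<longrightarrow> i < b \<longrightarrow> M3 ''cum'' (idx b t' i) = M2 ''cum'' (idx b t' i))"
        show "?I (Suc t) (setv ''t'' (Suc t) M3)"
        proof (intro allI impI)
          fix t' j
          assume "t' \<le> Suc t" "j < l"
          then show "setv ''t'' (Suc t) M3 ''cum'' (idx b t' j) = C t' j"
            using M3 I M2(5) by (cases "t' = Suc t") (simp_all del: C.simps)
        qed
      qed (use M2 M2u M t in auto)
    qed (use M1 M1t I t in auto)
  qed (use M0 Z in \<open>auto simp: tokens_left_def cum_row_def\<close>)
qed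

lemma score_partial_less_w:
  assumes "k \<le> Suc W" "j < l"
  shows "(\<Sum>t<k. C (T + t) j - C T j) < w"
proof -
  have "(\<Sum>t<k. C (T + t) j - C T j) \<le> (\<Sum>t<k. G * K)"
    by (rule sum_mono) (use assms C_le_GK in \<open>fastforce intro: order_trans[OF diff_le_self]\<close>)
  also have "\<dots> = k * (G * K)"
    by simp
  also have "\<dots> \<le> G * (G * K)"
    using assms(1) T_less by (intro mult_le_mono1) linarith
  also have "\<dots> < G * G * (K + 1)"
    using G_ge by simp
  finally show ?thesis
    using w_ge by simp
qed

lemma runs_score:
  assumes M: "inp M" "M ''T'' 0 = T" "M ''W'' 0 = W" "\<forall>t\<le>T + W. \<forall>j<l. M ''cum'' (idx b t j) = C t j"
    and Z: "Suc W \<le> Z"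
  shows "runs w s Z score_prog M (\<lambda>M'. \<forall>j<l. M' ''sc'' j = score T j)"
  unfolding score_prog_def
proof (rule runs_For[where N = l and I = "\<lambda>k M'. \<forall>j<k. M' ''sc'' j = score T j"])
  let ?inner = score_row
  fix j M1
  assume j: "j < l" and I: "\<forall>j'<j. M1 ''sc'' j' = score T j'" and M1j: "M1 ''j'' 0 = j"
    and "frame (insert ''j'' (writes (Seq (Store ''sc'' (V ''j'') (Const 0)) ?inner))) M M1"
  then have fr: "frame {''j'', ''t'', ''sc''} M M1"
    by (simp add: score_row_def)
  have M1: "inp M1" "M1 ''T'' 0 = T" "M1 ''W'' 0 = W" "M1 ''cum'' = M ''cum''"
    using inp_frame[OF M(1) fr, unfolded input_names_def] frameD[OF fr] M by simp_all
  show "runs w s Z (Seq (Store ''sc'' (V ''j'') (Const 0)) ?inner) M1 (\<lambda>M''. \<forall>j'<Suc j. setv ''j'' (Suc j) M'' ''sc'' j' = score T j')"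
  proof (intro runs_Seq runs_Store)
    let ?M2 = "M1(''sc'' := (M1 ''sc'')(ev M1 (V ''j'') := ev M1 (Const 0)))"
    show "runs w s Z ?inner ?M2 (\<lambda>M''. \<forall>j'<Suc j. setv ''j'' (Suc j) M'' ''sc'' j' = score T j')"
      unfolding score_row_def
    proof (rule runs_For[where N = "Suc W" and I = "\<lambda>k M'. M' ''sc'' j = (\<Sum>t<k. C (T + t) j - C T j) \<and> (\<forall>j'<j. M' ''sc'' j' = score T j')"])
      let ?body = "Store ''sc'' (V ''j'') (Bin Add (Cell ''sc'' (V ''j''))
        (Bin Sub (Cell ''cum'' (Ix (Bin Add (V ''T'') (V ''t'')) (V ''j''))) (Cell ''cum'' (Ix (V ''T'') (V ''j'')))))"
      fix t M3
      assume t: "t < Suc W" and I3: "M3 ''sc'' j = (\<Sum>t<t. C (T + t) j - C T j) \<and> (\<forall>j'<j. M3 ''sc'' j' = score T j')"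
        and M3t: "M3 ''t'' 0 = t" and "frame (insert ''t'' (writes ?body)) ?M2 M3"
      then have fr3: "frame {''t'', ''sc''} ?M2 M3"
        by simp
      have M3: "M3 ''T'' 0 = T" "M3 ''b'' 0 = b" "M3 ''j'' 0 = j" "M3 ''cum'' = M ''cum''"
        using frameD[OF fr3] M1 inpD[OF M1(1)] M1j by simp_all
      have cum: "M3 ''cum'' (idx b (T + t) j) = C (T + t) j" "M3 ''cum'' (idx b T j) = C T j"
        using M3(4) M(4) t j by simp_all
      have small: "C (T + t) j < w" "C T j < w" "C (T + t) j - C T j < w" "T + t < G" "T + t < w"
        using C_less_w[of "T + t" j] C_less_w[of T j] t j by auto
      have sum: "(\<Sum>t<t. C (T + t) j - C T j) < w" "(\<Sum>t<t. C (T + t) j - C T j) + (C (T + t) j - C T j) < w"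
        using score_partial_less_w[of "t" j] score_partial_less_w[of "Suc t" j] t j by auto
      show "runs w s Z ?body M3 (\<lambda>M''. setv ''t'' (Suc t) M'' ''sc'' j = (\<Sum>t<Suc t. C (T + t) j - C T j) \<and>
          (\<forall>j'<j. setv ''t'' (Suc t) M'' ''sc'' j' = score T j'))"
        by (rule runs_Store) (use M3 M3t cum small sum I3 j t in simp_all)
    next
      show "\<forall>j'<Suc j. setv ''j'' (Suc j) M' ''sc'' j' = score T j'"
        if "M' ''sc'' j = (\<Sum>t<Suc W. C (T + t) j - C T j) \<and> (\<forall>j'<j. M' ''sc'' j' = score T j')" for M'
        using that by (auto simp: score_def less_Suc_eq)
    qed (use M1 M1j I Z in auto)
  qed (use M1j j in simp_all)
qed (use M inpD[OF M(1)] l_le_Z in \<open>auto simp: score_row_def\<close>)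

lemma score_less_w: "j < l \<Longrightarrow> score T j < w"
  unfolding score_def by (rule score_partial_less_w) simp_all

lemma runs_rank:
  assumes M: "inp M" "\<forall>j<l. M ''sc'' j = score T j"
  shows "runs w s Z rank_prog M (\<lambda>M'. \<forall>j<l. M' ''rk'' j = rank T j)"
  unfolding rank_prog_def
proof (rule runs_For[where N = l and I = "\<lambda>k M'. \<forall>j<k. M' ''rk'' j = rank T j"])
  let ?if = "If before_expr (Store ''rk'' (V ''j'') (Bin Add (Cell ''rk'' (V ''j'')) (Const 1))) Skip"
  let ?inner = "For ''i'' (V ''l'') ?if"
  fix j M1
  assume j: "j < l" and I: "\<forall>j'<j. M1 ''rk'' j' = rank T j'" and M1j: "M1 ''j'' 0 = j"
    and "frame (insert ''j'' (writes (Seq (Store ''rk'' (V ''j'') (Const 0)) ?inner))) M M1"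
  then have fr: "frame {''j'', ''i'', ''rk''} M M1"
    by simp
  have M1: "inp M1" "M1 ''sc'' = M ''sc''"
    using inp_frame[OF M(1) fr, unfolded input_names_def] frameD[OF fr] M by simp_all
  define N where "N k = card {f. f < k \<and> dst f = dst j \<and> before T f j}" for k
  have N_Suc: "N (Suc i) = (if dst i = dst j \<and> before T i j then Suc (N i) else N i)" for i
  proof -
    have "{f. f < Suc i \<and> dst f = dst j \<and> before T f j} = (if dst i = dst j \<and> before T i j
        then insert i {f. f < i \<and> dst f = dst j \<and> before T f j} else {f. f < i \<and> dst f = dst j \<and> before T f j})"
      by (auto simp: less_Suc_eq)
    then show ?thesis
      by (simp add: N_def)
  qed
  have N_le: "N i \<le> i" for i
    unfolding N_def using card_mono[of "{..<i}" "{f. f < i \<and> dst f = dst j \<and> before T f j}"] by auto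
  have N_l: "N l = rank T j"
    by (simp add: N_def rank_def ins_def conj_assoc)
  show "runs w s Z (Seq (Store ''rk'' (V ''j'') (Const 0)) ?inner) M1 (\<lambda>M''. \<forall>j'<Suc j. setv ''j'' (Suc j) M'' ''rk'' j' = rank T j')"
  proof (intro runs_Seq runs_Store)
    let ?M2 = "M1(''rk'' := (M1 ''rk'')(ev M1 (V ''j'') := ev M1 (Const 0)))"
    let ?I = "\<lambda>k M'. M' ''rk'' j = N k \<and> (\<forall>j'<j. M' ''rk'' j' = rank T j')"
    show "runs w s Z ?inner ?M2 (\<lambda>M''. \<forall>j'<Suc j. setv ''j'' (Suc j) M'' ''rk'' j' = rank T j')"
    proof (rule runs_For[where N = l and I = ?I])
      fix i M3
      assume i: "i < l" and I3: "?I i M3"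
        and M3i: "M3 ''i'' 0 = i" and "frame (insert ''i'' (writes ?if)) ?M2 M3"
      then have fr3: "frame {''i'', ''rk''} ?M2 M3"
        by simp
      have M3: "M3 ''j'' 0 = j" "M3 ''head'' i = dst i" "M3 ''head'' j = dst j" "M3 ''sc'' i = score T i" "M3 ''sc'' j = score T j"
        using frameD[OF fr3] M1 inpD[OF M1(1)] M1j M(2) i j by simp_all
      have ev: "ev M3 before_expr \<noteq> 0 \<longleftrightarrow> dst i = dst j \<and> before T i j"
        by (auto simp: before_expr_def M3 M3i before_def)
      have ok: "ok w s M3 before_expr"
        using M3 M3i i j score_less_w by (simp add: before_expr_def)
      have N_w: "N i < w" "Suc (N i) < w"
        using N_le[of i] i less_b(6)[OF i] by linarith+
      show "runs w s Z ?if M3 (\<lambda>M''. ?I (Suc i) (setv ''i'' (Suc i) M''))"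
      proof (rule runs_If[OF ok])
        assume "ev M3 before_expr \<noteq> 0"
        then show "runs w s Z (Store ''rk'' (V ''j'') (Bin Add (Cell ''rk'' (V ''j'')) (Const 1))) M3
            (\<lambda>M''. ?I (Suc i) (setv ''i'' (Suc i) M''))"
          unfolding ev by (intro runs_Store) (use M3 I3 N_w j in \<open>simp_all add: N_Suc\<close>)
      next
        assume "ev M3 before_expr = 0"
        then have "\<not> (dst i = dst j \<and> before T i j)"
          using ev by blast
        then show "runs w s Z Skip M3 (\<lambda>M''. ?I (Suc i) (setv ''i'' (Suc i) M''))"
          using I3 by (intro runs_Skip) (simp add: N_Suc)
      qed
    next
      show "\<forall>j'<Suc j. setv ''j'' (Suc j) M' ''rk'' j' = rank T j'"
        if "?I l M'" for M'
        using that N_l by (auto simp: less_Suc_eq)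
      show "?I 0 (setv ''i'' 0 ?M2)"
        using I M1j by (simp add: N_def)
    qed (use inpD[OF M1(1)] l_le_Z in auto)
  qed (use M1j j in simp_all)
qed (use M inpD[OF M(1)] l_le_Z in auto)

lemma runs_pred:
  assumes M: "inp M" "\<forall>j<l. M ''rk'' j = rank T j" "\<forall>v<n. M ''u'' v = U (Suc T) v"
    "\<forall>j<l. M ''nper'' j = deg (src j)" "\<forall>j<l. M ''pos'' j = pos j"
  shows "runs w s Z pred_prog M (\<lambda>M'. \<forall>j<l. M' ''pred'' j = pred T j)"
  unfolding pred_prog_def
proof (rule runs_For[where N = l and I = "\<lambda>k M'. \<forall>j<k. M' ''pred'' j = pred T j"])
  let ?if = "If match_expr (Store ''pred'' (V ''j'') (V ''i'')) Skip"
  let ?inner = "For ''i'' (V ''l'') ?if"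
  fix j M1
  assume j: "j < l" and I: "\<forall>j'<j. M1 ''pred'' j' = pred T j'" and M1j: "M1 ''j'' 0 = j"
    and "frame (insert ''j'' (writes ?inner)) M M1"
  then have fr: "frame {''j'', ''i'', ''pred''} M M1"
    by simp
  have M1: "inp M1" "M1 ''rk'' = M ''rk''" "M1 ''u'' = M ''u''" "M1 ''nper'' = M ''nper''" "M1 ''pos'' = M ''pos''"
    using inp_frame[OF M(1) fr, unfolded input_names_def] frameD[OF fr] by simp_all
  define a where "a = U (Suc T) (src j)"
  define d where "d = deg (src j)"
  have d: "d \<le> l" "pos j < d" "a < w"
    using deg_le[of "src j"] pos_less[OF j] U_less_w[of "Suc T" "src j"] src_less[OF j] l_le_W(2)
    by (auto simp: d_def a_def simp del: U.simps)
  \<comment> \<open>The scan does not stop at a match, but by \<open>pred_unique\<close> there is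
    only one, so a written entry is final.\<close>
  let ?I = "\<lambda>k M'. (pred T j < k \<longrightarrow> M' ''pred'' j = pred T j) \<and> (\<forall>j'<j. M' ''pred'' j' = pred T j')"
  have offset: "offset T j = (pos j + d - a mod d) mod d"
    by (simp add: offset_def a_def d_def del: U.simps)
  show "runs w s Z ?inner M1 (\<lambda>M''. \<forall>j'<Suc j. setv ''j'' (Suc j) M'' ''pred'' j' = pred T j')"
  proof (rule runs_For[where N = l and I = ?I])
    fix i M3
    assume i: "i < l" and I3: "?I i M3"
      and M3i: "M3 ''i'' 0 = i" and "frame (insert ''i'' (writes ?if)) M1 M3"
    then have fr3: "frame {''i'', ''pred''} M1 M3"
      by simp
    have M3: "M3 ''j'' 0 = j" "M3 ''head'' i = dst i" "M3 ''tail'' j = src j" "M3 ''rk'' i = rank T i"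
      "M3 ''u'' (src j) = a" "M3 ''nper'' j = d" "M3 ''pos'' j = pos j"
      using frameD[OF fr3] M1 inpD[OF M1(1)] M1j M i j src_less[OF j] by (simp_all add: a_def d_def del: U.simps)
    have "ev M3 match_expr \<noteq> 0 \<longleftrightarrow> i \<in> ins (src j) \<and> rank T i = offset T j"
      by (simp add: match_expr_def M3 M3i offset ins_def i)
    then have ev: "ev M3 match_expr \<noteq> 0 \<longleftrightarrow> i = pred T j"
      unfolding pred_unique[OF j] .
    have rk: "rank T i < w"
    proof -
      have "i \<in> ins (dst i)"
        using i by (simp add: ins_def)
      then have "rank T i < deg (dst i)"
        using rank_bij_ins[of T "dst i"] by (auto simp: bij_betw_def)
      then show ?thesis
        using deg_le[of "dst i"] by simp
    qed
    have "pos j + d < w"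
    proof -
      have "pos j + d < G + G"
        using d l_less b_le by linarith
      also have "G + G \<le> G * G"
        using mult_le_mono1[OF G_ge, of G] by linarith
      finally show ?thesis
        using G2 s_le by linarith
    qed
    moreover have "a mod d < d"
      using d by simp
    ultimately have small: "pos j < w" "d < w" "pos j + d < w" "a mod d < w" "pos j + d - a mod d < w"
      "(pos j + d - a mod d) mod d < w"
      using d by (auto intro: le_less_trans[OF mod_less_eq_dividend])
    have ok: "ok w s M3 match_expr"
      using M3 M3i i j small rk d(3) by (simp add: match_expr_def)
    show "runs w s Z ?if M3 (\<lambda>M''. ?I (Suc i) (setv ''i'' (Suc i) M''))"
    proof (rule runs_If[OF ok])
      assume "ev M3 match_expr \<noteq> 0"
      then have "pred T j = i"
        using ev by simp
      then show "runs w s Z (Store ''pred'' (V ''j'') (V ''i'')) M3 (\<lambda>M''. ?I (Suc i) (setv ''i'' (Suc i) M''))"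
        by (intro runs_Store) (use M3 M3i I3 i j in simp_all)
    next
      assume "ev M3 match_expr = 0"
      then have "pred T j \<noteq> i"
        using ev by auto
      then show "runs w s Z Skip M3 (\<lambda>M''. ?I (Suc i) (setv ''i'' (Suc i) M''))"
        using I3 by (intro runs_Skip) (simp add: less_Suc_eq)
    qed
  next
    show "\<forall>j'<Suc j. setv ''j'' (Suc j) M' ''pred'' j' = pred T j'"
      if "?I l M'" for M'
      using that pred_props(1)[OF j] by (auto simp: less_Suc_eq)
  qed (use inpD[OF M1(1)] l_le_Z I in auto)
qed (use M inpD[OF M(1)] l_le_Z in auto)

lemma path_load_le: "settled T \<Longrightarrow> j < l \<Longrightarrow> path_load T i j \<le> C (T + i) j"
  by (simp add: C_after_settled)

lemma runs_atab_row:
  assumes "settled T" and M: "inp M" "M ''T'' 0 = T" "M ''j'' 0 = j" "\<forall>t\<le>T + W. \<forall>j<l. M ''cum'' (idx b t j) = C t j"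
    "\<forall>i\<le>l. M ''stab'' (idx b j i) = (pred T ^^ i) j" and j: "j < l"
  shows "runs w s Z atab_row M (\<lambda>M'. (\<forall>i\<le>l. M' ''atab'' (idx b j i) = path_load T i j) \<and>
    (\<forall>j' i. j' \<noteq> j \<longrightarrow> i < b \<longrightarrow> M' ''atab'' (idx b j' i) = M ''atab'' (idx b j' i)))"
  unfolding atab_row_def
proof (intro runs_Seq runs_Store)
  let ?body = "Store ''atab'' (Ix (V ''j'') (Bin Add (V ''i'') (Const 1))) prefix_expr"
  let ?M2 = "M(''atab'' := (M ''atab'')(ev M (Ix (V ''j'') (Const 0)) := ev M (Const 0)))"
  let ?I = "\<lambda>k M'. (\<forall>i\<le>k. M' ''atab'' (idx b j i) = path_load T i j) \<and>
    (\<forall>j' i. j' \<noteq> j \<longrightarrow> i < b \<longrightarrow> M' ''atab'' (idx b j' i) = M ''atab'' (idx b j' i))"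
  show "runs w s Z (For ''i'' (V ''l'') ?body) ?M2 (?I l)"
  proof (rule runs_For[where N = l and I = ?I])
    fix i M3
    assume i: "i < l" and I3: "?I i M3" and M3i: "M3 ''i'' 0 = i" and "frame (insert ''i'' (writes ?body)) ?M2 M3"
    then have fr3: "frame {''i'', ''atab''} ?M2 M3"
      by simp
    have M3: "M3 ''T'' 0 = T" "M3 ''b'' 0 = b" "M3 ''j'' 0 = j" "M3 ''cum'' = M ''cum''" "M3 ''stab'' = M ''stab''"
      using frameD[OF fr3] M inpD[OF M(1)] by simp_all
    define f where "f = (pred T ^^ i) j"
    have f: "f < l"
      unfolding f_def using pred_props(1) j by (intro funpow_closed) auto
    have tabs: "M ''stab'' (idx b j i) = f" "M ''cum'' (idx b T f) = C T f" "M ''cum'' (idx b (Suc T) f) = C (Suc T) f"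
      using M(4,5) i f l_le_W by (auto simp: f_def simp del: C.simps)
    have small: "C (Suc T) f < w" "C T f < w" "C (Suc T) f - C T f < w"
      using C_less_w[of "Suc T" f] C_less_w[of T f] f l_le_W by (auto simp del: C.simps)
    have Suc: "path_load T (Suc i) j = path_load T i j + (C (Suc T) f - C T f)"
      by (simp add: path_load_def f_def L_def)
    have "path_load T (Suc i) j < w"
      using path_load_le[OF assms(1) j, of "Suc i"] C_less_w[of "T + Suc i" j] i j l_le_W by linarith
    then have pl: "path_load T i j < w" "path_load T i j + (C (Suc T) f - C T f) < w"
      unfolding Suc by simp_all
    have tab: "M3 ''atab'' (idx b j i) = path_load T i j"
      using I3 by blast
    have "ok w s M3 prefix_expr \<and> ev M3 prefix_expr = path_load T (Suc i) j"
      unfolding Suc using M3 M3i tabs tab small pl f i j by (simp add: prefix_expr_def del: C.simps)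
    then show "runs w s Z ?body M3 (\<lambda>M''. ?I (Suc i) (setv ''i'' (Suc i) M''))"
      by (intro runs_Store) (use M3 M3i I3 i j in \<open>simp_all add: le_Suc_eq\<close>)
  next
    show "?I 0 (setv ''i'' 0 ?M2)"
      using inpD[OF M(1)] M(3) by (simp add: path_load_def)
  qed (use inpD[OF M(1)] l_le_Z in auto)
qed (use M inpD[OF M(1)] j in simp_all)

lemma runs_atab:
  assumes "settled T" and M: "inp M" "M ''T'' 0 = T" "\<forall>t\<le>T + W. \<forall>j<l. M ''cum'' (idx b t j) = C t j"
    "\<forall>j<l. \<forall>i\<le>l. M ''stab'' (idx b j i) = (pred T ^^ i) j"
  shows "runs w s Z atab_prog M (\<lambda>M'. \<forall>j<l. \<forall>i\<le>l. M' ''atab'' (idx b j i) = path_load T i j)"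
  unfolding atab_prog_def
proof (rule runs_For[where N = l and I = "\<lambda>k M'. \<forall>j<k. \<forall>i\<le>l. M' ''atab'' (idx b j i) = path_load T i j"])
  fix j M1
  assume j: "j < l" and I: "\<forall>j'<j. \<forall>i\<le>l. M1 ''atab'' (idx b j' i) = path_load T i j'" and M1j: "M1 ''j'' 0 = j"
    and "frame (insert ''j'' (writes atab_row)) M M1"
  then have fr: "frame {''j'', ''i'', ''atab''} M M1"
    by simp
  have M1: "inp M1" "M1 ''T'' 0 = T" "M1 ''cum'' = M ''cum''" "M1 ''stab'' = M ''stab''"
    using inp_frame[OF M(1) fr, unfolded input_names_def] frameD[OF fr] M by simp_all
  show "runs w s Z atab_row M1 (\<lambda>M''. \<forall>j'<Suc j. \<forall>i\<le>l. setv ''j'' (Suc j) M'' ''atab'' (idx b j' i) = path_load T i j')"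
  proof (rule runs_conseq[OF runs_atab_row[where j = j]])
    fix M2
    assume M2: "(\<forall>i\<le>l. M2 ''atab'' (idx b j i) = path_load T i j) \<and>
      (\<forall>j' i. j' \<noteq> j \<longrightarrow> i < b \<longrightarrow> M2 ''atab'' (idx b j' i) = M1 ''atab'' (idx b j' i))"
    show "\<forall>j'<Suc j. \<forall>i\<le>l. setv ''j'' (Suc j) M2 ''atab'' (idx b j' i) = path_load T i j'"
    proof (intro allI impI)
      fix j' i
      assume "j' < Suc j" "i \<le> l"
      then show "setv ''j'' (Suc j) M2 ''atab'' (idx b j' i) = path_load T i j'"
        using M2 I by (cases "j' = j") simp_all
    qed
  qed (use assms(1) M1 M1j M(3,4) j in simp_all)
qed (use M inpD[OF M(1)] l_le_Z in auto)

end

section \<open>Queries\<close>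

text \<open>\<open>cum_prog\<close> leaves in \<open>u\<close> the departures up to the last
  simulated time. \<open>tokens_left\<close> is therefore run again, for row T, before
  \<open>pred_prog\<close> reads the offsets.\<close>

definition tables_prog :: com where
  "tables_prog = Seq (orbit_prog ''next'' ''ntab'' ''nper'') (Seq pos_prog (Seq cum_prog (Seq score_prog
    (Seq rank_prog (Seq (tokens_left ''T'') (Seq pred_prog (Seq (orbit_prog ''pred'' ''stab'' ''sper'') atab_prog)))))))"

text \<open>By truncated subtraction, \<open>e\<close> becomes the minimum of \<tau> and T. One
  formula thus serves all times: before the horizon \<open>d\<close> is 0 and the periodic part of
  \<open>count_expr\<close> vanishes.\<close>

definition query_head :: com where
  "query_head = Seq (Store ''d'' (Const 0) (Bin Sub (V ''tau'') (V ''T'')))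
    (Store ''e'' (Const 0) (Bin Sub (V ''tau'') (V ''d'')))"

definition count_expr :: "expr \<Rightarrow> expr" where
  "count_expr j = Bin Add (Cell ''cum'' (Ix (V ''e'') j))
    (Bin Add (Bin Mul (Bin Div (V ''d'') (Cell ''sper'' j)) (Cell ''atab'' (Ix j (Cell ''sper'' j))))
      (Cell ''atab'' (Ix j (Bin Mod (V ''d'') (Cell ''sper'' j)))))"

definition count_prog :: com where
  "count_prog = Seq query_head (Store ''count'' (Const 0) (count_expr (V ''arc'')))"

definition sum_prog :: "string \<Rightarrow> string \<Rightarrow> com" where
  "sum_prog u h = For ''j'' (V ''l'') (Store u (Cell h (V ''j'')) (Bin Add (Cell u (Cell h (V ''j''))) (count_expr (V ''j''))))"

definition clear_out :: com where
  "clear_out = For ''v'' (V ''n'') (Store ''uo'' (V ''v'') (Const 0))"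

definition copy_in :: com where
  "copy_in = For ''v'' (V ''n'') (Store ''ui'' (V ''v'') (Cell ''tokens'' (V ''v'')))"

definition write_tokens :: com where
  "write_tokens = For ''v'' (V ''n'') (Store ''out_tokens'' (V ''v'') (Bin Sub (Cell ''ui'' (V ''v'')) (Cell ''uo'' (V ''v''))))"

definition pointer_expr :: expr where
  "pointer_expr = Cell ''ntab'' (Ix (Cell ''pointer'' (V ''v''))
    (Bin Mod (Cell ''uo'' (V ''v'')) (Cell ''nper'' (Cell ''pointer'' (V ''v'')))))"

definition write_pointers :: com where
  "write_pointers = For ''v'' (V ''n'') (Store ''out_pointer'' (V ''v'') pointer_expr)"

text \<open>Cumulative loads summed by tails give the departures \<open>U \<tau>\<close>; summed by
  heads and added to the initial tokens they give \<open>U (Suc \<tau>)\<close>. Their difference is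
  the number of tokens, and the departures modulo the degree give the pointer.\<close>

definition state_prog :: com where
  "state_prog = Seq query_head (Seq clear_out (Seq copy_in (Seq (sum_prog ''uo'' ''tail'')
    (Seq (sum_prog ''ui'' ''head'') (Seq write_tokens write_pointers)))))"

lemma writes_state_parts [simp]: "writes clear_out = {''v'', ''uo''}" "writes copy_in = {''v'', ''ui''}"
  "writes write_tokens = {''v'', ''out_tokens''}" "writes write_pointers = {''v'', ''out_pointer''}"
  by (simp_all add: clear_out_def copy_in_def write_tokens_def write_pointers_def)

lemma writes_query [simp]: "writes query_head = {''d'', ''e''}" "writes (sum_prog u h) = {''j'', u}"
  "writes count_prog = {''d'', ''e'', ''count''}"
  "writes state_prog = {''d'', ''e'', ''j'', ''v'', ''uo'', ''ui'', ''out_tokens'', ''out_pointer''}"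
  by (auto simp: query_head_def sum_prog_def count_prog_def state_prog_def)

lemma nesting_query [simp]: "nesting count_prog = 0" "nesting state_prog = 1"
  by (simp_all add: query_head_def sum_prog_def count_prog_def state_prog_def clear_out_def copy_in_def
      write_tokens_def write_pointers_def)

context rotor_program begin

definition tables :: "memory \<Rightarrow> bool" where
  "tables M \<longleftrightarrow> inp M \<and> M ''T'' 0 = T \<and>
    (\<forall>j<l. \<forall>i\<le>l. M ''ntab'' (idx b j i) = (nx ^^ i) j) \<and> (\<forall>j<l. M ''nper'' j = deg (src j)) \<and>
    (\<forall>t\<le>T. \<forall>j<l. M ''cum'' (idx b t j) = C t j) \<and> (\<forall>j<l. M ''sper'' j = period (pred T) j) \<and>
    (\<forall>j<l. \<forall>i\<le>l. M ''atab'' (idx b j i) = path_load T i j)"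

definition table_names :: "string set" where
  "table_names = input_names \<union> {''T'', ''ntab'', ''nper'', ''cum'', ''sper'', ''atab''}"

text \<open>Queries write outside \<open>table_names\<close>, so the tables survive any sequence of
  them.\<close>

lemma tables_frame:
  assumes "tables M" "frame X M M'" "X \<inter> table_names = {}"
  shows "tables M'"
proof -
  have "input_names \<subseteq> table_names"
    unfolding table_names_def by (rule Un_upper1)
  then have "X \<inter> input_names = {}"
    using assms(3) by blast
  moreover have "inp M"
    using assms(1) by (simp add: tables_def)
  ultimately have "inp M'"
    using inp_frame assms(2) by blast
  moreover have "M' y = M y" if "y \<in> table_names" for y
    by (rule frameD[OF assms(2)]) (use assms(3) that in blast)
  ultimately show ?thesis
    using assms(1) by (simp add: tables_def table_names_def)
qed

lemma nx_orbit: "j < l \<Longrightarrow> \<exists>p. 0 < p \<and> p \<le> l \<and> (nx ^^ p) j = j"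
  using nx_period(1)[of j] deg_pos[of j] deg_le[of "src j"] by blast

lemma pred_orbit: "j < l \<Longrightarrow> \<exists>p. 0 < p \<and> p \<le> l \<and> (pred T ^^ p) j = j"
  using orbit_period[OF _ pred_inj] pred_props(1) by blast

lemma runs_tables:
  assumes settled: "settled T" and M: "inp M" "M ''T'' 0 = T" "M ''W'' 0 = W" "M ''R'' 0 = T + W" and Z: "T + W + 1 \<le> Z"
  shows "runs w s Z tables_prog M tables"
proof -
  let ?p1 = "Seq (orbit_prog ''pred'' ''stab'' ''sper'') atab_prog"
  let ?p2 = "Seq pred_prog ?p1"
  let ?p3 = "Seq (tokens_left ''T'') ?p2"
  let ?p4 = "Seq rank_prog ?p3"
  let ?p5 = "Seq score_prog ?p4"
  let ?p6 = "Seq cum_prog ?p5"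
  have "runs w s Z (orbit_prog ''next'' ''ntab'' ''nper'') M (\<lambda>M'.
    (\<forall>j<l. \<forall>i\<le>l. M' ''ntab'' (idx b j i) = (nx ^^ i) j) \<and> (\<forall>j<l. M' ''nper'' j = period nx j))"
    by (rule runs_orbit) (use inpD[OF M(1)] nx_less nx_orbit in simp_all)
  then show ?thesis
    unfolding tables_prog_def
  proof (rule runs_SeqI)
    fix M1
    assume 1: "(\<forall>j<l. \<forall>i\<le>l. M1 ''ntab'' (idx b j i) = (nx ^^ i) j) \<and> (\<forall>j<l. M1 ''nper'' j = period nx j)"
      and "frame (writes (orbit_prog ''next'' ''ntab'' ''nper'')) M M1"
    then have fr1: "frame {''j'', ''i'', ''ntab'', ''nper''} M M1" and nper: "\<forall>j<l. M1 ''nper'' j = deg (src j)"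
      by (simp_all add: nx_period)
    note inp1 = inp_frame[OF M(1) fr1, unfolded input_names_def, simplified]
    from runs_pos[OF inp1 1[THEN conjunct1] nper]
    show "runs w s Z (Seq pos_prog ?p6) M1 tables"
    proof (rule runs_SeqI)
      fix M2
      assume 2: "\<forall>j<l. M2 ''pos'' j = pos j" and "frame (writes pos_prog) M1 M2"
      then have fr2: "frame {''v'', ''i'', ''pos''} M1 M2"
        by simp
      have inp2: "inp M2" "M2 ''R'' 0 = T + W" "\<forall>j<l. M2 ''nper'' j = deg (src j)"
        using inp_frame[OF inp1 fr2, unfolded input_names_def] frameD[OF fr1] frameD[OF fr2] M nper by simp_all
      have "T + W \<le> Z"
        using Z by simp
      from runs_cum[OF inp2(1,2,3) 2 this]
      show "runs w s Z ?p6 M2 tables"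
      proof (rule runs_SeqI)
        fix M3
        assume 3: "\<forall>t\<le>T + W. \<forall>j<l. M3 ''cum'' (idx b t j) = C t j" and "frame (writes cum_prog) M2 M3"
        then have fr3: "frame {''u'', ''v'', ''j'', ''t'', ''cum''} M2 M3"
          by simp
        have inp3: "inp M3" "M3 ''T'' 0 = T" "M3 ''W'' 0 = W"
          using inp_frame[OF inp2(1) fr3, unfolded input_names_def] frameD[OF fr1] frameD[OF fr2] frameD[OF fr3] M by simp_all
        have "Suc W \<le> Z"
          using Z by simp
        from runs_score[OF inp3 3 this]
        show "runs w s Z ?p5 M3 tables"
        proof (rule runs_SeqI)
          fix M4
          assume 4: "\<forall>j<l. M4 ''sc'' j = score T j" and "frame (writes score_prog) M3 M4"
          then have fr4: "frame {''j'', ''t'', ''sc''} M3 M4"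
            by simp
          note inp4 = inp_frame[OF inp3(1) fr4, unfolded input_names_def, simplified]
          from runs_rank[OF inp4 4]
          show "runs w s Z ?p4 M4 tables"
          proof (rule runs_SeqI)
            fix M5
            assume 5: "\<forall>j<l. M5 ''rk'' j = rank T j" and "frame (writes rank_prog) M4 M5"
            then have fr5: "frame {''j'', ''i'', ''rk''} M4 M5"
              by simp
            have inp5: "inp M5" "M5 ''T'' 0 = T" "M5 ''cum'' = M3 ''cum''" "M5 ''nper'' = M1 ''nper''"
              "M5 ''pos'' = M2 ''pos''" "M5 ''ntab'' = M1 ''ntab''"
              using inp_frame[OF inp4 fr5, unfolded input_names_def] inp3(2) frameD[OF fr2] frameD[OF fr3] frameD[OF fr4] frameD[OF fr5]
              by simp_all
            have cum: "\<forall>j<l. M5 ''cum'' (idx b T j) = C T j"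
              using 3 inp5(3) by simp
            from runs_tokens_left[OF _ inp5(1,2) cum]
            have "runs w s Z (tokens_left ''T'') M5 (\<lambda>M'. \<forall>v<n. M' ''u'' v = U (Suc T) v)"
              by simp
            then show "runs w s Z ?p3 M5 tables"
            proof (rule runs_SeqI)
              fix M6
              assume 6: "\<forall>v<n. M6 ''u'' v = U (Suc T) v" and "frame (writes (tokens_left ''T'')) M5 M6"
              then have fr6: "frame {''u'', ''v'', ''j''} M5 M6"
                by simp
              have inp6: "inp M6" "\<forall>j<l. M6 ''rk'' j = rank T j" "\<forall>j<l. M6 ''nper'' j = deg (src j)" "\<forall>j<l. M6 ''pos'' j = pos j"
                using inp_frame[OF inp5(1) fr6, unfolded input_names_def] frameD[OF fr6] inp5 5 nper 2 by simp_all
              from runs_pred[OF inp6(1,2) 6 inp6(3,4)]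
              show "runs w s Z ?p2 M6 tables"
              proof (rule runs_SeqI)
                fix M7
                assume 7: "\<forall>j<l. M7 ''pred'' j = pred T j" and "frame (writes pred_prog) M6 M7"
                then have fr7: "frame {''j'', ''i'', ''pred''} M6 M7"
                  by simp
                note inp7 = inp_frame[OF inp6(1) fr7, unfolded input_names_def, simplified]
                have "runs w s Z (orbit_prog ''pred'' ''stab'' ''sper'') M7 (\<lambda>M'.
                  (\<forall>j<l. \<forall>i\<le>l. M' ''stab'' (idx b j i) = (pred T ^^ i) j) \<and> (\<forall>j<l. M' ''sper'' j = period (pred T) j))"
                  by (rule runs_orbit) (use inpD[OF inp7] 7 pred_props(1) pred_orbit in simp_all)
                then show "runs w s Z ?p1 M7 tables"
                proof (rule runs_SeqI)
                  fix M8
                  assume 8: "(\<forall>j<l. \<forall>i\<le>l. M8 ''stab'' (idx b j i) = (pred T ^^ i) j) \<and> (\<forall>j<l. M8 ''sper'' j = period (pred T) j)"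
                    and "frame (writes (orbit_prog ''pred'' ''stab'' ''sper'')) M7 M8"
                  then have fr8: "frame {''j'', ''i'', ''stab'', ''sper''} M7 M8"
                    by simp
                  have inp8: "inp M8" "M8 ''T'' 0 = T" "M8 ''cum'' = M3 ''cum''" "M8 ''nper'' = M1 ''nper''" "M8 ''ntab'' = M1 ''ntab''"
                    using inp_frame[OF inp7 fr8, unfolded input_names_def] inp5 frameD[OF fr6] frameD[OF fr7] frameD[OF fr8]
                    by simp_all
                  have cum8: "\<forall>t\<le>T + W. \<forall>j<l. M8 ''cum'' (idx b t j) = C t j"
                    using 3 inp8(3) by simp
                  from runs_atab[OF settled inp8(1,2) cum8 8[THEN conjunct1]]
                  show "runs w s Z atab_prog M8 tables"
                  proof (rule runs_conseq)
                    fix M9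
                    assume 9: "\<forall>j<l. \<forall>i\<le>l. M9 ''atab'' (idx b j i) = path_load T i j" and "frame (writes atab_prog) M8 M9"
                    then have fr9: "frame {''j'', ''i'', ''atab''} M8 M9"
                      by simp
                    have "inp M9" "M9 ''T'' 0 = T" "M9 ''cum'' = M3 ''cum''" "M9 ''nper'' = M1 ''nper''" "M9 ''ntab'' = M1 ''ntab''"
                      "M9 ''sper'' = M8 ''sper''"
                      using inp_frame[OF inp8(1) fr9, unfolded input_names_def] inp8 frameD[OF fr9] by simp_all
                    then show "tables M9"
                      using 1 nper 3 8 9 by (simp add: tables_def)
                  qed
                qed
              qed
            qed
          qed
        qed
      qed
    qed
  qed
qed

lemma path_load_mult:
  assumes "(pred T ^^ p) j = j"
  shows "path_load T (q * p + r) j = q * path_load T p j + path_load T r j"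
proof (induction q)
  case (Suc q)
  have "Suc q * p + r = p + (q * p + r)"
    by simp
  then show ?case
    using path_load_add[OF assms, of "q * p + r"] Suc by (simp add: add.assoc)
qed simp

lemma period_pred: "j < l \<Longrightarrow> 0 < period (pred T) j \<and> period (pred T) j \<le> l \<and> (pred T ^^ period (pred T) j) j = j"
  using pred_orbit[of j] period_props[of _ "pred T" j] by (meson order_trans)

lemma C_extrapolate:
  fixes \<tau> :: nat
  assumes "settled T" "j < l"
  defines "p \<equiv> period (pred T) j"
  shows "C \<tau> j = C (\<tau> - (\<tau> - T)) j + ((\<tau> - T) div p * path_load T p j + path_load T ((\<tau> - T) mod p) j)"
proof -
  have p: "0 < p" "(pred T ^^ p) j = j"
    using period_pred[OF assms(2)] by (auto simp: p_def)
  have "path_load T (\<tau> - T) j = (\<tau> - T) div p * path_load T p j + path_load T ((\<tau> - T) mod p) j"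
    using path_load_mult[OF p(2), of "(\<tau> - T) div p" "(\<tau> - T) mod p"] by simp
  moreover have "C \<tau> j = C (\<tau> - (\<tau> - T)) j + path_load T (\<tau> - T) j"
  proof (cases "T \<le> \<tau>")
    case True
    then show ?thesis
      using C_after_settled[OF assms(1,2), of "\<tau> - T"] by simp
  next
    case False
    then show ?thesis
      by (simp add: path_load_def)
  qed
  ultimately show ?thesis
    by simp
qed

context
  fixes \<tau> :: nat
  assumes settled: "settled T" and \<tau>_less: "(\<tau> + 1) * (K + 1) \<le> w"
begin

definition query_ready :: "memory \<Rightarrow> bool" where
  "query_ready M \<longleftrightarrow> tables M \<and> M ''d'' 0 = \<tau> - T \<and> M ''e'' 0 = \<tau> - (\<tau> - T)"

lemma \<tau>_w: "\<tau> < w" "e < l \<Longrightarrow> C \<tau> e < w" "v < n \<Longrightarrow> U \<tau> v < w" "v < n \<Longrightarrow> U (Suc \<tau>) v < w"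
proof -
  have *: "(\<tau> + 1) * K < w" "\<tau> * K < w" "\<tau> < w"
    using \<tau>_less by auto
  show "\<tau> < w"
    by fact
  show "C \<tau> e < w" if "e < l"
    using C_le[OF that, of \<tau>] * by (simp add: K)
  show "U \<tau> v < w" "U (Suc \<tau>) v < w" if "v < n"
    using U_le[OF that, of \<tau>] U_le[OF that, of "Suc \<tau>"] * by (simp_all add: K del: U.simps)
qed

lemma runs_query_head:
  assumes "tables M" "M ''tau'' 0 = \<tau>"
  shows "runs w s Z query_head M query_ready"
proof -
  have T: "M ''T'' 0 = T" "\<tau> - T < w" "\<tau> - (\<tau> - T) < w"
    using assms(1) \<tau>_w(1) by (auto simp: tables_def)
  let ?M' = "setv ''e'' (\<tau> - (\<tau> - T)) (setv ''d'' (\<tau> - T) M)"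
  have "tables ?M'"
    by (rule tables_frame[OF assms(1), of "{''d'', ''e''}"]) (simp_all add: frame_def table_names_def input_names_def)
  then show ?thesis
    unfolding query_head_def
    by (intro runs_Seq runs_Store) (use assms(2) T \<tau>_w(1) in \<open>simp_all add: query_ready_def\<close>)
qed

lemma count_expr_eval:
  assumes "query_ready M" "ok w s M je" "ev M je = j" "j < l"
  shows "ok w s M (count_expr je) \<and> ev M (count_expr je) = C \<tau> j"
proof -
  define p where "p = period (pred T) j"
  define d where "d = \<tau> - T"
  define e where "e = \<tau> - d"
  define r where "r = d mod p"
  have p: "0 < p" "p \<le> l"
    using period_pred[OF assms(4)] by (simp_all add: p_def)
  have r: "r < p"
    unfolding r_def using p(1) by simp
  then have p: "p \<le> l" "r < p" "r \<le> l"
    using p(2) by simp_all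
  have d: "d < w" "e \<le> T"
    using \<tau>_w(1) by (auto simp: d_def e_def)
  then have "d div p < w"
    by (intro le_less_trans[OF div_le_dividend])
  note d = d this
  have C: "C \<tau> j = C e j + (d div p * path_load T p j + path_load T r j)"
    using C_extrapolate[OF settled assms(4), of \<tau>] by (simp only: p_def d_def e_def r_def)
  have Cw: "C \<tau> j < w"
    using \<tau>_w(2) assms(4) .
  have M: "M ''d'' 0 = d" "M ''e'' 0 = e" "M ''b'' 0 = b" "M ''cum'' (idx b e j) = C e j" "M ''sper'' j = p"
    "M ''atab'' (idx b j p) = path_load T p j" "M ''atab'' (idx b j r) = path_load T r j"
    using assms(1,4) p d inpD(3)[of M] by (auto simp: query_ready_def tables_def p_def d_def e_def)
  \<comment> \<open>The result bounds the product with this entry only if \<open>d div p\<close> is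
    positive, so the entry needs a bound of its own.\<close>
  have pl: "path_load T p j < w"
  proof -
    have "path_load T p j \<le> C (T + p) j"
      by (rule path_load_le[OF settled assms(4)])
    also have "\<dots> < w"
      using C_less_w[of "T + p" j] p(1) l_le_W(1) assms(4) by simp
    finally show ?thesis .
  qed
  have e: "e < G" "e < w"
    using less_T[of e] d(2) by auto
  show ?thesis
    using assms(2,3,4) M p d pl e Cw r_def unfolding C count_expr_def by (simp del: C.simps)
qed

lemma runs_count_prog:
  assumes "tables M" "M ''tau'' 0 = \<tau>" "M ''arc'' 0 = j" "j < l"
  shows "runs w s Z count_prog M (\<lambda>M'. M' ''count'' 0 = C \<tau> j)"
  unfolding count_prog_def
proof (rule runs_SeqI[OF runs_query_head[OF assms(1,2)]])
  fix M1
  assume 1: "query_ready M1" and "frame (writes query_head) M M1"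
  then have "M1 ''arc'' 0 = j"
    using assms(3) by (simp add: frame_def)
  moreover from this have "ok w s M1 (count_expr (V ''arc'')) \<and> ev M1 (count_expr (V ''arc'')) = C \<tau> j"
    using 1 assms(4) by (intro count_expr_eval) auto
  ultimately show "runs w s Z (Store ''count'' (Const 0) (count_expr (V ''arc''))) M1 (\<lambda>M'. M' ''count'' 0 = C \<tau> j)"
    by (intro runs_Store) simp_all
qed

lemma query_ready_frame:
  assumes "query_ready M" "frame X M M'" "X \<inter> table_names = {}" "''d'' \<notin> X" "''e'' \<notin> X"
  shows "query_ready M'"
  using assms tables_frame[OF _ assms(2,3)] frameD[OF assms(2)] by (simp add: query_ready_def)

lemma runs_sum_prog:
  assumes names: "u \<notin> insert ''j'' (insert ''d'' (insert ''e'' table_names))" "h \<in> table_names" "h \<noteq> ''j''"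
    and M: "query_ready M" "\<And>j. j < l \<Longrightarrow> M h j = H j" and H: "\<And>j. j < l \<Longrightarrow> H j < n"
    and bound: "\<And>v. v < n \<Longrightarrow> M u v + (\<Sum>j\<in>{j. j < l \<and> H j = v}. C \<tau> j) < w"
  shows "runs w s Z (sum_prog u h) M (\<lambda>M'. \<forall>v<n. M' u v = M u v + (\<Sum>j\<in>{j. j < l \<and> H j = v}. C \<tau> j))"
  unfolding sum_prog_def
proof (rule runs_accumulate)
  show "ok w s M' (count_expr (V ''j'')) \<and> ev M' (count_expr (V ''j'')) = C \<tau> j"
    if "j < l" "frame {''j'', u} M M'" "M' ''j'' 0 = j" for j M'
  proof (rule count_expr_eval)
    show "query_ready M'"
      by (rule query_ready_frame[OF M(1) that(2)]) (use names in \<open>auto simp: table_names_def input_names_def\<close>)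
  qed (use that in simp_all)
  show "u \<noteq> h" "u \<noteq> ''l''"
    using names by (auto simp: table_names_def input_names_def)
  show "M ''l'' 0 = l"
    using M(1) by (simp add: query_ready_def tables_def inp_def)
qed (use names M H bound in auto)

lemma runs_write_tokens:
  assumes M: "query_ready M" "\<forall>v<n. M ''ui'' v = U (Suc \<tau>) v" "\<forall>v<n. M ''uo'' v = U \<tau> v"
  shows "runs w s Z write_tokens M (\<lambda>M'. \<forall>v<n. M' ''out_tokens'' v = U (Suc \<tau>) v - U \<tau> v)"
  unfolding write_tokens_def
proof (rule runs_fill[where N = n])
  fix v M1
  assume v: "v < n" and fr: "frame {''v'', ''out_tokens''} M M1" and M1v: "M1 ''v'' 0 = v"
  have "U (Suc \<tau>) v - U \<tau> v < w"
    using \<tau>_w(4)[OF v] by (rule le_less_trans[OF diff_le_self])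
  then show "ok w s M1 (Bin Sub (Cell ''ui'' (V ''v'')) (Cell ''uo'' (V ''v''))) \<and>
      ev M1 (Bin Sub (Cell ''ui'' (V ''v'')) (Cell ''uo'' (V ''v''))) = U (Suc \<tau>) v - U \<tau> v"
    using frameD[OF fr] M(2,3) v M1v \<tau>_w(3,4)[OF v] by (simp del: U.simps)
qed (use M(1) n_less in \<open>simp_all add: query_ready_def tables_def inp_def\<close>)

lemma runs_write_pointers:
  assumes M: "query_ready M" "\<forall>v<n. M ''uo'' v = U \<tau> v"
  shows "runs w s Z write_pointers M (\<lambda>M'. \<forall>v<n. M' ''out_pointer'' v = (nx ^^ (U \<tau> v mod deg v)) (ptr v))"
  unfolding write_pointers_def
proof (rule runs_fill[where N = n])
  fix v M1
  assume v: "v < n" and fr: "frame {''v'', ''out_pointer''} M M1" and M1v: "M1 ''v'' 0 = v"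
  define r where "r = U \<tau> v mod deg v"
  have "r < deg v" "r \<le> U \<tau> v"
    using deg_pos'[OF v] by (simp_all add: r_def)
  then have small: "r < w" "r \<le> l" "deg v < w" "ptr v < l"
    using \<tau>_w(3)[OF v] deg_le[of v] ptr(1)[OF v] by auto
  have "(nx ^^ r) (ptr v) < l"
    using nx_less ptr(1)[OF v] by (intro funpow_closed) auto
  moreover have "tables M1"
    using tables_frame[of M, OF _ fr] M(1) by (simp add: query_ready_def table_names_def input_names_def)
  then have "M1 ''pointer'' v = ptr v" "M1 ''nper'' (ptr v) = deg v" "M1 ''b'' 0 = b"
    "M1 ''ntab'' (idx b (ptr v) r) = (nx ^^ r) (ptr v)"
    using v small ptr(2)[OF v] by (simp_all add: tables_def inp_def)
  moreover have "M1 ''uo'' v = U \<tau> v"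
    using frameD[OF fr] M(2) v by simp
  ultimately have "ok w s M1 pointer_expr \<and> ev M1 pointer_expr = (nx ^^ r) (ptr v)"
    using M1v small v \<tau>_w(3)[OF v] by (simp add: pointer_expr_def r_def)
  then show "ok w s M1 pointer_expr \<and> ev M1 pointer_expr = (nx ^^ (U \<tau> v mod deg v)) (ptr v)"
    by (simp add: r_def)
qed (use M(1) n_less in \<open>simp_all add: query_ready_def tables_def inp_def\<close>)

lemma runs_state_prog:
  assumes "tables M" "M ''tau'' 0 = \<tau>"
  shows "runs w s Z state_prog M (\<lambda>M'. \<forall>v<n. M' ''out_tokens'' v = U (Suc \<tau>) v - U \<tau> v \<and>
    M' ''out_pointer'' v = (nx ^^ (U \<tau> v mod deg v)) (ptr v))" (is "runs w s Z state_prog M ?Q")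
proof -
  have inp: "M ''n'' 0 = n" "M ''l'' 0 = l" "\<And>j. j < l \<Longrightarrow> M ''tail'' j = src j" "\<And>j. j < l \<Longrightarrow> M ''head'' j = dst j"
    "\<And>v. v < n \<Longrightarrow> M ''tokens'' v = tok v" if "query_ready M" for M
    using that by (simp_all add: query_ready_def tables_def inp_def)
  have departed: "(\<Sum>j\<in>{j. j < l \<and> src j = v}. C \<tau> j) = U \<tau> v" if "v < n" for v
    using sum_outs_C[OF that] by (simp add: outs_def)
  have arrived: "tok v + (\<Sum>j\<in>{j. j < l \<and> dst j = v}. C \<tau> j) = U (Suc \<tau>) v" for v
    by (simp add: ins_def)
  note names = table_names_def input_names_def
  note next_ready = query_ready_frame[unfolded names]
  let ?p1 = "Seq write_tokens write_pointers"
  let ?p2 = "Seq (sum_prog ''ui'' ''head'') ?p1"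
  let ?p3 = "Seq (sum_prog ''uo'' ''tail'') ?p2"
  let ?p4 = "Seq copy_in ?p3"
  show ?thesis
    unfolding state_prog_def
  proof (rule runs_SeqI[OF runs_query_head[OF assms]])
    fix M1
    assume r1: "query_ready M1"
    have "runs w s Z clear_out M1 (\<lambda>M'. \<forall>v<n. M' ''uo'' v = 0)"
      unfolding clear_out_def by (rule runs_fill[where N = n]) (use inp[OF r1] n_less in auto)
    then show "runs w s Z (Seq clear_out ?p4) M1 ?Q"
    proof (rule runs_SeqI)
      fix M2
      assume 2: "\<forall>v<n. M2 ''uo'' v = 0" and fr2: "frame (writes clear_out) M1 M2"
      have r2: "query_ready M2"
        by (rule next_ready[OF r1 fr2]) simp_all
      have "runs w s Z copy_in M2 (\<lambda>M'. \<forall>v<n. M' ''ui'' v = tok v)"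
        unfolding copy_in_def
        by (rule runs_fill[where N = n]) (use inp[OF r2] n_less in \<open>auto simp: frame_def\<close>)
      then show "runs w s Z ?p4 M2 ?Q"
      proof (rule runs_SeqI)
        fix M3
        assume 3: "\<forall>v<n. M3 ''ui'' v = tok v" and fr3: "frame (writes copy_in) M2 M3"
        have r3: "query_ready M3"
          by (rule next_ready[OF r2 fr3]) simp_all
        have uo3: "\<forall>v<n. M3 ''uo'' v = 0"
          using 2 frameD[OF fr3] by simp
        have "runs w s Z (sum_prog ''uo'' ''tail'') M3
            (\<lambda>M'. \<forall>v<n. M' ''uo'' v = M3 ''uo'' v + (\<Sum>j\<in>{j. j < l \<and> src j = v}. C \<tau> j))"
          by (rule runs_sum_prog) (use r3 inp(3)[OF r3] src_less uo3 departed \<tau>_w(3) in \<open>simp_all add: names\<close>)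
        then show "runs w s Z ?p3 M3 ?Q"
        proof (rule runs_SeqI)
          fix M4
          assume 4: "\<forall>v<n. M4 ''uo'' v = M3 ''uo'' v + (\<Sum>j\<in>{j. j < l \<and> src j = v}. C \<tau> j)"
            and fr4: "frame (writes (sum_prog ''uo'' ''tail'')) M3 M4"
          have uo4: "\<forall>v<n. M4 ''uo'' v = U \<tau> v"
            using 4 uo3 departed by simp
          have r4: "query_ready M4"
            by (rule next_ready[OF r3 fr4]) simp_all
          have ui4: "\<forall>v<n. M4 ''ui'' v = tok v"
            using 3 frameD[OF fr4] by simp
          have "runs w s Z (sum_prog ''ui'' ''head'') M4
              (\<lambda>M'. \<forall>v<n. M' ''ui'' v = M4 ''ui'' v + (\<Sum>j\<in>{j. j < l \<and> dst j = v}. C \<tau> j))"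
            by (rule runs_sum_prog)
              (use r4 inp(4)[OF r4] dst_less ui4 arrived \<tau>_w(4) in \<open>simp_all add: names del: U.simps\<close>)
          then show "runs w s Z ?p2 M4 ?Q"
          proof (rule runs_SeqI)
            fix M5
            assume 5: "\<forall>v<n. M5 ''ui'' v = M4 ''ui'' v + (\<Sum>j\<in>{j. j < l \<and> dst j = v}. C \<tau> j)"
              and fr5: "frame (writes (sum_prog ''ui'' ''head'')) M4 M5"
            have ui5: "\<forall>v<n. M5 ''ui'' v = U (Suc \<tau>) v"
              using 5 ui4 arrived by (simp del: U.simps)
            have r5: "query_ready M5"
              by (rule next_ready[OF r4 fr5]) simp_all
            have uo5: "\<forall>v<n. M5 ''uo'' v = U \<tau> v"
              using uo4 frameD[OF fr5] by simp
            show "runs w s Z ?p1 M5 ?Q"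
            proof (rule runs_SeqI[OF runs_write_tokens[OF r5 ui5 uo5]])
              fix M6
              assume 6: "\<forall>v<n. M6 ''out_tokens'' v = U (Suc \<tau>) v - U \<tau> v" and fr6: "frame (writes write_tokens) M5 M6"
              have r6: "query_ready M6"
                by (rule next_ready[OF r5 fr6]) simp_all
              have "\<forall>v<n. M6 ''uo'' v = U \<tau> v"
                using uo5 frameD[OF fr6] by simp
              from runs_write_pointers[OF r6 this] show "runs w s Z write_pointers M6 ?Q"
                by (rule runs_conseq) (use 6 in \<open>simp add: frame_def del: U.simps\<close>)
            qed
          qed
        qed
      qed
    qed
  qed
qed

end

end

section \<open>Number of tokens, its logarithm and the horizon\<close>

fun pow_expr :: "expr \<Rightarrow> nat \<Rightarrow> expr" where
  "pow_expr e 0 = Const 1"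
| "pow_expr e (Suc k) = Bin Mul e (pow_expr e k)"

lemma ev_pow_expr [simp]: "ev M (pow_expr e k) = ev M e ^ k"
  by (induction k) auto

lemma ok_pow_expr: "ok w s M e \<Longrightarrow> (\<And>i. i \<le> k \<Longrightarrow> ev M e ^ i < w) \<Longrightarrow> ok w s M (pow_expr e k)"
proof (induction k)
  case 0
  from 0(2)[of 0] show ?case
    by simp
next
  case (Suc k)
  from Suc.prems(2)[of "Suc k"] Suc show ?case
    by simp
qed

definition count_tokens :: com where
  "count_tokens = Seq (Store ''K'' (Const 0) (Const 0))
    (For ''v'' (V ''n'') (Store ''K'' (Const 0) (Bin Add (V ''K'') (Cell ''tokens'' (V ''v'')))))"

text \<open>\<open>h\<close> ends as g + 1 for the least g with \<open>K < 2 ^ g\<close>, the factor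
  required by \<open>settled_horizon\<close>.\<close>

definition double_prog :: com where
  "double_prog = Seq (Store ''h'' (Const 0) (Const 1)) (Seq (Store ''x'' (Const 0) (Const 1))
    (While (Bin Less (V ''x'') (Bin Add (V ''K'') (Const 1)))
      (Seq (Store ''x'' (Const 0) (Bin Mul (V ''x'') (Const 2))) (Store ''h'' (Const 0) (Bin Add (V ''h'') (Const 1))))))"

definition horizon_prog :: com where
  "horizon_prog = Seq (Store ''W'' (Const 0) (Bin Mul (Const 2) (Bin Mul (V ''l'') (V ''l''))))
    (Seq (Store ''T'' (Const 0) (Bin Mul (V ''h'') (pow_expr (V ''l'') 20)))
    (Store ''R'' (Const 0) (Bin Add (V ''T'') (V ''W''))))"

definition preprocess_prog :: com where
  "preprocess_prog = Seq (Store ''l'' (Const 0) (Bin Mul (Const 2) (V ''m'')))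
    (Seq (Store ''b'' (Const 0) (Bin Add (V ''l'') (Const 1)))
    (Seq count_tokens (Seq double_prog (Seq horizon_prog tables_prog))))"

lemma writes_init [simp]: "writes count_tokens = {''K'', ''v''}" "writes double_prog = {''h'', ''x''}"
  "writes horizon_prog = {''W'', ''T'', ''R''}"
  by (auto simp: count_tokens_def double_prog_def horizon_prog_def)

context rotor_program begin

lemma K_less: "K + 1 < w" "2 * K + 2 < w"
proof -
  have "2 * (K + 1) \<le> G * (K + 1)"
    using G_ge by (rule mult_le_mono1)
  then have "2 * (K + 1) < w"
    using GK_less by (rule le_less_trans)
  then show "2 * K + 2 < w"
    by simp
  then show "K + 1 < w"
    by linarith
qed

lemma runs_count_tokens:
  assumes M: "M ''n'' 0 = n" "\<And>v. v < n \<Longrightarrow> M ''tokens'' v = tok v"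
  shows "runs w s Z count_tokens M (\<lambda>M'. M' ''K'' 0 = K)"
  unfolding count_tokens_def
proof (intro runs_Seq runs_Store)
  let ?body = "Store ''K'' (Const 0) (Bin Add (V ''K'') (Cell ''tokens'' (V ''v'')))"
  let ?M1 = "M(''K'' := (M ''K'')(ev M (Const 0) := ev M (Const 0)))"
  have partial: "(\<Sum>u<v. tok u) < w" if "v \<le> n" for v
  proof -
    have "(\<Sum>u<v. tok u) \<le> K"
      unfolding K by (rule sum_mono2) (use that in auto)
    then show ?thesis
      using K_less by linarith
  qed
  show "runs w s Z (For ''v'' (V ''n'') ?body) ?M1 (\<lambda>M'. M' ''K'' 0 = K)"
  proof (rule runs_For[where N = n and I = "\<lambda>v M'. M' ''K'' 0 = (\<Sum>u<v. tok u)"])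
    fix v M2
    assume v: "v < n" and I: "M2 ''K'' 0 = (\<Sum>u<v. tok u)" and M2v: "M2 ''v'' 0 = v"
      and "frame (insert ''v'' (writes ?body)) ?M1 M2"
    then have "M2 ''tokens'' v = tok v"
      using M(2)[OF v] by (simp add: frame_def)
    then show "runs w s Z ?body M2 (\<lambda>M''. setv ''v'' (Suc v) M'' ''K'' 0 = (\<Sum>u<Suc v. tok u))"
      by (intro runs_Store) (use v I M2v partial[of v] partial[of "Suc v"] in simp_all)
  qed (use M n_less K in simp_all)
qed simp_all

lemma runs_double_prog:
  assumes "M ''K'' 0 = K" and g: "K < 2 ^ g" "\<forall>i<g. 2 ^ i \<le> K" "g \<le> Z" "g + 1 < w"
  shows "runs w s Z double_prog M (\<lambda>M'. M' ''h'' 0 = g + 1)"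
  unfolding double_prog_def
proof (intro runs_Seq runs_Store)
  \<comment> \<open>Minimality of g keeps the last power at most 2 K, unless it is 1.\<close>
  have two_pow: "(2::nat) ^ i < w" if "i \<le> g" for i
  proof (cases i)
    case (Suc i')
    then have "2 * 2 ^ i' \<le> 2 * K"
      using g(2) that by simp
    then show ?thesis
      using Suc K_less by simp
  qed simp
  let ?c = "Seq (Store ''x'' (Const 0) (Bin Mul (V ''x'') (Const 2))) (Store ''h'' (Const 0) (Bin Add (V ''h'') (Const 1)))"
  let ?I = "\<lambda>i (M'::memory). M' ''K'' 0 = K \<and> M' ''h'' 0 = i + 1 \<and> M' ''x'' 0 = 2 ^ i"
  let ?M1 = "M(''h'' := (M ''h'')(ev M (Const 0) := ev M (Const 1)))"
  let ?M2 = "?M1(''x'' := (?M1 ''x'')(ev ?M1 (Const 0) := ev ?M1 (Const 1)))"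
  have "runs w s Z (While (Bin Less (V ''x'') (Bin Add (V ''K'') (Const 1))) ?c) ?M2 (?I g)"
  proof (rule runs_While[where I = ?I])
    fix i M3
    assume i: "i < g" and I: "?I i M3"
    have b: "(2::nat) ^ i \<le> K" "(2::nat) ^ i < w" "2 * (2::nat) ^ i < w" "Suc (Suc i) < w" "Suc i < w"
      using g(2) two_pow[of i] two_pow[of "Suc i"] i g(4) by auto
    have "runs w s Z ?c M3 (?I (Suc i))"
      by (intro runs_Seq runs_Store) (use I b in \<open>simp_all add: mult.commute\<close>)
    then show "ok w s M3 (Bin Less (V ''x'') (Bin Add (V ''K'') (Const 1))) \<and>
        ev M3 (Bin Less (V ''x'') (Bin Add (V ''K'') (Const 1))) \<noteq> 0 \<and> runs w s Z ?c M3 (?I (Suc i))"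
      using I b K_less by simp
  next
    fix M3
    assume "?I g M3"
    then show "ok w s M3 (Bin Less (V ''x'') (Bin Add (V ''K'') (Const 1))) \<and>
        ev M3 (Bin Less (V ''x'') (Bin Add (V ''K'') (Const 1))) = 0"
      using K_less two_pow[of g] g(1) by simp
  qed (use assms(1) g(3) in simp_all)
  then show "runs w s Z (While (Bin Less (V ''x'') (Bin Add (V ''K'') (Const 1))) ?c) ?M2 (\<lambda>M'. M' ''h'' 0 = g + 1)"
    by (rule runs_conseq) simp
qed simp_all

lemma runs_horizon_prog:
  assumes M: "M ''l'' 0 = l" "M ''h'' 0 = h" and T: "T = h * l ^ 20" "0 < h"
  shows "runs w s Z horizon_prog M (\<lambda>M'. M' ''W'' 0 = W \<and> M' ''T'' 0 = T \<and> M' ''R'' 0 = T + W)"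
proof -
  have "l ^ i \<le> T" if "i \<le> 20" for i
  proof -
    have "l ^ i \<le> l ^ 20"
      using that l_ge by (intro power_increasing) auto
    also have "\<dots> \<le> h * l ^ 20"
      using T(2) by simp
    finally show ?thesis
      by (simp add: T(1))
  qed
  then have pow: "l ^ i < w" if "i \<le> 20" for i
    using that less_TW(5) by (meson le_less_trans)
  have "h * 1 \<le> h * l ^ 20"
    using l_ge by (intro mult_le_mono2) simp
  then have "h \<le> T"
    unfolding T(1) by (simp only: mult_1_right)
  then have h: "h < w"
    using less_TW(5) by (rule le_less_trans)
  have W: "2 * (l * l) = W" "l * l < w" "2 < w"
    using less_TW(9) two_less_w by (auto simp: W_def numeral_2_eq_2)
  have ok: "ok w s M' (pow_expr (V ''l'') 20)" if "M' ''l'' 0 = l" for M'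
    using that pow by (intro ok_pow_expr) simp_all
  show ?thesis
    unfolding horizon_prog_def
    by (intro runs_Seq runs_Store)
      (use M h W ok less_TW(5,9,11) T(1) in \<open>simp_all del: pow_expr.simps\<close>)
qed

lemma runs_preprocess:
  assumes settled: "settled T"
    and M: "M ''n'' 0 = n" "M ''m'' 0 = m" "\<forall>j<l. M ''tail'' j = src j" "\<forall>j<l. M ''head'' j = dst j"
      "\<forall>j<l. M ''next'' j = nx j" "\<forall>v<n. M ''pointer'' v = ptr v" "\<forall>v<n. M ''tokens'' v = tok v"
    and l: "l = 2 * m" "b = l + 1" and T: "T = (g + 1) * l ^ 20"
    and g: "K < 2 ^ g" "\<forall>i<g. 2 ^ i \<le> K" and Z: "T + W + 1 \<le> Z"
  shows "runs w s Z preprocess_prog M tables"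
  unfolding preprocess_prog_def
proof (rule runs_Seq, rule runs_Store)
  have "(g + 1) * 1 \<le> T"
    unfolding T using l_ge by (intro mult_le_mono2) simp
  then have "g + 1 \<le> T"
    by (simp only: mult_1_right)
  then have gT: "g \<le> Z" "g + 1 < w"
    using Z less_TW(5) by linarith+
  have m: "m < w" "2 < w" "2 * m < w" "2 * m = l"
    using l(1) constants_less(5) two_less_w by (auto simp: numeral_2_eq_2)
  let ?M1 = "M(''l'' := (M ''l'')(ev M (Const 0) := ev M (Bin Mul (Const 2) (V ''m''))))"
  let ?M2 = "?M1(''b'' := (?M1 ''b'')(ev ?M1 (Const 0) := ev ?M1 (Bin Add (V ''l'') (Const 1))))"
  have M2: "inp ?M2"
    unfolding inp_def using M l by simp
  have "runs w s Z (Seq count_tokens (Seq double_prog (Seq horizon_prog tables_prog))) ?M2 tables"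
  proof (rule runs_SeqI[OF runs_count_tokens])
    fix M3
    assume 3: "M3 ''K'' 0 = K" and fr3: "frame (writes count_tokens) ?M2 M3"
    have inp3: "inp M3"
      by (rule inp_frame[OF M2 fr3]) (simp add: input_names_def)
    show "runs w s Z (Seq double_prog (Seq horizon_prog tables_prog)) M3 tables"
    proof (rule runs_SeqI[OF runs_double_prog[where M = M3, OF 3 g gT]])
      fix M4
      assume 4: "M4 ''h'' 0 = g + 1" and fr4: "frame (writes double_prog) M3 M4"
      have inp4: "inp M4"
        by (rule inp_frame[OF inp3 fr4]) (simp add: input_names_def)
      show "runs w s Z (Seq horizon_prog tables_prog) M4 tables"
      proof (rule runs_SeqI[OF runs_horizon_prog[where M = M4, OF inpD(2)[OF inp4] 4 T]])
        fix M5
        assume 5: "M5 ''W'' 0 = W \<and> M5 ''T'' 0 = T \<and> M5 ''R'' 0 = T + W" and fr5: "frame (writes horizon_prog) M4 M5"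
        have "inp M5"
          by (rule inp_frame[OF inp4 fr5]) (simp add: input_names_def)
        then show "runs w s Z tables_prog M5 tables"
          using 5 Z by (intro runs_tables settled) auto
      qed simp
    qed
  qed (use inpD[OF M2] in simp_all)
  moreover have "ok w s ?M1 (Bin Add (V ''l'') (Const 1))"
    using M(2) m l(2) b_less by simp
  ultimately show "runs w s Z (Seq (Store ''b'' (Const 0) (Bin Add (V ''l'') (Const 1)))
      (Seq count_tokens (Seq double_prog (Seq horizon_prog tables_prog)))) ?M1 tables"
    by (intro runs_Seq[of _ _ _ "Store ''b'' (Const 0) (Bin Add (V ''l'') (Const 1))"] runs_Store) simp_all
  show "ok w s M (Bin Mul (Const 2) (V ''m''))"
    using M(2) m by simp
qed simp_all

end

lemma after_queries_frame:
  assumes "after_queries w qs qc l M\<^sub>0 M" "x \<notin> {''tau'', ''arc''} \<union> writes qs \<union> writes qc"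
  shows "M x = M\<^sub>0 x"
  using assms
proof (induction rule: after_queries.induct)
  case (state_query M \<tau> t M')
  then have "M' x = pose_state_query \<tau> M x"
    by (intro exec_frame) auto
  with state_query show ?case
    by (simp add: pose_state_query_def set_scalar_def)
next
  case (count_query M j \<tau> t M')
  then have "M' x = pose_count_query \<tau> j M x"
    by (intro exec_frame) auto
  with count_query show ?case
    by (simp add: pose_count_query_def set_scalar_def)
qed simp

section \<open>Instantiating the programs on a graph\<close>

context rotor_graph begin

lemma nth_funpow:
  assumes nx: "\<forall>j<length es. nx j < length es \<and> es ! nx j = nxt (es ! j)" and "j < length es"
  shows "(nx ^^ i) j < length es \<and> es ! ((nx ^^ i) j) = (nxt ^^ i) (es ! j)"
  using assms(2) nx by (induction i) auto

lemma rotor_programI: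
  assumes nx: "\<forall>j<length es. nx j < length es \<and> es ! nx j = nxt (es ! j)"
    and ptr: "\<forall>v<n. ptr v < length es \<and> es ! ptr v = pointer S\<^sub>0 v"
    and "machine w s Z (length es) b G" "n < G" "n \<le> Z" "T + W + 1 < G" "G * G * (K + 1) \<le> w"
    and K: "K = (\<Sum>v<n. tokens S\<^sub>0 v)"
  shows "rotor_program n (length es) src dst rev pos (tokens S\<^sub>0) w s Z b G nx ptr T K"
proof -
  interpret machine w s Z "length es" b G
    by fact
  note pow = nth_funpow[OF nx]
  have cyc: "(nxt ^^ deg (src j)) (es ! j) = es ! j" "inj_on (\<lambda>i. (nxt ^^ i) (es ! j)) {..<deg (src j)}"
    "(\<lambda>i. (nxt ^^ i) (es ! j)) ` {..<deg (src j)} = out_arcs E (src j)" if "j < length es" for j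
    using cycle_funpow[OF cyclic[OF src_less[OF that]] finite_out nth_out[OF that]] by (simp_all add: deg_eq)
  have per: "(nx ^^ deg (src j)) j = j" if "j < length es" for j
    using pow[OF that] cyc(1)[OF that] by (intro es_inj) (simp_all add: that)
  show ?thesis
  proof
    show "nx j < length es" if "j < length es" for j
      using nx that by simp
    show "(nx ^^ deg (src j)) j = j" if "j < length es" for j
      using per that .
    show "period nx j = deg (src j)" if "j < length es" for j
    proof (rule antisym)
      note props = period_props[OF deg_pos[OF that] per[OF that]]
      show "period nx j \<le> deg (src j)"
        by (rule props(3))
      show "deg (src j) \<le> period nx j"
      proof (rule ccontr)
        assume "\<not> deg (src j) \<le> period nx j"
        moreover have "(nxt ^^ period nx j) (es ! j) = (nxt ^^ 0) (es ! j)"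
          using pow[OF that, of "period nx j"] props(2) by simp
        ultimately have "period nx j = 0"
          by (intro inj_onD[OF cyc(2)[OF that]]) (use deg_pos[OF that] in auto)
        then show False
          using props(1) by simp
      qed
    qed
    show "ptr v < length es" if "v < n" for v
      using ptr that by simp
    show src_ptr: "src (ptr v) = v" if "v < n" for v
      using ptr pointer_out[OF that] that by (simp add: src_def out_arcs_def)
    show "src ((nx ^^ i) (ptr v)) = v \<and> pos ((nx ^^ i) (ptr v)) = i" if "v < n" "i < deg v" for v i
    proof -
      let ?j = "(nx ^^ i) (ptr v)"
      have p: "ptr v < length es" "es ! ptr v = pointer S\<^sub>0 v"
        using ptr that(1) by simp_all
      have j: "?j < length es" "es ! ?j = (nxt ^^ i) (pointer S\<^sub>0 v)"
        using pow[of "ptr v" i] p by auto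
      have "(nxt ^^ i) (es ! ptr v) \<in> out_arcs E (src (ptr v))"
        unfolding cyc(3)[OF p(1), symmetric] using that(2) src_ptr[OF that(1)] by auto
      then have src: "src ?j = v"
        using j(2) p src_ptr[OF that(1)] by (simp add: src_def out_arcs_def)
      moreover have "pos ?j = i"
        by (rule pos_eqI[OF j(1)]) (use src that(2) j(2) in \<open>simp_all add: deg_eq\<close>)
      ultimately show ?thesis
        by simp
    qed
  qed (use assms in auto)
qed

end

text \<open>The hypothesis on l is quadratic so that the 2 in l = 2 m is absorbed. The five summands
  are each at most \<beta>^41, and their number is absorbed by \<beta>^3. It is applied to n + m +
  log k for time and space and to n + m + k for words.\<close>

lemma magnitude_le:
  fixes \<beta> :: real
  assumes "2 \<le> \<beta>" "real n \<le> \<beta>" "real l \<le> \<beta> ^ 2" "real (g + 1) \<le> \<beta>"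
  shows "real ((g + 1) * l ^ 20 + 2 * (l * l) + n + l + 3) \<le> \<beta> ^ 44"
proof -
  have pow: "\<beta> ^ i \<le> \<beta> ^ 41" if "i \<le> 41" for i
    using assms(1) that by (intro power_increasing) auto
  have l20: "real (l ^ 20) \<le> (\<beta> ^ 2) ^ 20"
    using assms(3) by (simp only: of_nat_power) (intro power_mono, auto)
  have "real ((g + 1) * l ^ 20) \<le> \<beta> * (\<beta> ^ 2) ^ 20"
    unfolding of_nat_mult using assms(1,4) l20 by (intro mult_mono) auto
  also have "\<dots> = \<beta> ^ 41"
    by (simp flip: power_mult power_Suc)
  finally have 1: "real ((g + 1) * l ^ 20) \<le> \<beta> ^ 41" .
  have "real (2 * (l * l)) \<le> \<beta> * (\<beta> ^ 2 * \<beta> ^ 2)"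
    unfolding of_nat_mult using assms(1,3) by (intro mult_mono) auto
  also have "\<dots> = \<beta> ^ 5"
    by (simp flip: power_add power_Suc)
  finally have 2: "real (2 * (l * l)) \<le> \<beta> ^ 41"
    using pow[of 5] by simp
  have 3: "real n \<le> \<beta> ^ 41" "real l \<le> \<beta> ^ 41"
    using assms(2,3) pow[of 1] pow[of 2] by simp_all
  have "(2::real) ^ 2 \<le> \<beta> ^ 2"
    using assms(1) by (intro power_mono) auto
  then have 4: "3 \<le> \<beta> ^ 41"
    using pow[of 2] by simp
  have "real ((g + 1) * l ^ 20 + 2 * (l * l) + n + l + 3) \<le> 8 * \<beta> ^ 41"
    using 1 2 3 4 unfolding of_nat_add by simp
  also have "\<dots> \<le> \<beta> ^ 3 * \<beta> ^ 41"
    using power_mono[OF assms(1), of 3] assms(1) by (intro mult_right_mono) auto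
  also have "\<dots> = \<beta> ^ 44"
    by (simp flip: power_add)
  finally show ?thesis .
qed

section \<open>Complexity\<close>

text \<open>With no tokens at all, the logarithm takes its default value 0.\<close>

lemma log_of_nat_nonneg: "0 \<le> log 2 (real k)"
  by (cases "k = 0") (simp_all add: log_def)

text \<open>For the least such g, its predecessor satisfies \<open>2 ^ h \<le> k\<close>. The
  logarithmic bound enters time and space, the cruder \<open>g \<le> k\<close> the word
  size.\<close>

lemma two_power_log_bounds:
  fixes k :: nat
  obtains g where "k < 2 ^ g" "\<forall>i<g. 2 ^ i \<le> k" "real g \<le> log 2 k + 1" "g \<le> k"
proof -
  define g where "g = (LEAST g. k < 2 ^ g)"
  have 1: "k < 2 ^ g"
    unfolding g_def by (rule LeastI[of _ k]) simp
  have 2: "2 ^ i \<le> k" if "i < g" for i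
    using not_less_Least[of i "\<lambda>g. k < 2 ^ g"] that by (simp add: g_def)
  have "real g \<le> log 2 k + 1 \<and> g \<le> k"
  proof (cases g)
    case 0
    then show ?thesis
      using log_of_nat_nonneg[of k] by simp
  next
    case (Suc h)
    then have h: "2 ^ h \<le> k"
      using 2 by simp
    then have "h < k"
      using less_exp[of h] by linarith
    moreover have "real h \<le> log 2 k"
      using h by (rule le_log2_of_power)
    ultimately show ?thesis
      by (simp add: Suc)
  qed
  with 1 2 show thesis
    using that by blast
qed

text \<open>Each loop level costs a factor G, itself at most the 44th power of the input size. The
  100 leaves room for the space \<open>G * G\<close> and for words of size
  \<open>G * G * (k + 1)\<close>, at most \<open>B ^ 89\<close>.\<close>

definition cost_exponent :: nat where "cost_exponent = 44 * nesting preprocess_prog + 100"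

text \<open>The factor 2 is due to query loops being bounded by n + l rounds, where l = 2 m.\<close>

definition cost_factor :: nat where
  "cost_factor = time_bound 1 preprocess_prog + 2 * time_bound 1 state_prog + 2 * time_bound 1 count_prog + 1"

theorem theorem8:
  shows "\<exists>(preprocess::com) (state_query::com) (count_query::com) (c::nat) (d::nat).
    \<forall>(n::nat) (E::nat set set) (nxt::nat arc \<Rightarrow> nat arc) (S\<^sub>0::nat rr_state) (es::nat arc list)
      (M::memory) (m::nat) (k::nat).
      connected_graph {..<n} E \<longrightarrow> m = card E \<longrightarrow>
      cyclic_orderings {..<n} E nxt \<longrightarrow>
      valid_state {..<n} E S\<^sub>0 \<longrightarrow> k = (\<Sum>v<n. tokens S\<^sub>0 v) \<longrightarrow>
      distinct es \<longrightarrow> set es = arcs E \<longrightarrow>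
      input_memory n E es nxt S\<^sub>0 M \<longrightarrow>
      (\<exists>(time::nat) (space::nat) (M\<^sub>0::memory).
        exec ((n + m + k) ^ d) space preprocess M time M\<^sub>0 \<and>
        real time \<le> c * (real n + real m + log 2 k) ^ d \<and>
        real space \<le> c * (real n + real m + log 2 k) ^ d \<and>
        (\<forall>M\<^sub>1 \<tau>. after_queries (\<lambda>\<tau>. (n + m + k + \<tau>) ^ d) state_query count_query
                   (length es) M\<^sub>0 M\<^sub>1 \<longrightarrow>
          (\<exists>t M'. exec ((n + m + k + \<tau>) ^ d) ((n + m + k + \<tau>) ^ d)
                    state_query (pose_state_query \<tau> M\<^sub>1) t M' \<and>
                  t \<le> c * (n + m) \<and>
                  output_state n es (state_at E nxt S\<^sub>0 \<tau>) M') \<and>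
          (\<forall>e j. encodes_arc es j e \<longrightarrow>
            (\<exists>t M'. exec ((n + m + k + \<tau>) ^ d) ((n + m + k + \<tau>) ^ d)
                      count_query (pose_count_query \<tau> j M\<^sub>1) t M' \<and>
                    t \<le> c * (n + m) \<and>
                    output_count (cumulative_load E nxt S\<^sub>0 \<tau> e) M'))))"
proof (rule exI[of _ preprocess_prog], rule exI[of _ state_prog], rule exI[of _ count_prog],
    rule exI[of _ cost_factor], rule exI[of _ cost_exponent], intro allI impI, goal_cases)
  case (1 n E nxt S\<^sub>0 es M m k)
  interpret rotor_graph n E nxt S\<^sub>0 es
    by unfold_locales (use 1 in simp_all)
  note m = 1(2) and k = 1(5) and M = 1(8)
  define \<beta> where "\<beta> = real n + real m + log 2 k"
  define nx ptr where "nx = M ''next''" and "ptr = M ''pointer''"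
  define l where "l = length es"
  obtain g where g: "k < 2 ^ g" "\<forall>i<g. 2 ^ i \<le> k" "real g \<le> log 2 k + 1" "g \<le> k"
    by (rule two_power_log_bounds)
  define T where "T = (g + 1) * l ^ 20"
  define G where "G = T + 2 * (l * l) + n + l + 3"
  define B where "B = n + m + k"
  define d where "d = cost_exponent"
  have l: "l = 2 * m" "2 \<le> l"
    using length_es l_ge by (simp_all add: l_def m)
  have n: "1 \<le> n"
    using src_less[of 0] l(2) unfolding l_def by linarith
  have W: "W = 2 * (l * l)"
    by (simp add: W_def l_def)
  have \<beta>: "2 \<le> \<beta>" "real n \<le> \<beta>" "real m \<le> \<beta>" "real (g + 1) \<le> \<beta>"
    using n l g(3) log_of_nat_nonneg[of k] by (simp_all add: \<beta>_def)
  have square: "real l \<le> x ^ 2" if "2 \<le> x" "real m \<le> x" for x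
  proof -
    have "2 * real m \<le> x * x"
      using that by (intro mult_mono) auto
    then show ?thesis
      by (simp add: l(1) power2_eq_square)
  qed
  have G_\<beta>: "real G \<le> \<beta> ^ 44"
    unfolding G_def T_def by (rule magnitude_le) (use \<beta> square in simp_all)
  have B: "2 \<le> B" "k + 1 \<le> B"
    using n l by (simp_all add: B_def)
  have "real G \<le> real B ^ 44"
    unfolding G_def T_def
    by (rule magnitude_le) (use B g(4) square[of "real B"] n l in \<open>simp_all add: B_def\<close>)
  then have G_B: "G \<le> B ^ 44"
    by (simp flip: of_nat_power)
  have d: "100 \<le> d" "44 * nesting preprocess_prog \<le> d" "88 \<le> d"
    by (simp_all add: d_def cost_exponent_def)
  have GG: "G * G * (k + 1) \<le> B ^ d"
  proof -
    have "G * G * (k + 1) \<le> B ^ 44 * B ^ 44 * B"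
      using G_B B(2) by (intro mult_le_mono)
    also have "\<dots> = B ^ 89"
      by (simp flip: power_add power_Suc2)
    also have "\<dots> \<le> B ^ d"
      using B(1) d(1) by (intro power_increasing) auto
    finally show ?thesis .
  qed
  have nx: "\<forall>j<length es. nx j < length es \<and> es ! nx j = nxt (es ! j)"
    using M by (simp add: input_memory_def encodes_arc_def nx_def)
  have ptr: "\<forall>v<n. ptr v < length es \<and> es ! ptr v = pointer S\<^sub>0 v"
    using M by (simp add: input_memory_def encodes_arc_def ptr_def)
  have settled: "settled T"
    unfolding T_def l_def by (rule settled_horizon) (use g(1) k in simp)
  \<comment> \<open>Instantiated twice with the same T: preprocessing loops run up to G rounds in
    space \<open>G * G\<close>, query loops at most n + l rounds with words that grow with
    \<tau>.\<close>
  have rotor_program: "rotor_program n l src dst rev pos (tokens S\<^sub>0) w s Z (l + 1) G nx ptr T k"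
    if "G * G * (k + 1) \<le> w" "G * G \<le> s" "s \<le> w" "n + l \<le> Z" for w s Z
    unfolding l_def
  proof (rule rotor_programI[OF nx ptr])
    show "machine w s Z (length es) (length es + 1) G"
      using that by unfold_locales (simp_all add: G_def l_def)
  qed (use that k in \<open>simp_all add: G_def W\<close>)
  have "G * G \<le> G * G * (k + 1)"
    by simp
  with GG have "G * G \<le> B ^ d"
    by (rule order_trans[rotated])
  interpret pre: rotor_program n l src dst rev pos "tokens S\<^sub>0" "B ^ d" "G * G" G "l + 1" G nx ptr T k
    by (rule rotor_program) (use GG \<open>G * G \<le> B ^ d\<close> in \<open>simp_all add: G_def\<close>)
  have "runs (B ^ d) (G * G) G preprocess_prog M pre.tables"
    by (rule pre.runs_preprocess[where m = m and g = g])
      (use M settled l g T_def W in \<open>simp_all add: input_memory_def m src_def dst_def nx_def ptr_def l_def G_def\<close>)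
  then obtain time M\<^sub>0 where pre: "exec (B ^ d) (G * G) preprocess_prog M time M\<^sub>0"
    "time \<le> time_bound G preprocess_prog" "pre.tables M\<^sub>0"
    unfolding runs_def by blast
  have "time_bound G preprocess_prog \<le> time_bound 1 preprocess_prog * G ^ nesting preprocess_prog"
    by (rule time_bound_le) (simp add: G_def)
  then have "real time \<le> real (time_bound 1 preprocess_prog) * real G ^ nesting preprocess_prog"
    using pre(2) by (simp flip: of_nat_power of_nat_mult)
  also have "\<dots> \<le> real cost_factor * (\<beta> ^ 44) ^ nesting preprocess_prog"
    using G_\<beta> by (intro mult_mono power_mono) (simp_all add: cost_factor_def)
  also have "\<dots> = real cost_factor * \<beta> ^ (44 * nesting preprocess_prog)"
    by (simp only: power_mult)
  also have "\<dots> \<le> real cost_factor * \<beta> ^ d"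
    using \<beta>(1) d(2) by (intro mult_left_mono power_increasing) simp_all
  finally have time: "real time \<le> real cost_factor * \<beta> ^ d" .
  have "real (G * G) \<le> \<beta> ^ 44 * \<beta> ^ 44"
    unfolding of_nat_mult using G_\<beta> \<beta>(1) by (intro mult_mono) simp_all
  also have "\<dots> = \<beta> ^ 88"
    by (simp flip: power_add)
  also have "\<dots> \<le> \<beta> ^ d"
    using \<beta>(1) d(3) by (intro power_increasing) simp_all
  also have "\<dots> \<le> real cost_factor * \<beta> ^ d"
    using \<beta>(1) by (simp add: cost_factor_def)
  finally have space: "real (G * G) \<le> real cost_factor * \<beta> ^ d" .
  have query: "(\<exists>t M'. exec ((B + \<tau>) ^ d) ((B + \<tau>) ^ d) state_prog (pose_state_query \<tau> M\<^sub>1) t M' \<and>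
        t \<le> cost_factor * (n + m) \<and> output_state n es (state_at E nxt S\<^sub>0 \<tau>) M') \<and>
      (\<forall>e j. encodes_arc es j e \<longrightarrow>
        (\<exists>t M'. exec ((B + \<tau>) ^ d) ((B + \<tau>) ^ d) count_prog (pose_count_query \<tau> j M\<^sub>1) t M' \<and>
          t \<le> cost_factor * (n + m) \<and> output_count (cumulative_load E nxt S\<^sub>0 \<tau> e) M'))"
    if after: "after_queries (\<lambda>\<tau>. (B + \<tau>) ^ d) state_prog count_prog (length es) M\<^sub>0 M\<^sub>1" for M\<^sub>1 \<tau>
  proof -
    define w where "w = (B + \<tau>) ^ d"
    have "B ^ d \<le> w"
      unfolding w_def by (intro power_mono) simp_all
    then have w: "G * G * (k + 1) \<le> w" "G * G \<le> w"
      using GG \<open>G * G \<le> B ^ d\<close> by linarith+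
    have "(\<tau> + 1) * (k + 1) \<le> (B + \<tau>) * (B + \<tau>)"
      using B by (intro mult_le_mono) simp_all
    also have "\<dots> = (B + \<tau>) ^ 2"
      by (simp add: power2_eq_square)
    also have "\<dots> \<le> w"
      unfolding w_def using B(1) d(1) by (intro power_increasing) simp_all
    finally have \<tau>: "(\<tau> + 1) * (k + 1) \<le> w" .
    interpret q: rotor_program n l src dst rev pos "tokens S\<^sub>0" w w "n + l" "l + 1" G nx ptr T k
      by (rule rotor_program) (use w in simp_all)
    let ?X = "{''tau'', ''arc''} \<union> writes state_prog \<union> writes count_prog"
    have "frame ?X M\<^sub>0 M\<^sub>1"
      unfolding frame_def by (intro allI impI after_queries_frame[OF after])
    \<comment> \<open>\<open>tables\<close> depends neither on the word and space bounds nor on Z,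
      so the predicate established by preprocessing is the one that queries require.\<close>
    then have tables: "q.tables M\<^sub>1"
      by (rule q.tables_frame[OF pre(3)]) (simp add: q.table_names_def q.input_names_def)
    have linear: "t \<le> cost_factor * (n + m)" if "t \<le> time_bound (n + l) c" "nesting c \<le> 1"
      "2 * time_bound 1 c \<le> cost_factor" for t c
    proof -
      have "t \<le> time_bound 1 c * (n + l) ^ nesting c"
        using that(1) time_bound_le[of "n + l" c] n by simp
      also have "\<dots> \<le> time_bound 1 c * (n + l) ^ 1"
        using that(2) n by (intro mult_le_mono2 power_increasing) simp_all
      also have "\<dots> \<le> 2 * time_bound 1 c * (n + m)"
        using l(1) by (simp add: algebra_simps)
      also have "\<dots> \<le> cost_factor * (n + m)"
        using that(3) by (rule mult_le_mono1)
      finally show ?thesis .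
    qed
    have "frame {''tau''} M\<^sub>1 (pose_state_query \<tau> M\<^sub>1)"
      by (simp add: frame_def pose_state_query_def set_scalar_def)
    then have "q.tables (pose_state_query \<tau> M\<^sub>1)"
      by (rule q.tables_frame[OF tables]) (simp add: q.table_names_def q.input_names_def)
    from q.runs_state_prog[OF settled[folded l_def] \<tau> this] obtain t M' where state:
      "exec w w state_prog (pose_state_query \<tau> M\<^sub>1) t M'" "t \<le> time_bound (n + l) state_prog"
      "\<forall>v<n. M' ''out_tokens'' v = U (Suc \<tau>) v - U \<tau> v \<and> M' ''out_pointer'' v = (nx ^^ (U \<tau> v mod deg v)) (ptr v)"
      unfolding runs_def by (auto simp: pose_state_query_def set_scalar_def l_def simp del: U.simps)
    have "output_state n es (state_at E nxt S\<^sub>0 \<tau>) M'"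
      unfolding output_state_def encodes_arc_def
    proof (intro allI impI)
      fix v assume v: "v < n"
      have "(nxt ^^ (U \<tau> v mod deg v)) (pointer S\<^sub>0 v) = (nxt ^^ U \<tau> v) (pointer S\<^sub>0 v)"
        using cycle_funpow(1)[OF cyclic[OF v] finite_out pointer_out[OF v]] unfolding deg_eq by (rule funpow_mod_eq)
      then show "(M' ''out_pointer'' v < length es \<and> es ! M' ''out_pointer'' v = pointer (state_at E nxt S\<^sub>0 \<tau>) v) \<and>
          M' ''out_tokens'' v = tokens (state_at E nxt S\<^sub>0 \<tau>) v"
        using state(3) v state_at_eq[OF v, of \<tau>] nth_funpow[OF nx, of "ptr v" "U \<tau> v mod deg v"] ptr
        by (simp del: U.simps)
    qed
    moreover have "t \<le> cost_factor * (n + m)"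
      by (rule linear[OF state(2)]) (simp_all add: cost_factor_def)
    moreover have "\<exists>t M'. exec w w count_prog (pose_count_query \<tau> j M\<^sub>1) t M' \<and>
        t \<le> cost_factor * (n + m) \<and> output_count (cumulative_load E nxt S\<^sub>0 \<tau> e) M'"
      if "encodes_arc es j e" for e j
    proof -
      have j: "j < length es" "e = es ! j"
        using that by (simp_all add: encodes_arc_def)
      have "frame {''tau'', ''arc''} M\<^sub>1 (pose_count_query \<tau> j M\<^sub>1)"
        by (simp add: frame_def pose_count_query_def set_scalar_def)
      then have "q.tables (pose_count_query \<tau> j M\<^sub>1)"
        by (rule q.tables_frame[OF tables]) (simp add: q.table_names_def q.input_names_def)
      from q.runs_count_prog[OF settled[folded l_def] \<tau> this, of j] obtain t M' where count:
        "exec w w count_prog (pose_count_query \<tau> j M\<^sub>1) t M'" "t \<le> time_bound (n + l) count_prog"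
        "M' ''count'' 0 = C \<tau> j"
        using j(1) unfolding runs_def by (auto simp: pose_count_query_def set_scalar_def l_def simp del: C.simps)
      have "t \<le> cost_factor * (n + m)"
        by (rule linear[OF count(2)]) (simp_all add: cost_factor_def)
      with count(1,3) show ?thesis
        using cumulative_load_eq[OF j(1)] by (auto simp: output_count_def j(2))
    qed
    ultimately show ?thesis
      using state(1) unfolding w_def by blast
  qed
  show ?case
    using pre(1) time space query unfolding B_def d_def \<beta>_def by blast
qed

end
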